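(* Over the standard structure $\mathbb{N}$ of arithmetic, a relation $X\subseteq\mathbb{N}^k$ is definable by a formula of $\mathrm{BndSCL}$ (i.e., there is $\varphi(x_1,\dots,x_k)$ with $(m_1,\dots,m_k)\in X$ iff $\mathbb{N},[m_i/x_i]\models_\omega\varphi$) if and only if $X$ is a $\Sigma^0_{\omega+1}$-relation.
   Context: Fix a reasonable Gödel numbering $\ulcorner\cdot\urcorner$ of formulas of first-order arithmetic and let $T=\{\ulcorner\varphi\urcorner : \varphi$ a first-order sentence in prenex normal form with $\mathbb{N}\models\varphi\}$. A relation $X\subseteq\mathbb{N}^k$ is $\Sigma^0_{\omega+1}$ if there is a relation $R\subseteq\mathbb{N}^{k+\ell}$ computable by a Turing machine with oracle access to (the characteristic function of) $T$ such that $(x_1,\dots,x_k)\in X$ iff $\exists y_1\dots\exists y_\ell\,R(x_1,\dots,x_k,y_1,\dots,y_\ell)$. Syntax of $\mathrm{BndSCL}$. $\mathrm{FO}$ has equality and $\bot$ as primitives and $\neg,\wedge,\vee,\exists,\forall$. Fix label symbols $L_0,L_1,\dots$ and for each $L$ a claim symbol $C_L$. Formulas: $\mathrm{FO}$ formation rules plus: each $C_L$ is atomic (no free variables); if $\varphi$ is a formula, $L\varphi$ is a formula (same free variables). FO-atoms are atomic formulas of $\mathrm{FO}$. The reference formula of an occurrence of $C_L$ is the subformula occurrence $L\psi$ above it in the syntax tree with no occurrence of $L$ strictly between (if any). Semantics. $\mathcal{G}_n(\mathfrak{A},s,\varphi)$ has positions $(\psi,r,\#,m)$, $\#\in\{+,-\}$,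 clock $m$, starting at $(\varphi,s,+,n)$. FO-atom $\alpha$: if $\#=+$ Eloise wins iff $\mathfrak{A},r\models\alpha$, else Abelard; if $\#=-$ Abelard wins iff $\mathfrak{A},r\models\alpha$, else Eloise. $\neg$ flips the sign. $\wedge$: Abelard chooses if $+$, Eloise if $-$. $\vee$: Eloise if $+$, Abelard if $-$. $\forall x$: Abelard picks $a\in A$ if $+$, Eloise if $-$, assignment becomes $r[a/x]$. $\exists x$: Eloise if $+$, Abelard if $-$. $L\psi$: move to $\psi$. $C_L$: if $m>0$ move to its reference formula with clock $m-1$; if $m=0$ (or no reference formula) the play ends with no winner. $\mathcal{G}_\omega$: Abelard picks $n'$, Eloise picks $n\ge n'$, then $\mathcal{G}_n$. $\mathfrak{A},s\models_\omega\varphi$ iff Eloise has a winning strategy in $\mathcal{G}_\omega(\mathfrak{A},s,\varphi)$. *)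

theory Defs
  imports "HOL-Library.Nat_Bijection" "HOL-Library.Sublist"
begin

section \<open>First-order arithmetic\<close>

datatype trm = Var nat | Zero | Succ trm | Add trm trm | Mul trm trm

datatype atom = Falsum | Equal trm trm | Less trm trm

datatype fo =
    FAtom atom
  | FNeg fo
  | FConj fo fo
  | FDisj fo fo
  | FExists nat fo
  | FForall nat fo

primrec trm_vars :: "trm \<Rightarrow> nat set" where
  "trm_vars (Var x) = {x}"
| "trm_vars Zero = {}"
| "trm_vars (Succ t) = trm_vars t"
| "trm_vars (Add t u) = trm_vars t \<union> trm_vars u"
| "trm_vars (Mul t u) = trm_vars t \<union> trm_vars u"

primrec atom_vars :: "atom \<Rightarrow> nat set" where
  "atom_vars Falsum = {}"
| "atom_vars (Equal t u) = trm_vars t \<union> trm_vars u"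
| "atom_vars (Less t u) = trm_vars t \<union> trm_vars u"

primrec fo_free :: "fo \<Rightarrow> nat set" where
  "fo_free (FAtom \<alpha>) = atom_vars \<alpha>"
| "fo_free (FNeg \<phi>) = fo_free \<phi>"
| "fo_free (FConj \<phi> \<psi>) = fo_free \<phi> \<union> fo_free \<psi>"
| "fo_free (FDisj \<phi> \<psi>) = fo_free \<phi> \<union> fo_free \<psi>"
| "fo_free (FExists x \<phi>) = fo_free \<phi> - {x}"
| "fo_free (FForall x \<phi>) = fo_free \<phi> - {x}"

text \<open>The only structure considered is the standard one, with domain \<^typ>\<open>nat\<close>.\<close>

type_synonym assignment = "nat \<Rightarrow> nat"

primrec trm_val :: "assignment \<Rightarrow> trm \<Rightarrow> nat" where
  "trm_val r (Var x) = r x"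
| "trm_val r Zero = 0"
| "trm_val r (Succ t) = Suc (trm_val r t)"
| "trm_val r (Add t u) = trm_val r t + trm_val r u"
| "trm_val r (Mul t u) = trm_val r t * trm_val r u"

primrec atom_true :: "assignment \<Rightarrow> atom \<Rightarrow> bool" where
  "atom_true r Falsum \<longleftrightarrow> False"
| "atom_true r (Equal t u) \<longleftrightarrow> trm_val r t = trm_val r u"
| "atom_true r (Less t u) \<longleftrightarrow> trm_val r t < trm_val r u"

primrec fo_true :: "assignment \<Rightarrow> fo \<Rightarrow> bool" where
  "fo_true r (FAtom \<alpha>) \<longleftrightarrow> atom_true r \<alpha>"
| "fo_true r (FNeg \<phi>) \<longleftrightarrow> \<not> fo_true r \<phi>"
| "fo_true r (FConj \<phi> \<psi>) \<longleftrightarrow> fo_true r \<phi> \<and> fo_true r \<psi>"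
| "fo_true r (FDisj \<phi> \<psi>) \<longleftrightarrow> fo_true r \<phi> \<or> fo_true r \<psi>"
| "fo_true r (FExists x \<phi>) \<longleftrightarrow> (\<exists>a. fo_true (r(x := a)) \<phi>)"
| "fo_true r (FForall x \<phi>) \<longleftrightarrow> (\<forall>a. fo_true (r(x := a)) \<phi>)"

primrec quantifier_free :: "fo \<Rightarrow> bool" where
  "quantifier_free (FAtom \<alpha>) \<longleftrightarrow> True"
| "quantifier_free (FNeg \<phi>) \<longleftrightarrow> quantifier_free \<phi>"
| "quantifier_free (FConj \<phi> \<psi>) \<longleftrightarrow> quantifier_free \<phi> \<and> quantifier_free \<psi>"
| "quantifier_free (FDisj \<phi> \<psi>) \<longleftrightarrow> quantifier_free \<phi> \<and> quantifier_free \<psi>"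
| "quantifier_free (FExists x \<phi>) \<longleftrightarrow> False"
| "quantifier_free (FForall x \<phi>) \<longleftrightarrow> False"

inductive prenex :: "fo \<Rightarrow> bool" where
  "quantifier_free \<phi> \<Longrightarrow> prenex \<phi>"
| "prenex \<phi> \<Longrightarrow> prenex (FExists x \<phi>)"
| "prenex \<phi> \<Longrightarrow> prenex (FForall x \<phi>)"

text \<open>Goedel numbers: a tag for the outermost symbol, paired with the codes of its arguments.\<close>

primrec trm_code :: "trm \<Rightarrow> nat" where
  "trm_code (Var x) = prod_encode (0, x)"
| "trm_code Zero = prod_encode (1, 0)"
| "trm_code (Succ t) = prod_encode (2, trm_code t)"
| "trm_code (Add t u) = prod_encode (3, prod_encode (trm_code t, trm_code u))"
| "trm_code (Mul t u) = prod_encode (4, prod_encode (trm_code t, trm_code u))"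

primrec atom_code :: "atom \<Rightarrow> nat" where
  "atom_code Falsum = prod_encode (0, 0)"
| "atom_code (Equal t u) = prod_encode (1, prod_encode (trm_code t, trm_code u))"
| "atom_code (Less t u) = prod_encode (2, prod_encode (trm_code t, trm_code u))"

primrec goedel :: "fo \<Rightarrow> nat" where
  "goedel (FAtom \<alpha>) = prod_encode (0, atom_code \<alpha>)"
| "goedel (FNeg \<phi>) = prod_encode (1, goedel \<phi>)"
| "goedel (FConj \<phi> \<psi>) = prod_encode (2, prod_encode (goedel \<phi>, goedel \<psi>))"
| "goedel (FDisj \<phi> \<psi>) = prod_encode (3, prod_encode (goedel \<phi>, goedel \<psi>))"
| "goedel (FExists x \<phi>) = prod_encode (4, prod_encode (x, goedel \<phi>))"
| "goedel (FForall x \<phi>) = prod_encode (5, prod_encode (x, goedel \<phi>))"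

lemma trm_code_inject: "trm_code t = trm_code u \<longleftrightarrow> t = u"
proof (induction t arbitrary: u)
  case (Var x) then show ?case by (cases u) auto
next
  case Zero then show ?case by (cases u) auto
next
  case (Succ t) then show ?case by (cases u) auto
next
  case (Add t1 t2) then show ?case by (cases u) auto
next
  case (Mul t1 t2) then show ?case by (cases u) auto
qed

lemma atom_code_inject: "atom_code \<alpha> = atom_code \<beta> \<longleftrightarrow> \<alpha> = \<beta>"
  by (cases \<alpha>; cases \<beta>) (auto simp: trm_code_inject)

lemma goedel_inject: "goedel \<phi> = goedel \<psi> \<longleftrightarrow> \<phi> = \<psi>"
proof (induction \<phi> arbitrary: \<psi>)
  case (FAtom \<alpha>) then show ?case by (cases \<psi>) (auto simp: atom_code_inject)
next
  case (FNeg \<phi>) then show ?case by (cases \<psi>) auto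
next
  case (FConj \<phi>1 \<phi>2) then show ?case by (cases \<psi>) auto
next
  case (FDisj \<phi>1 \<phi>2) then show ?case by (cases \<psi>) auto
next
  case (FExists x \<phi>) then show ?case by (cases \<psi>) auto
next
  case (FForall x \<phi>) then show ?case by (cases \<psi>) auto
qed

text \<open>Sentences have no free variables, so truth does not depend on the assignment.\<close>

definition true_arithmetic :: "nat set" where
  "true_arithmetic =
     {goedel \<phi> | \<phi>. prenex \<phi> \<and> fo_free \<phi> = {} \<and> (\<forall>r. fo_true r \<phi>)}"


section \<open>Oracle Turing machines\<close>

text \<open>
  A deterministic machine has finitely many two-way infinite work tapes and one
  further read-only tape carrying the characteristic function of the oracle: cell
  \<open>i \<ge> 0\<close> holds \<open>Some True\<close> or \<open>Some False\<close> according to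
  whether \<open>i\<close> belongs to the oracle, and the cells left of the origin hold
  the blank \<^const>\<open>None\<close>.  States and work symbols are the numbers below
  \<open>nstates\<close> and \<open>nsymbols\<close>; symbol 0 is the blank.
  A transition maps the state, the symbols scanned on the work tapes and the symbol
  scanned on the oracle tape to the next state, the symbols written, the moves of the
  work heads and the move of the oracle head.
\<close>

datatype move = MLeft | MStay | MRight

primrec offset :: "move \<Rightarrow> int" where
  "offset MLeft = -1"
| "offset MStay = 0"
| "offset MRight = 1"

record otm =
  ntapes :: nat
  nstates :: nat
  nsymbols :: nat
  start :: nat
  accept :: nat
  reject :: nat
  delta :: "nat \<Rightarrow> nat list \<Rightarrow> bool option \<Rightarrow> nat \<times> nat list \<times> move list \<times> move"

definition wf_otm :: "otm \<Rightarrow> bool" where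
  "wf_otm M \<longleftrightarrow>
     ntapes M \<ge> 1 \<and> nsymbols M \<ge> 2 \<and>
     start M < nstates M \<and> accept M < nstates M \<and> reject M < nstates M \<and>
     accept M \<noteq> reject M \<and>
     (\<forall>q v c. q < nstates M \<and> length v = ntapes M \<and> set v \<subseteq> {..<nsymbols M} \<longrightarrow>
        (case delta M q v c of (q', w, d, e) \<Rightarrow>
           q' < nstates M \<and> length w = ntapes M \<and> set w \<subseteq> {..<nsymbols M} \<and>
           length d = ntapes M))"

record config =
  state :: nat
  tape :: "nat \<Rightarrow> int \<Rightarrow> nat"
  head :: "nat \<Rightarrow> int"
  ohead :: int

definition oracle_cell :: "nat set \<Rightarrow> int \<Rightarrow> bool option" where
  "oracle_cell A i = (if i < 0 then None else Some (nat i \<in> A))"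

definition step :: "otm \<Rightarrow> nat set \<Rightarrow> config \<Rightarrow> config" where
  "step M A c =
     (if state c = accept M \<or> state c = reject M then c
      else case delta M (state c) (map (\<lambda>t. tape c t (head c t)) [0..<ntapes M])
                  (oracle_cell A (ohead c)) of
        (q', w, d, e) \<Rightarrow>
          \<lparr>state = q',
           tape = (\<lambda>t. if t < ntapes M then (tape c t)(head c t := w ! t) else tape c t),
           head = (\<lambda>t. if t < ntapes M then head c t + offset (d ! t) else head c t),
           ohead = ohead c + offset e\<rparr>)"

text \<open>Inputs are written in unary on tape 0, each number being followed by a blank.\<close>

definition input_word :: "nat list \<Rightarrow> nat list" where
  "input_word xs = concat (map (\<lambda>x. replicate x 1 @ [0]) xs)"

definition init_config :: "otm \<Rightarrow> nat list \<Rightarrow> config" where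
  "init_config M xs =
     \<lparr>state = start M,
      tape = (\<lambda>t i. if t = 0 \<and> 0 \<le> i \<and> nat i < length (input_word xs)
                     then input_word xs ! nat i else 0),
      head = (\<lambda>t. 0),
      ohead = 0\<rparr>"

definition computable_in :: "nat set \<Rightarrow> nat \<Rightarrow> nat list set \<Rightarrow> bool" where
  "computable_in A n R \<longleftrightarrow>
     R \<subseteq> {xs. length xs = n} \<and>
     (\<exists>M. wf_otm M \<and>
        (\<forall>xs. length xs = n \<longrightarrow>
           (\<exists>t. state ((step M A ^^ t) (init_config M xs)) =
                (if xs \<in> R then accept M else reject M))))"

definition sigma_omega_plus_1 :: "nat \<Rightarrow> nat list set \<Rightarrow> bool" where
  "sigma_omega_plus_1 k X \<longleftrightarrow>
     X \<subseteq> {xs. length xs = k} \<and>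
     (\<exists>l R. computable_in true_arithmetic (k + l) R \<and>
        (\<forall>xs. length xs = k \<longrightarrow>
           (xs \<in> X \<longleftrightarrow> (\<exists>ys. length ys = l \<and> xs @ ys \<in> R))))"


section \<open>The logic BndSCL\<close>

datatype scl =
    Atom atom
  | Neg scl
  | Conj scl scl
  | Disj scl scl
  | Exists nat scl
  | Forall nat scl
  | Label nat scl
  | Claim nat

primrec scl_free :: "scl \<Rightarrow> nat set" where
  "scl_free (Atom \<alpha>) = atom_vars \<alpha>"
| "scl_free (Neg \<phi>) = scl_free \<phi>"
| "scl_free (Conj \<phi> \<psi>) = scl_free \<phi> \<union> scl_free \<psi>"
| "scl_free (Disj \<phi> \<psi>) = scl_free \<phi> \<union> scl_free \<psi>"
| "scl_free (Exists x \<phi>) = scl_free \<phi> - {x}"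
| "scl_free (Forall x \<phi>) = scl_free \<phi> - {x}"
| "scl_free (Label L \<phi>) = scl_free \<phi>"
| "scl_free (Claim L) = {}"

text \<open>
  Subformula occurrences are represented by their addresses, that is, by the paths of child
  indices leading to them from the root of the syntax tree.
\<close>

type_synonym address = "nat list"

primrec children :: "scl \<Rightarrow> scl list" where
  "children (Atom \<alpha>) = []"
| "children (Neg \<phi>) = [\<phi>]"
| "children (Conj \<phi> \<psi>) = [\<phi>, \<psi>]"
| "children (Disj \<phi> \<psi>) = [\<phi>, \<psi>]"
| "children (Exists x \<phi>) = [\<phi>]"
| "children (Forall x \<phi>) = [\<phi>]"
| "children (Label L \<phi>) = [\<phi>]"
| "children (Claim L) = []"

fun subformula_at :: "scl \<Rightarrow> address \<Rightarrow> scl option" where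
  "subformula_at \<phi> [] = Some \<phi>"
| "subformula_at \<phi> (i # p) =
     (if i < length (children \<phi>) then subformula_at (children \<phi> ! i) p else None)"

definition label_at :: "scl \<Rightarrow> address \<Rightarrow> nat \<Rightarrow> bool" where
  "label_at \<phi> p L \<longleftrightarrow> (\<exists>\<psi>. subformula_at \<phi> p = Some (Label L \<psi>))"

text \<open>\<open>q\<close> is the address of the reference formula of the claim \<open>Claim L\<close> at \<open>p\<close>.\<close>

definition is_reference :: "scl \<Rightarrow> address \<Rightarrow> nat \<Rightarrow> address \<Rightarrow> bool" where
  "is_reference \<phi> p L q \<longleftrightarrow>
     strict_prefix q p \<and> label_at \<phi> q L \<and>
     (\<forall>q'. strict_prefix q q' \<and> strict_prefix q' p \<longrightarrow> \<not> label_at \<phi> q' L)"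

datatype player = Eloise | Abelard

datatype sign = Plus | Minus

primrec flip :: "sign \<Rightarrow> sign" where
  "flip Plus = Minus"
| "flip Minus = Plus"

text \<open>
  In \<open>Init\<close> Abelard is to pick the lower bound \<open>n'\<close>, and in
  \<open>Bound n'\<close> Eloise is to pick the clock value.
\<close>

datatype position =
    Init
  | Bound nat
  | Position address assignment sign nat

fun moves :: "scl \<Rightarrow> assignment \<Rightarrow> position \<Rightarrow> position set" where
  "moves \<phi> s Init = {Bound n' | n'. True}"
| "moves \<phi> s (Bound n') = {Position [] s Plus n | n. n \<ge> n'}"
| "moves \<phi> s (Position p r b m) =
     (case subformula_at \<phi> p of
        None \<Rightarrow> {}
      | Some (Atom \<alpha>) \<Rightarrow> {}
      | Some (Neg \<psi>) \<Rightarrow> {Position (p @ [0]) r (flip b) m}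
      | Some (Conj \<psi> \<theta>) \<Rightarrow> {Position (p @ [0]) r b m, Position (p @ [1]) r b m}
      | Some (Disj \<psi> \<theta>) \<Rightarrow> {Position (p @ [0]) r b m, Position (p @ [1]) r b m}
      | Some (Exists x \<psi>) \<Rightarrow> {Position (p @ [0]) (r(x := a)) b m | a. True}
      | Some (Forall x \<psi>) \<Rightarrow> {Position (p @ [0]) (r(x := a)) b m | a. True}
      | Some (Label L \<psi>) \<Rightarrow> {Position (p @ [0]) r b m}
      | Some (Claim L) \<Rightarrow> {Position q r b (m - 1) | q. m > 0 \<and> is_reference \<phi> p L q})"

text \<open>The player who chooses the next move; \<^const>\<open>None\<close> if the move is forced or the play is over.\<close>

fun chooser :: "scl \<Rightarrow> position \<Rightarrow> player option" where
  "chooser \<phi> Init = Some Abelard"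
| "chooser \<phi> (Bound n') = Some Eloise"
| "chooser \<phi> (Position p r b m) =
     (case subformula_at \<phi> p of
        Some (Conj \<psi> \<theta>) \<Rightarrow> Some (if b = Plus then Abelard else Eloise)
      | Some (Disj \<psi> \<theta>) \<Rightarrow> Some (if b = Plus then Eloise else Abelard)
      | Some (Exists x \<psi>) \<Rightarrow> Some (if b = Plus then Eloise else Abelard)
      | Some (Forall x \<psi>) \<Rightarrow> Some (if b = Plus then Abelard else Eloise)
      | _ \<Rightarrow> None)"

text \<open>The winner of a play that has ended; \<^const>\<open>None\<close> also covers plays ending without a winner.\<close>

fun winner :: "scl \<Rightarrow> position \<Rightarrow> player option" where
  "winner \<phi> (Position p r b m) =
     (case subformula_at \<phi> p of
        Some (Atom \<alpha>) \<Rightarrow>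
          Some (if b = Plus then (if atom_true r \<alpha> then Eloise else Abelard)
                else (if atom_true r \<alpha> then Abelard else Eloise))
      | _ \<Rightarrow> None)"
| "winner \<phi> _ = None"

text \<open>
  Strategies map the history of a play (its positions so far, the current one last) to
  the next position.  A play is an infinite sequence which stays put once it has ended.
\<close>

type_synonym strategy = "position list \<Rightarrow> position"

definition legal :: "scl \<Rightarrow> assignment \<Rightarrow> strategy \<Rightarrow> bool" where
  "legal \<phi> s \<sigma> \<longleftrightarrow>
     (\<forall>h. h \<noteq> [] \<and> chooser \<phi> (last h) = Some Eloise \<longrightarrow> \<sigma> h \<in> moves \<phi> s (last h))"

definition play :: "scl \<Rightarrow> assignment \<Rightarrow> position \<Rightarrow> strategy \<Rightarrow> (nat \<Rightarrow> position) \<Rightarrow> bool" where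
  "play \<phi> s P \<sigma> \<pi> \<longleftrightarrow>
     \<pi> 0 = P \<and>
     (\<forall>i. if moves \<phi> s (\<pi> i) = {} then \<pi> (Suc i) = \<pi> i
          else \<pi> (Suc i) \<in> moves \<phi> s (\<pi> i) \<and>
               (chooser \<phi> (\<pi> i) = Some Eloise \<longrightarrow> \<pi> (Suc i) = \<sigma> (map \<pi> [0..<Suc i])))"

definition winning_strategy :: "scl \<Rightarrow> assignment \<Rightarrow> position \<Rightarrow> strategy \<Rightarrow> bool" where
  "winning_strategy \<phi> s P \<sigma> \<longleftrightarrow>
     legal \<phi> s \<sigma> \<and> (\<forall>\<pi>. play \<phi> s P \<sigma> \<pi> \<longrightarrow> (\<exists>i. winner \<phi> (\<pi> i) = Some Eloise))"

definition models_omega :: "assignment \<Rightarrow> scl \<Rightarrow> bool" where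
  "models_omega s \<phi> \<longleftrightarrow> (\<exists>\<sigma>. winning_strategy \<phi> s Init \<sigma>)"

text \<open>
  The variables \<open>x\<^sub>1, \<dots>, x\<^sub>k\<close> are the variables with indices \<open>0, \<dots>, k - 1\<close>.
  Assignments are total; the value 0 of the other variables is irrelevant, since they are
  not free in \<open>\<phi>\<close>.
\<close>

definition bndscl_definable :: "nat \<Rightarrow> nat list set \<Rightarrow> bool" where
  "bndscl_definable k X \<longleftrightarrow>
     X \<subseteq> {xs. length xs = k} \<and>
     (\<exists>\<phi>. scl_free \<phi> \<subseteq> {..<k} \<and>
        (\<forall>ms. length ms = k \<longrightarrow>
           (ms \<in> X \<longleftrightarrow> models_omega (\<lambda>i. if i < k then ms ! i else 0) \<phi>)))"

end

theory Submission
  imports Defs "HOL-Library.Countable"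
begin

text \<open>
  Winning \<open>\<G>\<^sub>\<omega>\<close> means winning \<open>\<G>\<^sub>n\<close> for some clock \<open>n\<close>, and this
  means winning within some finite number \<open>t\<close> of moves.  For fixed \<open>t\<close> the latter is expressed by a
  prenex sentence with \<open>t\<close> blocks of quantifiers for the announcements of Eloise and Abelard and the
  resulting positions; its Goedel number is computable from \<open>t\<close> and the arguments, so that a
  definable relation has the form \<open>\<exists>t. R\<close> with one query to the oracle deciding \<open>R\<close>.

  Conversely, a formula \<open>L \<psi>\<close> whose claims all refer to \<open>L\<close> acts as a recursive procedure whose
  arguments are passed in variables.  Evaluating a prenex sentence takes a number of calls bounded in
  terms of its Goedel number alone, so for a large clock one of the players wins and the evaluation
  may be used under either sign.  Hence the body can simulate an oracle machine step by step, each
  oracle answer being verified by a call of the evaluation procedure.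
\<close>

section \<open>Winning positions\<close>

text \<open>The sentence for \<open>t\<close> moves has a quantifier depth that grows with
  \<open>t\<close>; the oracle absorbs this growth, and the unbounded clock contributes the single
  existential quantifier in front. In the converse direction the obstacle is that a play whose clock
  runs out has no winner, so a claim under a negation does not express the complement. The
  evaluation procedures are therefore specified as relations settled by either sign: on every
  argument, numbers that code nothing and wrong values included, Eloise wins under
  \<open>Plus\<close> if the relation holds and under \<open>Minus\<close> if it fails, once the
  clock has reached an explicit rank. The machine simulation has no such bound on the clock and is
  used under \<open>Plus\<close> alone. A claim yields a winner and never a value. Hence values of
  terms and subformulas are guessed by quantifiers and each guess is verified by a further
  call.\<close>

lemma subformula_at_append:
  "subformula_at \<phi> (p @ q) = (case subformula_at \<phi> p of None \<Rightarrow> None | Some \<psi> \<Rightarrow> subformula_at \<psi> q)"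
  by (induction p arbitrary: \<phi>) auto

lemma length_address_le_size:
  "subformula_at \<phi> p = Some \<psi> \<Longrightarrow> length p \<le> size \<phi>"
proof (induction p arbitrary: \<phi>)
  case (Cons i p)
  from Cons.prems have i: "i < length (children \<phi>)"
    and *: "subformula_at (children \<phi> ! i) p = Some \<psi>" by (auto split: if_splits)
  have "size (children \<phi> ! i) < size \<phi>"
    using i by (cases \<phi>) (auto simp: less_Suc_eq)
  with Cons.IH[OF *] show ?case by simp
qed simp

definition move_measure :: "scl \<Rightarrow> position \<Rightarrow> nat \<times> nat \<times> nat" where
  "move_measure \<phi> P = (case P of Init \<Rightarrow> (2, 0, 0) | Bound n \<Rightarrow> (1, 0, 0)
     | Position p r b m \<Rightarrow> (0, m, Suc (size \<phi>) - length p))"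

text \<open>A claim lowers the clock; every other move inside the formula lengthens the address,
  whose length is bounded by the size of the formula; the two opening moves rank above all of
  these.\<close>

lemma wf_moves: "wf {(Q, P). Q \<in> moves \<phi> s P}"
proof (rule wf_subset)
  show "wf (inv_image (less_than <*lex*> less_than <*lex*> less_than) (move_measure \<phi>))"
    by (intro wf_inv_image wf_lex_prod wf_less_than)
  have "(Q, P) \<in> inv_image (less_than <*lex*> less_than <*lex*> less_than) (move_measure \<phi>)"
    if step: "Q \<in> moves \<phi> s P" for Q P
  proof (cases P)
    case (Position p r b m)
    then obtain \<psi> where \<psi>: "subformula_at \<phi> p = Some \<psi>"
      using step by (cases "subformula_at \<phi> p") auto
    then have "length p \<le> size \<phi>" by (rule length_address_le_size)
    then show ?thesis
      using step Position \<psi> by (cases \<psi>) (auto simp: move_measure_def)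
  qed (use step in \<open>auto simp: move_measure_def\<close>)
  then show "{(Q, P). Q \<in> moves \<phi> s P}
      \<subseteq> inv_image (less_than <*lex*> less_than <*lex*> less_than) (move_measure \<phi>)"
    by blast
qed

lemma moves_chooser_nonempty: "chooser \<phi> P = Some pl \<Longrightarrow> moves \<phi> s P \<noteq> {}"
  by (cases P) (auto split: option.splits scl.splits)

lemma winner_no_moves: "winner \<phi> P = Some pl \<Longrightarrow> moves \<phi> s P = {}"
  by (cases P) (auto split: option.splits scl.splits)

text \<open>Backward induction as a least fixed point. The premise on \<open>moves\<close> in
  \<open>other\<close> keeps stuck positions, such as a claim at clock 0, from being won
  vacuously.\<close>

inductive Win :: "scl \<Rightarrow> assignment \<Rightarrow> position \<Rightarrow> bool" for \<phi> s where
  won: "winner \<phi> P = Some Eloise \<Longrightarrow> Win \<phi> s P"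
| eloise: "chooser \<phi> P = Some Eloise \<Longrightarrow> Q \<in> moves \<phi> s P \<Longrightarrow> Win \<phi> s Q \<Longrightarrow> Win \<phi> s P"
| other: "chooser \<phi> P \<noteq> Some Eloise \<Longrightarrow> moves \<phi> s P \<noteq> {} \<Longrightarrow>
    (\<And>Q. Q \<in> moves \<phi> s P \<Longrightarrow> Win \<phi> s Q) \<Longrightarrow> Win \<phi> s P"

lemma Win_iff:
  "Win \<phi> s P \<longleftrightarrow>
     (if moves \<phi> s P = {} then winner \<phi> P = Some Eloise
      else if chooser \<phi> P = Some Eloise then \<exists>Q\<in>moves \<phi> s P. Win \<phi> s Q
      else \<forall>Q\<in>moves \<phi> s P. Win \<phi> s Q)"
  by (subst Win.simps) (auto dest: winner_no_moves)

text \<open>Contraposition: outside \<open>Win\<close>, every move of Eloise stays outside, and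
  every other position that is not a dead end has a successor outside. So some play consistent with
  \<open>\<sigma>\<close> never enters \<open>Win\<close>.\<close>

lemma Win_if_winning_strategy:
  assumes "winning_strategy \<phi> s P \<sigma>"
  shows "Win \<phi> s P"
proof (rule ccontr)
  assume P: "\<not> Win \<phi> s P"
  \<comment> \<open>The play is generated through its histories because \<open>\<sigma>\<close> may
    depend on all earlier positions.\<close>
  define nxt where "nxt h =
     (if moves \<phi> s (last h) = {} then last h
      else if chooser \<phi> (last h) = Some Eloise then \<sigma> h
      else (SOME Q. Q \<in> moves \<phi> s (last h) \<and> \<not> Win \<phi> s Q))" for h
  define H where "H i = ((\<lambda>h. h @ [nxt h]) ^^ i) [P]" for i
  define \<pi> where "\<pi> i = last (H i)" for i
  have H_Suc: "H (Suc i) = H i @ [nxt (H i)]" for i by (simp add: H_def)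
  have H: "H i = map \<pi> [0..<Suc i]" for i
  proof (induction i)
    case 0 show ?case by (simp add: H_def \<pi>_def)
  next
    case (Suc i)
    have "\<pi> (Suc i) = nxt (H i)" by (simp add: \<pi>_def H_Suc)
    then show ?case using Suc by (simp add: H_Suc)
  qed
  have H_ne: "H i \<noteq> []" for i by (simp add: H)
  have step: "(if moves \<phi> s (\<pi> i) = {} then \<pi> (Suc i) = \<pi> i
     else \<pi> (Suc i) \<in> moves \<phi> s (\<pi> i) \<and>
       (chooser \<phi> (\<pi> i) = Some Eloise \<longrightarrow> \<pi> (Suc i) = \<sigma> (map \<pi> [0..<Suc i]))) \<and>
     \<not> Win \<phi> s (\<pi> (Suc i))" if "\<not> Win \<phi> s (\<pi> i)" for i
  proof -
    have nx: "\<pi> (Suc i) = nxt (H i)" by (simp add: \<pi>_def H_Suc)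
    consider "moves \<phi> s (\<pi> i) = {}"
      | "moves \<phi> s (\<pi> i) \<noteq> {}" "chooser \<phi> (\<pi> i) = Some Eloise"
      | "moves \<phi> s (\<pi> i) \<noteq> {}" "chooser \<phi> (\<pi> i) \<noteq> Some Eloise" by blast
    then show ?thesis
    proof cases
      case 1 then show ?thesis using that nx by (simp add: nxt_def \<pi>_def)
    next
      case 2
      then have "\<pi> (Suc i) = \<sigma> (H i)" using nx by (simp add: nxt_def \<pi>_def)
      moreover have "\<sigma> (H i) \<in> moves \<phi> s (\<pi> i)"
        using assms 2 H_ne by (auto simp: winning_strategy_def legal_def \<pi>_def)
      moreover have "\<forall>Q\<in>moves \<phi> s (\<pi> i). \<not> Win \<phi> s Q"
        using that 2 by (subst (asm) Win_iff) auto
      ultimately show ?thesis using 2 H[of i] by simp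
    next
      case 3
      then have "\<exists>Q. Q \<in> moves \<phi> s (\<pi> i) \<and> \<not> Win \<phi> s Q"
        using that by (subst (asm) Win_iff) auto
      from someI_ex[OF this] show ?thesis using 3 nx by (simp add: nxt_def \<pi>_def)
    qed
  qed
  have "\<pi> 0 = P" by (simp add: \<pi>_def H_def)
  have inv: "\<not> Win \<phi> s (\<pi> i)" for i
  proof (induction i)
    case 0 then show ?case using P \<open>\<pi> 0 = P\<close> by simp
  next
    case (Suc i) then show ?case using step by blast
  qed
  then have "play \<phi> s P \<sigma> \<pi>" using step \<open>\<pi> 0 = P\<close> by (auto simp: play_def)
  then obtain i where "winner \<phi> (\<pi> i) = Some Eloise"
    using assms by (auto simp: winning_strategy_def)
  then show False using inv[of i] by (blast intro: Win.won)
qed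

lemma winning_strategy_if_Win:
  assumes "Win \<phi> s P"
  shows "\<exists>\<sigma>. winning_strategy \<phi> s P \<sigma>"
proof -
  \<comment> \<open>Legality binds Eloise at lost positions as well, so \<open>f\<close> has to
    supply a move there, too.\<close>
  define f where "f P = (SOME Q. Q \<in> moves \<phi> s P \<and> (Win \<phi> s P \<longrightarrow> Win \<phi> s Q))" for P
  have f: "f P \<in> moves \<phi> s P \<and> (Win \<phi> s P \<longrightarrow> Win \<phi> s (f P))"
    if "chooser \<phi> P = Some Eloise" for P
  proof -
    have "\<exists>Q. Q \<in> moves \<phi> s P \<and> (Win \<phi> s P \<longrightarrow> Win \<phi> s Q)"
      using that moves_chooser_nonempty[OF that, of s] Win_iff[of \<phi> s P] by auto
    from someI_ex[OF this] show ?thesis by (simp add: f_def)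
  qed
  have "winning_strategy \<phi> s P (\<lambda>h. f (last h))"
    unfolding winning_strategy_def
  proof (intro conjI allI impI)
    show "legal \<phi> s (\<lambda>h. f (last h))" using f by (simp add: legal_def)
    fix \<pi> assume \<pi>: "play \<phi> s P (\<lambda>h. f (last h)) \<pi>"
    have inv: "Win \<phi> s (\<pi> i)" for i
    proof (induction i)
      case 0 then show ?case using assms \<pi> by (simp add: play_def)
    next
      case (Suc i)
      show ?case
      proof (cases "moves \<phi> s (\<pi> i) = {}")
        case True then show ?thesis using Suc \<pi> by (auto simp: play_def)
      next
        case False
        then have "\<pi> (Suc i) \<in> moves \<phi> s (\<pi> i)"
          "chooser \<phi> (\<pi> i) = Some Eloise \<Longrightarrow> \<pi> (Suc i) = f (\<pi> i)"
          using \<pi> by (auto simp: play_def split: if_splits)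
        then show ?thesis using Suc False f[of "\<pi> i"] Win_iff[of \<phi> s "\<pi> i"]
          by (auto split: if_splits)
      qed
    qed
    \<comment> \<open>Well-foundedness forces a dead end, and a dead end inside \<open>Win\<close>
      is a victory of Eloise.\<close>
    obtain i where "moves \<phi> s (\<pi> i) = {}"
    proof -
      have "\<exists>i. (\<pi> (Suc i), \<pi> i) \<notin> {(Q, P). Q \<in> moves \<phi> s P}"
        using wf_moves[of \<phi> s] by (simp only: wf_iff_no_infinite_down_chain) blast
      then obtain i where "\<pi> (Suc i) \<notin> moves \<phi> s (\<pi> i)" by auto
      moreover have "moves \<phi> s (\<pi> i) \<noteq> {} \<longrightarrow> \<pi> (Suc i) \<in> moves \<phi> s (\<pi> i)"
        using \<pi> by (auto simp: play_def split: if_splits)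
      ultimately show ?thesis using that by blast
    qed
    then show "\<exists>i. winner \<phi> (\<pi> i) = Some Eloise"
      using inv[of i] by (subst (asm) Win_iff) auto
  qed
  then show ?thesis by blast
qed

section \<open>Winning positions by the shape of the subformula, and monotonicity in the
  clock\<close>

fun sub_win :: "scl \<Rightarrow> assignment \<Rightarrow> nat \<Rightarrow> address \<Rightarrow> assignment \<Rightarrow> sign \<Rightarrow> scl option \<Rightarrow> bool" where
  "sub_win \<phi> s m p r b None = False"
| "sub_win \<phi> s m p r b (Some (Atom \<alpha>)) = (atom_true r \<alpha> \<longleftrightarrow> b = Plus)"
| "sub_win \<phi> s m p r b (Some (Neg \<psi>)) = Win \<phi> s (Position (p @ [0]) r (flip b) m)"
| "sub_win \<phi> s m p r b (Some (Conj \<psi> \<theta>)) =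
    (if b = Plus then Win \<phi> s (Position (p @ [0]) r b m) \<and> Win \<phi> s (Position (p @ [1]) r b m)
     else Win \<phi> s (Position (p @ [0]) r b m) \<or> Win \<phi> s (Position (p @ [1]) r b m))"
| "sub_win \<phi> s m p r b (Some (Disj \<psi> \<theta>)) =
    (if b = Plus then Win \<phi> s (Position (p @ [0]) r b m) \<or> Win \<phi> s (Position (p @ [1]) r b m)
     else Win \<phi> s (Position (p @ [0]) r b m) \<and> Win \<phi> s (Position (p @ [1]) r b m))"
| "sub_win \<phi> s m p r b (Some (Exists x \<psi>)) =
    (if b = Plus then \<exists>a. Win \<phi> s (Position (p @ [0]) (r(x := a)) b m)
     else \<forall>a. Win \<phi> s (Position (p @ [0]) (r(x := a)) b m))"
| "sub_win \<phi> s m p r b (Some (Forall x \<psi>)) =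
    (if b = Plus then \<forall>a. Win \<phi> s (Position (p @ [0]) (r(x := a)) b m)
     else \<exists>a. Win \<phi> s (Position (p @ [0]) (r(x := a)) b m))"
| "sub_win \<phi> s m p r b (Some (Label L \<psi>)) = Win \<phi> s (Position (p @ [0]) r b m)"
| "sub_win \<phi> s m p r b (Some (Claim L)) =
    (m > 0 \<and> (\<exists>q. is_reference \<phi> p L q \<and> Win \<phi> s (Position q r b (m - 1))))"

text \<open>Both addresses are prefixes of \<open>p\<close>, hence comparable; if they differed, the
  longer one would lie strictly between the shorter one and the claim.\<close>

lemma is_reference_unique:
  assumes "is_reference \<phi> p L q" "is_reference \<phi> p L q'"
  shows "q = q'"
proof -
  have "prefix q q' \<or> prefix q' q"
    using assms prefix_same_cases unfolding is_reference_def strict_prefix_def by blast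
  then show ?thesis
    using assms unfolding is_reference_def by (auto simp: strict_prefix_def)
qed

lemma Win_Position:
  "Win \<phi> s (Position p r b m) \<longleftrightarrow> sub_win \<phi> s m p r b (subformula_at \<phi> p)"
proof (cases "subformula_at \<phi> p")
  case None then show ?thesis by (subst Win_iff) simp
next
  case (Some \<psi>)
  show ?thesis
  proof (cases \<psi>)
    case (Claim L)
    show ?thesis
    proof (cases "m > 0 \<and> (\<exists>q. is_reference \<phi> p L q)")
      case True
      then obtain q where q: "is_reference \<phi> p L q" by blast
      have "is_reference \<phi> p L q' \<longleftrightarrow> q' = q" for q'
        using q is_reference_unique by blast
      then show ?thesis using True Some Claim by (subst Win_iff) simp
    next
      case False
      then show ?thesis using Some Claim by (subst Win_iff) auto
    qed
  qed (use Some in \<open>subst Win_iff; auto\<close>)+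
qed

text \<open>A larger clock adds moves only at claims that were stuck at clock 0, and such positions
  are not in \<open>Win\<close>.\<close>

lemma Win_clock_mono:
  assumes "Win \<phi> s (Position p r b m)" "m \<le> m'"
  shows "Win \<phi> s (Position p r b m')"
proof -
  have "(\<And>p r b m m'. P = Position p r b m \<Longrightarrow> m \<le> m' \<Longrightarrow> Win \<phi> s (Position p r b m'))"
    if "Win \<phi> s P" for P
    using that
  proof (induction rule: Win.induct)
    case (won P)
    then show ?case by (intro Win.won) simp
  next
    case (eloise P Q)
    obtain p' r' where Q: "Q = Position p' r' b m" "Position p' r' b m' \<in> moves \<phi> s (Position p r b m')"
    proof -
      obtain \<psi> where "subformula_at \<phi> p = Some \<psi>"
        using eloise.hyps(2) eloise.prems(1) by (cases "subformula_at \<phi> p") auto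
      then show ?thesis
        using eloise.hyps(1,2) eloise.prems(1) that by (cases \<psi>) auto
    qed
    moreover have "chooser \<phi> (Position p r b m') = Some Eloise"
      using eloise.hyps(1) eloise.prems(1) by simp
    ultimately show ?case
      using eloise.IH[OF Q(1) eloise.prems(2)] by (blast intro: Win.eloise)
  next
    case (other P)
    show ?case
    proof (rule Win.other)
      show "chooser \<phi> (Position p r b m') \<noteq> Some Eloise"
        using other by simp
      obtain \<psi> where \<psi>: "subformula_at \<phi> p = Some \<psi>"
        using other.hyps(2) other.prems(1) by (cases "subformula_at \<phi> p") auto
      show "moves \<phi> s (Position p r b m') \<noteq> {}"
        using other.hyps(2) other.prems \<psi> by (cases \<psi>) auto
      fix Q assume Q: "Q \<in> moves \<phi> s (Position p r b m')"
      have "\<exists>p' r' b' k k'. Q = Position p' r' b' k' \<and> k \<le> k' \<and>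
          Position p' r' b' k \<in> moves \<phi> s (Position p r b m)"
        using Q other.hyps(2) other.prems \<psi> by (cases \<psi>) auto
      then show "Win \<phi> s Q" using other by blast
    qed
  qed
  then show ?thesis using assms by blast
qed

text \<open>As soon as one clock wins for Eloise, so do all larger ones, and she can answer every
  lower bound.\<close>

lemma models_omega_iff: "models_omega s \<phi> \<longleftrightarrow> (\<exists>n. Win \<phi> s (Position [] s Plus n))"
proof -
  have "models_omega s \<phi> \<longleftrightarrow> Win \<phi> s Init"
    using Win_if_winning_strategy winning_strategy_if_Win by (auto simp: models_omega_def)
  also have "\<dots> \<longleftrightarrow> (\<forall>n'. Win \<phi> s (Bound n'))" by (subst Win_iff) auto
  also have "\<dots> \<longleftrightarrow> (\<forall>n'. \<exists>n\<ge>n'. Win \<phi> s (Position [] s Plus n))"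
    by (subst Win_iff) auto
  also have "\<dots> \<longleftrightarrow> (\<exists>n. Win \<phi> s (Position [] s Plus n))"
    by (meson Win_clock_mono linear order_refl)
  finally show ?thesis .
qed

section \<open>Counter programs on oracle machines\<close>

datatype com = Skip | Inc nat | Dec nat | Seq com com (infixr ";;" 60) | While nat com

text \<open>\<open>Dec\<close> has no result at 0, so the head that represents a counter never
  passes to the left of its origin.\<close>

inductive exec :: "com \<Rightarrow> (nat \<Rightarrow> nat) \<Rightarrow> (nat \<Rightarrow> nat) \<Rightarrow> bool" where
  exec_Skip: "exec Skip s s"
| exec_Inc: "exec (Inc j) s (s(j := Suc (s j)))"
| exec_Dec: "s j > 0 \<Longrightarrow> exec (Dec j) s (s(j := s j - 1))"
| exec_Seq: "exec c s s' \<Longrightarrow> exec c' s' s'' \<Longrightarrow> exec (c ;; c') s s''"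
| exec_While_0: "s j = 0 \<Longrightarrow> exec (While j c) s s"
| exec_While_Suc: "s j > 0 \<Longrightarrow> exec c s s' \<Longrightarrow> exec (While j c) s' s'' \<Longrightarrow> exec (While j c) s s''"

primrec regs :: "com \<Rightarrow> nat set" where
  "regs Skip = {}"
| "regs (Inc j) = {j}"
| "regs (Dec j) = {j}"
| "regs (c ;; c') = regs c \<union> regs c'"
| "regs (While j c) = insert j (regs c)"

lemma finite_regs: "finite (regs c)" by (induction c) auto

datatype instr = IMark | IRead nat | IInc nat | IDec nat | IJz nat nat | IJmp nat | IOracle nat

primrec compile :: "com \<Rightarrow> nat \<Rightarrow> instr list" where
  "compile Skip a = []"
| "compile (Inc j) a = [IInc j]"
| "compile (Dec j) a = [IDec j]"
| "compile (c ;; c') a = compile c a @ compile c' (a + length (compile c a))"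
| "compile (While j c) a =
    IJz j (a + length (compile c (Suc a)) + 2) # compile c (Suc a) @ [IJmp a]"

text \<open>
  Counter \<open>j\<close> is the position of the head on tape \<open>Suc j\<close>, whose origin carries
  the symbol 2 so that the value 0 can be recognised; tape 0 is only used for reading the input.
\<close>

context
  fixes N :: nat and prog :: "instr list"
begin

definition stays :: "move list" where
  "stays = replicate (Suc N) MStay"

lemma length_stays [simp]: "length stays = Suc N"
  by (simp add: stays_def)

lemma nth_stays: "t \<le> N \<Longrightarrow> stays ! t = MStay"
  by (simp add: stays_def less_Suc_eq_le del: replicate_Suc)

text \<open>The state is the program counter. Jump targets are cut off at
  \<open>length prog\<close>, which makes the machine well formed for every instruction list.
  \<open>IOracle j\<close> moves the oracle head right while counter \<open>j\<close> runs down, so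
  from the origin it reads the cell whose index was in the counter.\<close>

definition counter_delta :: "nat \<Rightarrow> nat list \<Rightarrow> bool option \<Rightarrow> nat \<times> nat list \<times> move list \<times> move" where
  "counter_delta pc v c =
    (if pc \<ge> length prog then (pc, v, stays, MStay)
     else case prog ! pc of
       IMark \<Rightarrow> (Suc pc, v ! 0 # replicate N 2, stays, MStay)
     | IRead j \<Rightarrow> if v ! 0 = 1 then (pc, v, stays[0 := MRight, Suc j := MRight], MStay)
         else (Suc pc, v, stays[0 := MRight], MStay)
     | IInc j \<Rightarrow> (Suc pc, v, stays[Suc j := MRight], MStay)
     | IDec j \<Rightarrow> (Suc pc, v, stays[Suc j := MLeft], MStay)
     | IJz j l \<Rightarrow> (if v ! Suc j = 2 then min l (length prog) else Suc pc, v, stays, MStay)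
     | IJmp l \<Rightarrow> (min l (length prog), v, stays, MStay)
     | IOracle j \<Rightarrow> if v ! Suc j = 2
         then (if c = Some True then length prog else Suc (length prog), v, stays, MStay)
         else (pc, v, stays[Suc j := MLeft], MRight))"

definition counter_otm :: otm where
  "counter_otm = \<lparr>ntapes = Suc N, nstates = length prog + 2, nsymbols = 3, start = 0,
     accept = length prog, reject = Suc (length prog), delta = counter_delta\<rparr>"

lemma wf_counter_otm: "wf_otm counter_otm"
proof -
  have "v ! 0 < 3" if "length v = Suc N" "set v \<subseteq> {..<3}" for v :: "nat list"
    using that by (metis lessThan_iff nth_mem subsetD zero_less_Suc)
  then show ?thesis
    by (auto simp: wf_otm_def counter_otm_def counter_delta_def split: instr.split)
qed

text \<open>Once the origins are marked the tapes never change again, so all varying information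
  sits in the state and the head positions.\<close>

definition cconf :: "nat list \<Rightarrow> nat \<Rightarrow> (nat \<Rightarrow> nat) \<Rightarrow> nat \<Rightarrow> nat \<Rightarrow> config" where
  "cconf W pc s i k =
    \<lparr>state = pc,
     tape = (\<lambda>t x. if t = 0 then if 0 \<le> x \<and> nat x < length W then W ! nat x else 0
                   else if t \<le> N \<and> x = 0 then 2 else 0),
     head = (\<lambda>t. if t = 0 then int i else if t \<le> N then int (s (t - 1)) else 0),
     ohead = int k\<rparr>"

definition reach :: "nat set \<Rightarrow> config \<Rightarrow> config \<Rightarrow> bool" where
  "reach A c c' \<longleftrightarrow> (\<exists>t. (step counter_otm A ^^ t) c = c')"

lemma reach_refl: "reach A c c"
  unfolding reach_def by (rule exI[of _ 0]) simp

lemma reach_trans: "reach A c c' \<Longrightarrow> reach A c' c'' \<Longrightarrow> reach A c c''"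
  unfolding reach_def by (metis comp_apply funpow_add)

lemma reach_step: "step counter_otm A c = c' \<Longrightarrow> reach A c c'"
  unfolding reach_def by (rule exI[of _ 1]) simp

text \<open>The second premise says that the scanned symbols are written back; such a step is
  described by its head movements.\<close>

lemma step_cconf:
  assumes "pc < length prog"
    and "counter_delta pc (map (\<lambda>t. tape (cconf W pc s i k) t (head (cconf W pc s i k) t)) [0..<Suc N])
      (Some (k \<in> A)) =
      (pc', map (\<lambda>t. tape (cconf W pc s i k) t (head (cconf W pc s i k) t)) [0..<Suc N], d, e)"
    and "\<And>t. t \<le> N \<Longrightarrow> head (cconf W pc s i k) t + offset (d ! t) = head (cconf W pc' s' i' k') t"
    and "int k + offset e = int k'"
  shows "reach A (cconf W pc s i k) (cconf W pc' s' i' k')"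
proof (rule reach_step)
  let ?c = "cconf W pc s i k"
  have "(\<lambda>t. if t < Suc N
        then (tape ?c t)(head ?c t := map (\<lambda>t. tape ?c t (head ?c t)) [0..<Suc N] ! t)
        else tape ?c t) = tape ?c"
    by (rule ext) (simp del: upt_Suc)
  moreover have "(\<lambda>t. if t < Suc N then head ?c t + offset (d ! t) else head ?c t) =
      head (cconf W pc' s' i' k')"
    using assms(3) by (rule_tac ext) (auto simp: less_Suc_eq_le, auto simp: cconf_def)
  moreover have "ohead ?c = int k" "state ?c = pc" by (simp_all add: cconf_def)
  moreover have "cconf W pc' s' i' k' = \<lparr>state = pc', tape = tape ?c,
      head = head (cconf W pc' s' i' k'), ohead = int k'\<rparr>"
    by (simp add: cconf_def)
  ultimately show "step counter_otm A ?c = cconf W pc' s' i' k'"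
    using assms(1,2,4)
    by (simp add: step_def counter_otm_def oracle_cell_def del: upt_Suc)
qed

lemma head_cconf: "head (cconf W pc s i k) t =
    (if t = 0 then int i else if t \<le> N then int (s (t - 1)) else 0)"
  by (simp add: cconf_def)

lemma tape_cconf: "tape (cconf W pc s i k) t x =
    (if t = 0 then if 0 \<le> x \<and> nat x < length W then W ! nat x else 0
     else if t \<le> N \<and> x = 0 then 2 else 0)"
  by (simp add: cconf_def)

lemmas step_simps = counter_delta_def head_cconf tape_cconf


lemma reach_instr:
  assumes "pc < length prog"
  shows reach_IInc: "prog ! pc = IInc j \<Longrightarrow> j < N \<Longrightarrow>
      reach A (cconf W pc s i k) (cconf W (Suc pc) (s(j := Suc (s j))) i k)"
    and reach_IDec: "prog ! pc = IDec j \<Longrightarrow> j < N \<Longrightarrow> s j > 0 \<Longrightarrow>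
      reach A (cconf W pc s i k) (cconf W (Suc pc) (s(j := s j - 1)) i k)"
    and reach_IJz_0: "prog ! pc = IJz j l \<Longrightarrow> j < N \<Longrightarrow> s j = 0 \<Longrightarrow> l \<le> length prog \<Longrightarrow>
      reach A (cconf W pc s i k) (cconf W l s i k)"
    and reach_IJz_Suc: "prog ! pc = IJz j l \<Longrightarrow> j < N \<Longrightarrow> s j > 0 \<Longrightarrow>
      reach A (cconf W pc s i k) (cconf W (Suc pc) s i k)"
    and reach_IJmp: "prog ! pc = IJmp l \<Longrightarrow> l \<le> length prog \<Longrightarrow>
      reach A (cconf W pc s i k) (cconf W l s i k)"
    and reach_IRead_1: "prog ! pc = IRead j \<Longrightarrow> j < N \<Longrightarrow> i < length W \<Longrightarrow> W ! i = 1 \<Longrightarrow>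
      reach A (cconf W pc s i k) (cconf W pc (s(j := Suc (s j))) (Suc i) k)"
    and reach_IRead_0: "prog ! pc = IRead j \<Longrightarrow> i < length W \<Longrightarrow> W ! i = 0 \<Longrightarrow>
      reach A (cconf W pc s i k) (cconf W (Suc pc) s (Suc i) k)"
    and reach_IOracle_Suc: "prog ! pc = IOracle j \<Longrightarrow> j < N \<Longrightarrow> s j > 0 \<Longrightarrow>
      reach A (cconf W pc s i k) (cconf W pc (s(j := s j - 1)) i (Suc k))"
    and reach_IOracle_in: "prog ! pc = IOracle j \<Longrightarrow> j < N \<Longrightarrow> s j = 0 \<Longrightarrow> k \<in> A \<Longrightarrow>
      reach A (cconf W pc s i k) (cconf W (length prog) s i k)"
    and reach_IOracle_notin: "prog ! pc = IOracle j \<Longrightarrow> j < N \<Longrightarrow> s j = 0 \<Longrightarrow> k \<notin> A \<Longrightarrow>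
      reach A (cconf W pc s i k) (cconf W (Suc (length prog)) s i k)"
  using assms
  by - (rule step_cconf, assumption, simp add: step_simps del: upt_Suc replicate_Suc,
    force simp: cconf_def nth_stays nth_list_update less_Suc_eq_le
      simp del: upt_Suc replicate_Suc, simp)+

text \<open>Jump targets are absolute, hence the compiled code is considered at an arbitrary place,
  behind \<open>pre\<close>, of the program.\<close>

lemma reach_compile:
  assumes "exec c s s'" "regs c \<subseteq> {..<N}" "prog = pre @ compile c (length pre) @ post"
  shows "reach A (cconf W (length pre) s i k)
    (cconf W (length pre + length (compile c (length pre))) s' i k)"
  using assms
proof (induction arbitrary: pre post rule: exec.induct)
  case (exec_Skip s)
  show ?case by (simp add: reach_refl)
next
  case (exec_Inc j s)
  then show ?case using reach_IInc[of "length pre" j] by (simp del: fun_upd_apply)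
next
  case (exec_Dec s j)
  then show ?case using reach_IDec[of "length pre" j] by (simp del: fun_upd_apply)
next
  case (exec_Seq c s s' c' s'')
  have "reach A (cconf W (length pre) s i k)
      (cconf W (length pre + length (compile c (length pre))) s' i k)"
    using exec_Seq.prems by (intro exec_Seq.IH(1)[where post = "compile c' (length pre + length (compile c (length pre))) @ post"]) auto
  moreover have "reach A (cconf W (length (pre @ compile c (length pre))) s' i k)
      (cconf W (length (pre @ compile c (length pre)) +
         length (compile c' (length (pre @ compile c (length pre))))) s'' i k)"
    using exec_Seq.prems by (intro exec_Seq.IH(2)[where post = post]) auto
  ultimately show ?case by (auto intro: reach_trans simp: add.assoc)
next
  case (exec_While_0 s j c)
  then show ?case using reach_IJz_0[of "length pre" j "length pre + length (compile c (Suc (length pre))) + 2" s A W i k] by simp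
next
  case (exec_While_Suc s j c s' s'')
  let ?c = "compile c (Suc (length pre))"
  have 1: "reach A (cconf W (length pre) s i k) (cconf W (Suc (length pre)) s i k)"
    using reach_IJz_Suc[of "length pre" j "length pre + length ?c + 2" s A W i k]
      exec_While_Suc.prems exec_While_Suc.hyps(1) by simp
  have "reach A (cconf W (length (pre @ [IJz j (length pre + length ?c + 2)])) s i k)
      (cconf W (length (pre @ [IJz j (length pre + length ?c + 2)]) +
         length (compile c (length (pre @ [IJz j (length pre + length ?c + 2)])))) s' i k)"
    using exec_While_Suc.prems
    by (intro exec_While_Suc.IH(1)[where post = "IJmp (length pre) # post"]) auto
  then have 2: "reach A (cconf W (Suc (length pre)) s i k)
      (cconf W (Suc (length pre + length ?c)) s' i k)" by simp
  have 3: "reach A (cconf W (Suc (length pre + length ?c)) s' i k)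
      (cconf W (length pre) s' i k)"
    using exec_While_Suc.prems by (intro reach_IJmp) (auto simp: nth_append)
  have 4: "reach A (cconf W (length pre) s' i k)
      (cconf W (length pre + length (compile (While j c) (length pre))) s'' i k)"
    using exec_While_Suc.prems by (intro exec_While_Suc.IH(2)[where post = post]) auto
  show ?case using 1 2 3 4 reach_trans by blast
qed

text \<open>The sum of the oracle head position and the counter is invariant during the
  walk.\<close>

lemma reach_oracle:
  assumes "pc < length prog" "prog ! pc = IOracle j" "j < N"
  shows "\<exists>s' k'. reach A (cconf W pc s i k)
    (cconf W (if k + s j \<in> A then length prog else Suc (length prog)) s' i k')"
proof (induction "s j" arbitrary: s k)
  case 0
  then show ?case using reach_IOracle_in[OF assms, of s k A W i] reach_IOracle_notin[OF assms, of s k A W i]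
    by (intro exI[of _ s] exI[of _ k]) auto
next
  case (Suc x)
  let ?s = "s(j := s j - 1)"
  have x: "x = ?s j" "Suc k + ?s j = k + s j" using Suc.hyps(2) by simp_all
  have "reach A (cconf W pc s i k) (cconf W pc ?s i (Suc k))"
    using Suc.hyps(2) by (intro reach_IOracle_Suc[OF assms]) simp
  then show ?case using Suc.hyps(1)[of ?s "Suc k", OF x(1)] unfolding x(2)
    by (blast intro: reach_trans)
qed

lemma reach_read:
  assumes "pc < length prog" "prog ! pc = IRead j" "j < N" "W = W1 @ replicate x 1 @ 0 # W2"
  shows "reach A (cconf W pc s (length W1) k) (cconf W (Suc pc) (s(j := s j + x)) (Suc (length W1 + x)) k)"
  using assms(4)
proof (induction x arbitrary: s W1)
  case 0
  then show ?case using reach_IRead_0[OF assms(1,2), of "length W1" W A s k] by simp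
next
  case (Suc x)
  have "reach A (cconf W pc s (length W1) k) (cconf W pc (s(j := Suc (s j))) (Suc (length W1)) k)"
    using Suc.prems by (intro reach_IRead_1[OF assms(1-3)]) simp_all
  moreover have "reach A (cconf W pc (s(j := Suc (s j))) (length (W1 @ [1])) k)
     (cconf W (Suc pc) ((s(j := Suc (s j)))(j := (s(j := Suc (s j))) j + x)) (Suc (length (W1 @ [1]) + x)) k)"
    using Suc.prems by (intro Suc.IH) simp
  ultimately show ?case by (auto intro: reach_trans simp del: fun_upd_apply simp: fun_upd_same)
qed

text \<open>Marking the origins turns the initial configuration into one of the form
  \<open>cconf\<close>; each \<open>IRead\<close> then consumes one unary block together with the
  blank behind it.\<close>

lemma reach_input:
  assumes "prog = IMark # map IRead [0..<n] @ post" "n \<le> N" "length xs = n"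
  shows "\<exists>i. reach A (init_config counter_otm xs)
    (cconf (input_word xs) (Suc n) (\<lambda>j. if j < n then xs ! j else 0) i 0)"
proof -
  let ?W = "input_word xs"
  have init: "reach A (init_config counter_otm xs) (cconf ?W 1 (\<lambda>j. 0) 0 0)"
  proof (rule reach_step)
    have "map (\<lambda>t. tape (init_config counter_otm xs) t (head (init_config counter_otm xs) t)) [0..<Suc N] ! 0
        = (if 0 < length ?W then ?W ! 0 else 0)"
      by (simp add: init_config_def del: upt_Suc)
    moreover have "(x # replicate N y) ! t = (if t = 0 then x else y)" if "t < Suc N" for x y :: nat and t
      using that by (cases t) auto
    moreover have "0 < length prog" "prog ! 0 = IMark" using assms(1) by simp_all
    ultimately show "step counter_otm A (init_config counter_otm xs) = cconf ?W 1 (\<lambda>j. 0) 0 0"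
      by (auto simp: step_def counter_otm_def init_config_def counter_delta_def cconf_def
          fun_eq_iff less_Suc_eq_le nth_stays simp del: upt_Suc)
  qed
  have "m \<le> n \<Longrightarrow> reach A (init_config counter_otm xs)
    (cconf ?W (Suc m) (\<lambda>j. if j < m then xs ! j else 0) (length (input_word (take m xs))) 0)" for m
  proof (induction m)
    case 0
    then show ?case using init by (simp add: input_word_def)
  next
    case (Suc m)
    have xs: "xs = take m xs @ xs ! m # drop (Suc m) xs"
      using Suc.prems assms(3) by (simp add: id_take_nth_drop)
    have W: "?W = input_word (take m xs) @ replicate (xs ! m) 1 @ 0 # input_word (drop (Suc m) xs)"
      by (subst xs) (simp add: input_word_def)
    have tk: "take (Suc m) xs = take m xs @ [xs ! m]"
      using Suc.prems assms(3) by (simp add: take_Suc_conv_app_nth)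
    have len: "length (input_word (take (Suc m) xs)) = Suc (length (input_word (take m xs)) + xs ! m)"
      by (simp add: tk input_word_def)
    have s: "(\<lambda>j. if j < m then xs ! j else 0)(m := (if m < m then xs ! m else 0) + xs ! m) =
        (\<lambda>j. if j < Suc m then xs ! j else 0)"
      by (auto simp: fun_eq_iff less_Suc_eq)
    have "reach A (cconf ?W (Suc m) (\<lambda>j. if j < m then xs ! j else 0) (length (input_word (take m xs))) 0)
      (cconf ?W (Suc (Suc m)) (\<lambda>j. if j < Suc m then xs ! j else 0) (length (input_word (take (Suc m) xs))) 0)"
      unfolding len s[symmetric]
      by (rule reach_read[OF _ _ _ W]) (use assms Suc.prems in \<open>simp_all add: nth_append\<close>)
    then show ?case using Suc by (auto intro: reach_trans)
  qed
  then show ?thesis by blast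
qed

end

text \<open>The oracle is consulted once, at the very end, and its answer is the verdict:
  \<open>c\<close> computes a many-one reduction of \<open>R\<close> to \<open>A\<close>.\<close>

theorem computable_in_if_exec:
  assumes "R \<subseteq> {xs. length xs = n}"
    and "\<And>xs. length xs = n \<Longrightarrow>
      \<exists>s'. exec c (\<lambda>j. if j < n then xs ! j else 0) s' \<and> (s' d \<in> A \<longleftrightarrow> xs \<in> R)"
  shows "computable_in A n R"
proof -
  define prog where "prog = IMark # map IRead [0..<n] @ compile c (Suc n) @ [IOracle d]"
  obtain N where N: "regs c \<subseteq> {..<N}" "n \<le> N" "d < N"
  proof -
    have "finite (regs c \<union> {..<n} \<union> {d})" by (simp add: finite_regs)
    then obtain N where "\<forall>x \<in> regs c \<union> {..<n} \<union> {d}. x < N"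
      unfolding finite_nat_set_iff_bounded by blast
    then show ?thesis by (intro that[of N]) (auto simp: leI)
  qed
  have "\<exists>t. state ((step (counter_otm N prog) A ^^ t) (init_config (counter_otm N prog) xs)) =
      (if xs \<in> R then accept (counter_otm N prog) else reject (counter_otm N prog))"
    if xs: "length xs = n" for xs
  proof -
    let ?s = "\<lambda>j. if j < n then xs ! j else 0"
    obtain s' where s': "exec c ?s s'" "s' d \<in> A \<longleftrightarrow> xs \<in> R" using assms(2)[OF xs] by blast
    let ?pre = "IMark # map IRead [0..<n]"
    have prog: "prog = ?pre @ compile c (length ?pre) @ [IOracle d]" by (simp add: prog_def)
    obtain i where i: "reach N prog A (init_config (counter_otm N prog) xs)
        (cconf N (input_word xs) (Suc n) ?s i 0)"
      using reach_input[OF prog_def N(2) xs] by blast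
    let ?pc = "Suc n + length (compile c (Suc n))"
    have "reach N prog A (cconf N (input_word xs) (Suc n) ?s i 0)
        (cconf N (input_word xs) ?pc s' i 0)"
      using reach_compile[OF s'(1) N(1) prog, of A "input_word xs" i 0] by simp
    moreover have "?pc < length prog" "prog ! ?pc = IOracle d"
      by (simp_all add: prog_def nth_append)
    from reach_oracle[where N = N and prog = prog, OF this N(3), of A "input_word xs" s' i 0]
    obtain s'' k' where "reach N prog A (cconf N (input_word xs) ?pc s' i 0)
      (cconf N (input_word xs) (if s' d \<in> A then length prog else Suc (length prog)) s'' i k')"
      by auto
    ultimately have "reach N prog A (init_config (counter_otm N prog) xs)
      (cconf N (input_word xs) (if s' d \<in> A then length prog else Suc (length prog)) s'' i k')"
      using i reach_trans by blast
    then obtain t where "(step (counter_otm N prog) A ^^ t) (init_config (counter_otm N prog) xs) =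
      cconf N (input_word xs) (if s' d \<in> A then length prog else Suc (length prog)) s'' i k'"
      unfolding reach_def by blast
    then show ?thesis using s'(2)
      by (intro exI[of _ t]) (simp add: cconf_def counter_otm_def)
  qed
  then show ?thesis
    using assms(1) wf_counter_otm unfolding computable_in_def by blast
qed

subsection \<open>Arithmetic by counter programs\<close>

text \<open>\<open>S m\<close> is the state at the moment when the loop counter shows
  \<open>m\<close>. The body starts after the decrement, so the values \<open>S n, ..., S 0\<close>
  are passed in descending order.\<close>

lemma exec_For:
  assumes "\<And>m. m < n \<Longrightarrow> exec c ((S (Suc m))(i := m)) (S m)" "\<And>m. m \<le> n \<Longrightarrow> S m i = m"
  shows "exec (While i (Dec i ;; c)) (S n) (S 0)"
  using assms
proof (induction n)
  case 0
  then show ?case by (intro exec_While_0) simp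
next
  case (Suc n)
  have "exec (Dec i) (S (Suc n)) ((S (Suc n))(i := S (Suc n) i - 1))"
    using Suc.prems(2)[of "Suc n"] by (intro exec_Dec) simp
  then have "exec (Dec i) (S (Suc n)) ((S (Suc n))(i := n))"
    using Suc.prems(2)[of "Suc n"] by simp
  then have 1: "exec (Dec i ;; c) (S (Suc n)) (S n)"
    by (rule exec_Seq) (rule Suc.prems(1), simp)
  have 2: "exec (While i (Dec i ;; c)) (S n) (S 0)"
    by (rule Suc.IH) (rule Suc.prems, simp)+
  have "S (Suc n) i > 0" using Suc.prems(2)[of "Suc n"] by simp
  then show ?case by (rule exec_While_Suc[OF _ 1 2])
qed

definition transfer :: "nat \<Rightarrow> nat \<Rightarrow> com" where
  "transfer x y = While x (Dec x ;; Inc y)"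

text \<open>Reading a counter destroys it. With two targets a copy is possible: one of them is moved
  back into the emptied source.\<close>

definition transfer2 :: "nat \<Rightarrow> nat \<Rightarrow> nat \<Rightarrow> com" where
  "transfer2 x y z = While x (Dec x ;; Inc y ;; Inc z)"

lemma exec_transfer:
  assumes "x \<noteq> y"
  shows "exec (transfer x y) s (s(x := 0, y := s y + s x))"
proof -
  define S where "S m = s(x := m, y := s y + (s x - m))" for m
  have "exec (transfer x y) (S (s x)) (S 0)"
    unfolding transfer_def
  proof (rule exec_For)
    fix m assume "m < s x"
    then have "S m = ((S (Suc m))(x := m))(y := Suc (((S (Suc m))(x := m)) y))"
      using assms by (auto simp: S_def fun_eq_iff)
    then show "exec (Inc y) ((S (Suc m))(x := m)) (S m)"
      using exec_Inc[of y "(S (Suc m))(x := m)"] by (simp only:)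
  qed (use assms in \<open>simp add: S_def\<close>)
  moreover have "S (s x) = s" by (auto simp: S_def)
  ultimately show ?thesis by (simp add: S_def)
qed

lemma exec_transfer2:
  assumes "distinct [x, y, z]"
  shows "exec (transfer2 x y z) s (s(x := 0, y := s y + s x, z := s z + s x))"
proof -
  define S where "S m = s(x := m, y := s y + (s x - m), z := s z + (s x - m))" for m
  have "exec (transfer2 x y z) (S (s x)) (S 0)"
    unfolding transfer2_def
  proof (rule exec_For)
    fix m assume m: "m < s x"
    let ?s = "(S (Suc m))(x := m)"
    have "S m = (?s(y := Suc (?s y)))(z := Suc ((?s(y := Suc (?s y))) z))"
      using m assms by (auto simp: S_def fun_eq_iff)
    then show "exec (Inc y ;; Inc z) ?s (S m)"
      using exec_Seq[OF exec_Inc exec_Inc] by metis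
  qed (use assms in \<open>simp add: S_def\<close>)
  moreover have "S (s x) = s" by (auto simp: S_def)
  ultimately show ?thesis by (simp add: S_def)
qed

definition clear :: "nat \<Rightarrow> com" where
  "clear x = While x (Dec x ;; Skip)"

lemma exec_clear: "exec (clear x) s (s(x := 0))"
proof -
  have "exec (clear x) (s(x := s x)) (s(x := 0))"
    unfolding clear_def by (rule exec_For[where S = "\<lambda>m. s(x := m)"]) (auto intro: exec_Skip)
  then show ?thesis by simp
qed

primrec increase :: "nat \<Rightarrow> nat \<Rightarrow> com" where
  "increase x 0 = Skip"
| "increase x (Suc n) = Inc x ;; increase x n"

lemma exec_increase: "exec (increase x n) s (s(x := s x + n))"
proof (induction n arbitrary: s)
  case 0 show ?case using exec_Skip[of s] by simp
next
  case (Suc n)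
  have "(s(x := Suc (s x)))(x := (s(x := Suc (s x))) x + n) = s(x := s x + Suc n)" by simp
  then show ?case
    using exec_Seq[OF exec_Inc Suc.IH[of "s(x := Suc (s x))"]] by (simp only: increase.simps)
qed

text \<open>The summand is the value before the decrement; the opening \<open>Dec x ;; Inc x\<close>
  gives the loop the shape treated by \<open>exec_For\<close>.\<close>

definition add_triangle :: "nat \<Rightarrow> com" where
  "add_triangle x = While x (Dec x ;; Inc x ;; transfer2 x (x + 1) (x + 2) ;; transfer (x + 2) x ;; Dec x)"

lemma exec_add_triangle:
  assumes "s (x + 2) = 0"
  shows "exec (add_triangle x) s (s(x := 0, x + 1 := s (x + 1) + triangle (s x)))"
proof -
  define S where "S m = s(x := m, x + 1 := s (x + 1) + (triangle (s x) - triangle m))" for m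
  have tri: "triangle m \<le> triangle n" if "m \<le> n" for m n
    using that by (induction rule: dec_induct) auto
  have "exec (add_triangle x) (S (s x)) (S 0)"
    unfolding add_triangle_def
  proof (rule exec_For)
    fix m assume m: "m < s x"
    define s0 where "s0 = (S (Suc m))(x := Suc m)"
    define s1 where "s1 = s0(x := 0, x + 1 := s0 (x + 1) + s0 x, x + 2 := s0 (x + 2) + s0 x)"
    define s2 where "s2 = s1(x + 2 := 0, x := s1 x + s1 (x + 2))"
    have "((S (Suc m))(x := m))(x := Suc (((S (Suc m))(x := m)) x)) = s0"
      by (simp add: s0_def)
    with exec_Inc[of x "(S (Suc m))(x := m)"]
    have 0: "exec (Inc x) ((S (Suc m))(x := m)) s0" by simp
    have 1: "exec (transfer2 x (x + 1) (x + 2)) s0 s1"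
      unfolding s1_def by (rule exec_transfer2) simp
    have 2: "exec (transfer (x + 2) x) s1 s2"
      unfolding s2_def by (rule exec_transfer) simp
    have 3: "exec (Dec x) s2 (s2(x := s2 x - 1))"
      by (rule exec_Dec) (simp add: s2_def s1_def s0_def)
    have "s2(x := s2 x - 1) = S m"
      using assms tri[of "Suc m" "s x"] m
      by (auto simp: s2_def s1_def s0_def S_def fun_eq_iff)
    then show "exec (Inc x ;; transfer2 x (x + 1) (x + 2) ;; transfer (x + 2) x ;; Dec x)
        ((S (Suc m))(x := m)) (S m)"
      using 0 1 2 3 by (auto intro: exec_Seq)
  qed (simp add: S_def)
  moreover have "S (s x) = s" by (auto simp: S_def)
  ultimately show ?thesis by (simp add: S_def)
qed

section \<open>Evaluation of expressions built from addition and pairing\<close>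

datatype exp = EReg nat | EConst nat | EAdd exp exp | EPair exp exp

primrec val :: "(nat \<Rightarrow> nat) \<Rightarrow> exp \<Rightarrow> nat" where
  "val s (EReg x) = s x"
| "val s (EConst n) = n"
| "val s (EAdd e e') = val s e + val s e'"
| "val s (EPair e e') = prod_encode (val s e, val s e')"

primrec exp_regs :: "exp \<Rightarrow> nat set" where
  "exp_regs (EReg x) = {x}"
| "exp_regs (EConst n) = {}"
| "exp_regs (EAdd e e') = exp_regs e \<union> exp_regs e'"
| "exp_regs (EPair e e') = exp_regs e \<union> exp_regs e'"

lemma val_cong: "(\<And>x. x \<in> exp_regs e \<Longrightarrow> s x = s' x) \<Longrightarrow> val s e = val s' e"
  by (induction e) auto

text \<open>The registers from \<open>d\<close> on are a stack of zeros. For a pair of values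
  \<open>a\<close> and \<open>b\<close>, register \<open>d + 1\<close> receives \<open>a + b\<close>
  and \<open>d + 2\<close> receives \<open>a\<close>; adding the triangular number of
  \<open>a + b\<close> to the latter gives \<open>prod_encode (a, b)\<close>.\<close>

primrec eval_into :: "nat \<Rightarrow> exp \<Rightarrow> com" where
  "eval_into d (EReg x) = transfer2 x d (d + 1) ;; transfer (d + 1) x"
| "eval_into d (EConst n) = increase d n"
| "eval_into d (EAdd e e') = eval_into d e ;; eval_into (d + 1) e' ;; transfer (d + 1) d"
| "eval_into d (EPair e e') = eval_into d e ;; eval_into (d + 1) e' ;;
     transfer2 d (d + 1) (d + 2) ;; add_triangle (d + 1) ;; transfer (d + 2) d"

lemma exec_eval_into:
  assumes "exp_regs e \<subseteq> {..<d}" "\<And>x. d \<le> x \<Longrightarrow> s x = 0"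
  shows "exec (eval_into d e) s (s(d := val s e))"
  using assms
proof (induction e arbitrary: d s)
  case (EReg x)
  define s1 where "s1 = s(x := 0, d := s d + s x, d + 1 := s (d + 1) + s x)"
  have "exec (transfer2 x d (d + 1)) s s1"
    unfolding s1_def using EReg by (intro exec_transfer2) auto
  moreover have "exec (transfer (d + 1) x) s1 (s1(d + 1 := 0, x := s1 x + s1 (d + 1)))"
    using EReg by (intro exec_transfer) auto
  moreover have "s1(d + 1 := 0, x := s1 x + s1 (d + 1)) = s(d := s x)"
    using EReg by (auto simp: s1_def fun_eq_iff)
  ultimately show ?case unfolding eval_into.simps val.simps by (metis exec_Seq)
next
  case (EConst n)
  then show ?case using exec_increase[of d n s] by (simp del: fun_upd_apply)
next
  case (EAdd e e')
  define s1 where "s1 = s(d := val s e)"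
  define s2 where "s2 = s1(d + 1 := val s1 e')"
  have v: "val s1 e' = val s e'" unfolding s1_def using EAdd.prems by (intro val_cong) auto
  have "exec (eval_into d e) s s1" unfolding s1_def using EAdd.prems by (intro EAdd.IH) auto
  moreover have "exec (eval_into (d + 1) e') s1 s2"
    unfolding s2_def using EAdd.prems by (intro EAdd.IH) (auto simp: s1_def)
  moreover have "exec (transfer (d + 1) d) s2 (s2(d + 1 := 0, d := s2 d + s2 (d + 1)))"
    by (intro exec_transfer) simp
  moreover have "s2(d + 1 := 0, d := s2 d + s2 (d + 1)) = s(d := val s (EAdd e e'))"
    using EAdd.prems(2) v by (auto simp: s2_def s1_def fun_eq_iff)
  ultimately show ?case unfolding eval_into.simps by (metis exec_Seq)
next
  case (EPair e e')
  define s1 where "s1 = s(d := val s e)"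
  define s2 where "s2 = s1(d + 1 := val s1 e')"
  define s3 where "s3 = s2(d := 0, d + 1 := s2 (d + 1) + s2 d, d + 2 := s2 (d + 2) + s2 d)"
  define s4 where "s4 = s3(d + 1 := 0, d + 1 + 1 := s3 (d + 1 + 1) + triangle (s3 (d + 1)))"
  define s5 where "s5 = s4(d + 2 := 0, d := s4 d + s4 (d + 2))"
  have v: "val s1 e' = val s e'" unfolding s1_def using EPair.prems by (intro val_cong) auto
  have e1: "exec (eval_into d e) s s1" unfolding s1_def using EPair.prems by (intro EPair.IH) auto
  have e2: "exec (eval_into (d + 1) e') s1 s2"
    unfolding s2_def using EPair.prems by (intro EPair.IH) (auto simp: s1_def)
  have e3: "exec (transfer2 d (d + 1) (d + 2)) s2 s3"
    unfolding s3_def by (intro exec_transfer2) simp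
  have e4: "exec (add_triangle (d + 1)) s3 s4"
    unfolding s4_def using EPair.prems(2)
    by (intro exec_add_triangle) (simp add: s3_def s2_def s1_def)
  have e5: "exec (transfer (d + 2) d) s4 s5"
    unfolding s5_def by (intro exec_transfer) simp
  have eq: "s5 = s(d := val s (EPair e e'))"
    using EPair.prems(2) v
    by (auto simp: s5_def s4_def s3_def s2_def s1_def fun_eq_iff prod_encode_def add.commute)
  show ?case unfolding eval_into.simps eq[symmetric]
    by (rule exec_Seq[OF e1 exec_Seq[OF e2 exec_Seq[OF e3 exec_Seq[OF e4 e5]]]])
qed

text \<open>The value is formed in the scratch area before \<open>x\<close> is cleared, so
  \<open>e\<close> may mention \<open>x\<close>.\<close>

definition assign_exp :: "nat \<Rightarrow> nat \<Rightarrow> exp \<Rightarrow> com" where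
  "assign_exp d x e = eval_into d e ;; clear x ;; transfer d x"

lemma exec_assign_exp:
  assumes "exp_regs e \<subseteq> {..<d}" "x < d" "\<And>y. d \<le> y \<Longrightarrow> s y = 0"
  shows "exec (assign_exp d x e) s (s(x := val s e))"
proof -
  let ?s = "s(d := val s e, x := 0)"
  have "exec (eval_into d e) s (s(d := val s e))" using assms by (intro exec_eval_into) auto
  moreover have "exec (clear x) (s(d := val s e)) ?s" by (rule exec_clear)
  moreover have "exec (transfer d x) ?s (?s(d := 0, x := ?s x + ?s d))"
    using assms by (intro exec_transfer) simp
  moreover have "?s(d := 0, x := ?s x + ?s d) = s(x := val s e)"
    using assms by (auto simp: fun_eq_iff)
  ultimately show ?thesis unfolding assign_exp_def by (metis exec_Seq)
qed

section \<open>Definable relations are \<open>\<Sigma>\<^sup>0\<close> at level \<open>\<omega> + 1\<close>\<close>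

text \<open>
  The clock is irrelevant for deciding whether Eloise can win within \<open>t\<close> moves: a claim costs a
  move, and a clock of \<open>n\<close> bounds the number of moves by a multiple of \<open>n + 1\<close>.  In every round
  both players announce a number, of which the one of the player not to move is ignored; plays
  that have ended, or are stuck, stay put.
\<close>

type_synonym gstate = "address \<times> assignment \<times> sign"

fun next_state :: "scl \<Rightarrow> nat \<Rightarrow> nat \<Rightarrow> gstate \<Rightarrow> gstate" where
  "next_state \<phi> e a (p, r, b) =
     (case subformula_at \<phi> p of
        None \<Rightarrow> (p, r, b)
      | Some (Atom \<alpha>) \<Rightarrow> (p, r, b)
      | Some (Neg \<psi>) \<Rightarrow> (p @ [0], r, flip b)
      | Some (Conj \<psi> \<theta>) \<Rightarrow> (p @ [if (if b = Plus then a else e) = 0 then 0 else 1], r, b)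
      | Some (Disj \<psi> \<theta>) \<Rightarrow> (p @ [if (if b = Plus then e else a) = 0 then 0 else 1], r, b)
      | Some (Exists x \<psi>) \<Rightarrow> (p @ [0], r(x := if b = Plus then e else a), b)
      | Some (Forall x \<psi>) \<Rightarrow> (p @ [0], r(x := if b = Plus then a else e), b)
      | Some (Label L \<psi>) \<Rightarrow> (p @ [0], r, b)
      | Some (Claim L) \<Rightarrow>
          (if \<exists>q. is_reference \<phi> p L q then (THE q. is_reference \<phi> p L q, r, b) else (p, r, b)))"

fun won_state :: "scl \<Rightarrow> gstate \<Rightarrow> bool" where
  "won_state \<phi> (p, r, b) \<longleftrightarrow>
     (\<exists>\<alpha>. subformula_at \<phi> p = Some (Atom \<alpha>) \<and> (atom_true r \<alpha> \<longleftrightarrow> b = Plus))"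

text \<open>Every round has the same pair of quantifiers, whoever is to move. This uniformity makes
  the quantifier prefix of the later sentence independent of the course of the play.\<close>

primrec wins_within :: "scl \<Rightarrow> nat \<Rightarrow> gstate \<Rightarrow> bool" where
  "wins_within \<phi> 0 st \<longleftrightarrow> won_state \<phi> st"
| "wins_within \<phi> (Suc t) st \<longleftrightarrow> (\<exists>e. \<forall>a. wins_within \<phi> t (next_state \<phi> e a st))"

lemma wins_within_Atom:
  "subformula_at \<phi> p = Some (Atom \<alpha>) \<Longrightarrow>
    wins_within \<phi> t (p, r, b) \<longleftrightarrow> (atom_true r \<alpha> \<longleftrightarrow> b = Plus)"
  by (induction t) auto

lemma the_reference: "is_reference \<phi> p L q \<Longrightarrow> (THE q. is_reference \<phi> p L q) = q"
  using is_reference_unique by blast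

text \<open>The choice between two subformulas is announced as 0 or not 0.\<close>

lemma nat_choice_iff:
  "(\<exists>e::nat. (e = 0 \<longrightarrow> X) \<and> (0 < e \<longrightarrow> Y)) \<longleftrightarrow> X \<or> Y"
  "(\<forall>e::nat. (e = 0 \<longrightarrow> X) \<and> (0 < e \<longrightarrow> Y)) \<longleftrightarrow> X \<and> Y"
  by (auto intro: exI[of _ 0] exI[of _ 1])

lemma wins_within_Suc:
  "wins_within \<phi> (Suc t) (p, r, b) \<longleftrightarrow>
    (case subformula_at \<phi> p of
       None \<Rightarrow> wins_within \<phi> t (p, r, b)
     | Some (Atom \<alpha>) \<Rightarrow> (atom_true r \<alpha> \<longleftrightarrow> b = Plus)
     | Some (Neg \<psi>) \<Rightarrow> wins_within \<phi> t (p @ [0], r, flip b)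
     | Some (Conj \<psi> \<theta>) \<Rightarrow>
         (if b = Plus then wins_within \<phi> t (p @ [0], r, b) \<and> wins_within \<phi> t (p @ [1], r, b)
          else wins_within \<phi> t (p @ [0], r, b) \<or> wins_within \<phi> t (p @ [1], r, b))
     | Some (Disj \<psi> \<theta>) \<Rightarrow>
         (if b = Plus then wins_within \<phi> t (p @ [0], r, b) \<or> wins_within \<phi> t (p @ [1], r, b)
          else wins_within \<phi> t (p @ [0], r, b) \<and> wins_within \<phi> t (p @ [1], r, b))
     | Some (Exists x \<psi>) \<Rightarrow>
         (if b = Plus then \<exists>a. wins_within \<phi> t (p @ [0], r(x := a), b)
          else \<forall>a. wins_within \<phi> t (p @ [0], r(x := a), b))
     | Some (Forall x \<psi>) \<Rightarrow>
         (if b = Plus then \<forall>a. wins_within \<phi> t (p @ [0], r(x := a), b)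
          else \<exists>a. wins_within \<phi> t (p @ [0], r(x := a), b))
     | Some (Label L \<psi>) \<Rightarrow> wins_within \<phi> t (p @ [0], r, b)
     | Some (Claim L) \<Rightarrow>
         (if \<exists>q. is_reference \<phi> p L q
          then \<exists>q. is_reference \<phi> p L q \<and> wins_within \<phi> t (q, r, b)
          else wins_within \<phi> t (p, r, b)))"
proof (cases "subformula_at \<phi> p")
  case None then show ?thesis by simp
next
  case (Some \<psi>)
  show ?thesis
  proof (cases \<psi>)
    case (Atom \<alpha>)
    then show ?thesis using Some wins_within_Atom[of \<phi> p \<alpha> "Suc t"] by simp
  next
    case (Conj \<psi>1 \<psi>2)
    then show ?thesis using Some by (cases b) (simp_all add: nat_choice_iff)
  next
    case (Disj \<psi>1 \<psi>2)
    then show ?thesis using Some by (cases b) (simp_all add: nat_choice_iff)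
  next
    case (Claim L)
    then show ?thesis using Some the_reference[of \<phi> p L] by auto
  qed (use Some in simp_all)
qed

text \<open>Between two claims the address grows to length \<open>size \<phi>\<close> at most, and a
  claim trades one unit of the clock for a fresh allowance of \<open>Suc (size \<phi>)\<close>
  moves.\<close>

lemma wins_within_if_Win:
  assumes "Win \<phi> s (Position p r b m)"
    and "m * Suc (size \<phi>) + (Suc (size \<phi>) - length p) \<le> t"
  shows "wins_within \<phi> t (p, r, b)"
  using assms
proof (induction t arbitrary: p r b m)
  case 0
  \<comment> \<open>An address inside the formula makes the bound positive, so the case
    \<open>t = 0\<close> is void.\<close>
  then obtain \<psi> where "subformula_at \<phi> p = Some \<psi>"
    by (cases "subformula_at \<phi> p") (auto simp: Win_Position)
  then show ?case using 0 length_address_le_size by fastforce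
next
  case (Suc t)
  obtain \<psi> where \<psi>: "subformula_at \<phi> p = Some \<psi>"
    using Suc.prems by (cases "subformula_at \<phi> p") (auto simp: Win_Position)
  then have len: "length p \<le> size \<phi>" by (rule length_address_le_size)
  have *: "wins_within \<phi> t (p @ [i], r', b')" if "Win \<phi> s (Position (p @ [i]) r' b' m)" for i r' b'
    using Suc.prems(2) len by (intro Suc.IH[OF that]) simp
  show ?case
  proof (cases \<psi>)
    case (Claim L)
    then obtain q where q: "is_reference \<phi> p L q" "Win \<phi> s (Position q r b (m - 1))" "m > 0"
      using Suc.prems \<psi> by (auto simp: Win_Position[of \<phi> s p])
    have "(m - 1) * Suc (size \<phi>) + Suc (size \<phi>) = m * Suc (size \<phi>)"
      using q(3) by (cases m) simp_all
    then have "wins_within \<phi> t (q, r, b)"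
      using Suc.prems(2) len by (intro Suc.IH[OF q(2)]) simp
    then show ?thesis using Claim \<psi> q(1) the_reference[OF q(1)]
      by (subst wins_within_Suc) auto
  qed (use Suc.prems(1) \<psi> * in \<open>subst wins_within_Suc; auto simp: Win_Position[of \<phi> s p] split: if_splits\<close>)+
qed

text \<open>Each claim uses up one of the \<open>t\<close> moves, so a clock of at least
  \<open>t\<close> cannot run out too early.\<close>

lemma Win_if_wins_within:
  assumes "wins_within \<phi> t (p, r, b)" "t \<le> m"
  shows "Win \<phi> s (Position p r b m)"
  using assms
proof (induction t arbitrary: p r b m)
  case 0
  then show ?case by (auto simp: Win_Position)
next
  case (Suc t)
  have *: "Win \<phi> s (Position p' r' b' m)" if "wins_within \<phi> t (p', r', b')" for p' r' b'
    using Suc.prems by (intro Suc.IH[OF that]) simp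
  have **: "Win \<phi> s (Position p' r' b' (m - 1))" if "wins_within \<phi> t (p', r', b')" for p' r' b'
    using Suc.prems by (intro Suc.IH[OF that]) simp
  show ?case
  proof (cases "subformula_at \<phi> p")
    case None
    then show ?thesis using Suc.prems * by (subst (asm) wins_within_Suc) simp
  next
    case (Some \<psi>)
    show ?thesis
    proof (cases \<psi>)
      case (Claim L)
      show ?thesis
      proof (cases "\<exists>q. is_reference \<phi> p L q")
        case True
        then obtain q where "is_reference \<phi> p L q" "wins_within \<phi> t (q, r, b)"
          using Suc.prems(1) Some Claim by (subst (asm) wins_within_Suc) auto
        then show ?thesis using Some Claim ** Suc.prems(2) by (subst Win_Position) auto
      next
        case False
        then show ?thesis using Suc.prems(1) Some Claim *
          by (subst (asm) wins_within_Suc) auto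
      qed
    qed (use Suc.prems(1) Some * in \<open>subst (asm) wins_within_Suc, subst Win_Position;
        auto split: if_splits\<close>)+
  qed
qed

lemma models_omega_iff_wins_within:
  "models_omega s \<phi> \<longleftrightarrow> (\<exists>t. wins_within \<phi> t ([], s, Plus))"
  unfolding models_omega_iff using wins_within_if_Win Win_if_wins_within by blast

subsection \<open>Shifted variables and prenex sentences\<close>

lemma trm_val_cong: "(\<And>x. x \<in> trm_vars t \<Longrightarrow> r x = r' x) \<Longrightarrow> trm_val r t = trm_val r' t"
proof (induction t)
  case (Add t u)
  have "trm_val r t = trm_val r' t" "trm_val r u = trm_val r' u"
    by (rule Add.IH; simp add: Add.prems)+
  then show ?case by simp
next
  case (Mul t u)
  have "trm_val r t = trm_val r' t" "trm_val r u = trm_val r' u"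
    by (rule Mul.IH; simp add: Mul.prems)+
  then show ?case by simp
qed auto

lemma atom_true_cong:
  assumes "\<And>x. x \<in> atom_vars \<alpha> \<Longrightarrow> r x = r' x"
  shows "atom_true r \<alpha> \<longleftrightarrow> atom_true r' \<alpha>"
proof (cases \<alpha>)
  case (Equal t u)
  then have "trm_val r t = trm_val r' t" "trm_val r u = trm_val r' u"
    using assms by (auto intro!: trm_val_cong)
  then show ?thesis using Equal by simp
next
  case (Less t u)
  then have "trm_val r t = trm_val r' t" "trm_val r u = trm_val r' u"
    using assms by (auto intro!: trm_val_cong)
  then show ?thesis using Less by simp
qed simp

lemma fo_true_cong: "(\<And>x. x \<in> fo_free \<phi> \<Longrightarrow> r x = r' x) \<Longrightarrow> fo_true r \<phi> \<longleftrightarrow> fo_true r' \<phi>"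
proof (induction \<phi> arbitrary: r r')
  case (FAtom \<alpha>)
  have "atom_true r \<alpha> = atom_true r' \<alpha>" by (rule atom_true_cong) (simp add: FAtom)
  then show ?case by simp
next
  case (FNeg \<phi>)
  have "fo_true r \<phi> = fo_true r' \<phi>" by (rule FNeg.IH) (simp add: FNeg.prems)
  then show ?case by simp
next
  case (FConj \<phi> \<psi>)
  have "fo_true r \<phi> = fo_true r' \<phi>" "fo_true r \<psi> = fo_true r' \<psi>"
    by (rule FConj.IH; simp add: FConj.prems)+
  then show ?case by simp
next
  case (FDisj \<phi> \<psi>)
  have "fo_true r \<phi> = fo_true r' \<phi>" "fo_true r \<psi> = fo_true r' \<psi>"
    by (rule FDisj.IH; simp add: FDisj.prems)+
  then show ?case by simp
next
  case (FExists x \<phi>)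
  have "fo_true (r(x := a)) \<phi> = fo_true (r'(x := a)) \<phi>" for a
    by (rule FExists.IH) (simp add: FExists.prems)
  then show ?case by simp
next
  case (FForall x \<phi>)
  have "fo_true (r(x := a)) \<phi> = fo_true (r'(x := a)) \<phi>" for a
    by (rule FForall.IH) (simp add: FForall.prems)
  then show ?case by simp
qed

primrec trm_shift :: "nat \<Rightarrow> trm \<Rightarrow> trm" where
  "trm_shift d (Var x) = Var (d + x)"
| "trm_shift d Zero = Zero"
| "trm_shift d (Succ t) = Succ (trm_shift d t)"
| "trm_shift d (Add t u) = Add (trm_shift d t) (trm_shift d u)"
| "trm_shift d (Mul t u) = Mul (trm_shift d t) (trm_shift d u)"

primrec atom_shift :: "nat \<Rightarrow> atom \<Rightarrow> atom" where
  "atom_shift d Falsum = Falsum"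
| "atom_shift d (Equal t u) = Equal (trm_shift d t) (trm_shift d u)"
| "atom_shift d (Less t u) = Less (trm_shift d t) (trm_shift d u)"

primrec fo_shift :: "nat \<Rightarrow> fo \<Rightarrow> fo" where
  "fo_shift d (FAtom \<alpha>) = FAtom (atom_shift d \<alpha>)"
| "fo_shift d (FNeg \<phi>) = FNeg (fo_shift d \<phi>)"
| "fo_shift d (FConj \<phi> \<psi>) = FConj (fo_shift d \<phi>) (fo_shift d \<psi>)"
| "fo_shift d (FDisj \<phi> \<psi>) = FDisj (fo_shift d \<phi>) (fo_shift d \<psi>)"
| "fo_shift d (FExists x \<phi>) = FExists (d + x) (fo_shift d \<phi>)"
| "fo_shift d (FForall x \<phi>) = FForall (d + x) (fo_shift d \<phi>)"

lemma trm_val_shift: "trm_val r (trm_shift d t) = trm_val (\<lambda>x. r (d + x)) t"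
  by (induction t) auto

lemma atom_true_shift: "atom_true r (atom_shift d \<alpha>) \<longleftrightarrow> atom_true (\<lambda>x. r (d + x)) \<alpha>"
  by (cases \<alpha>) (auto simp: trm_val_shift)

lemma fo_true_shift:
  "quantifier_free \<phi> \<Longrightarrow> fo_true r (fo_shift d \<phi>) \<longleftrightarrow> fo_true (\<lambda>x. r (d + x)) \<phi>"
  by (induction \<phi>) (auto simp: atom_true_shift)

lemma quantifier_free_shift: "quantifier_free (fo_shift d \<phi>) \<longleftrightarrow> quantifier_free \<phi>"
  by (induction \<phi>) auto

lemma trm_vars_shift: "trm_vars (trm_shift d t) = (+) d ` trm_vars t"
  by (induction t) auto

lemma atom_vars_shift: "atom_vars (atom_shift d \<alpha>) = (+) d ` atom_vars \<alpha>"
  by (cases \<alpha>) (auto simp: trm_vars_shift)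

lemma fo_free_shift: "quantifier_free \<phi> \<Longrightarrow> fo_free (fo_shift d \<phi>) = (+) d ` fo_free \<phi>"
  by (induction \<phi>) (auto simp: atom_vars_shift)

primrec num :: "nat \<Rightarrow> trm" where
  "num 0 = Zero"
| "num (Suc n) = Succ (num n)"

lemma trm_val_num [simp]: "trm_val r (num n) = n"
  by (induction n) auto

lemma trm_vars_num [simp]: "trm_vars (num n) = {}"
  by (induction n) auto

abbreviation FEq :: "trm \<Rightarrow> trm \<Rightarrow> fo" where
  "FEq t u \<equiv> FAtom (Equal t u)"

definition fo_Conj :: "fo list \<Rightarrow> fo" where
  "fo_Conj \<phi>s = foldr FConj \<phi>s (FNeg (FAtom Falsum))"

definition fo_Disj :: "fo list \<Rightarrow> fo" where
  "fo_Disj \<phi>s = foldr FDisj \<phi>s (FAtom Falsum)"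

lemma fo_Conj_simps [simp]:
  "fo_true r (fo_Conj \<phi>s) \<longleftrightarrow> (\<forall>\<phi>\<in>set \<phi>s. fo_true r \<phi>)"
  "quantifier_free (fo_Conj \<phi>s) \<longleftrightarrow> (\<forall>\<phi>\<in>set \<phi>s. quantifier_free \<phi>)"
  "fo_free (fo_Conj \<phi>s) = (\<Union>\<phi>\<in>set \<phi>s. fo_free \<phi>)"
  unfolding fo_Conj_def by (induction \<phi>s) auto

lemma fo_Disj_simps [simp]:
  "fo_true r (fo_Disj \<phi>s) \<longleftrightarrow> (\<exists>\<phi>\<in>set \<phi>s. fo_true r \<phi>)"
  "quantifier_free (fo_Disj \<phi>s) \<longleftrightarrow> (\<forall>\<phi>\<in>set \<phi>s. quantifier_free \<phi>)"
  "fo_free (fo_Disj \<phi>s) = (\<Union>\<phi>\<in>set \<phi>s. fo_free \<phi>)"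
  unfolding fo_Disj_def by (induction \<phi>s) auto

definition ex_block :: "nat \<Rightarrow> nat \<Rightarrow> fo \<Rightarrow> fo" where
  "ex_block d n = foldr (\<lambda>x. FExists (d + x)) [0..<n]"

text \<open>The quantified values are collected in one function. The induction peels off the
  innermost quantifier, which is why \<open>\<phi>\<close> varies.\<close>

lemma fo_true_ex_block:
  "fo_true r (ex_block d n \<phi>) \<longleftrightarrow>
     (\<exists>f. fo_true (\<lambda>x. if d \<le> x \<and> x < d + n then f x else r x) \<phi>)"
proof (induction n arbitrary: \<phi>)
  case 0
  have "(\<lambda>x. if d \<le> x \<and> x < d + 0 then f x else r x) = r" for f by auto
  then show ?case by (simp add: ex_block_def)
next
  case (Suc n)
  let ?g = "\<lambda>n f x. if d \<le> x \<and> x < d + n then f x else r x"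
  have 1: "(?g n f)(d + n := a) = ?g (Suc n) (f(d + n := a))" for f and a :: nat
    by (auto simp: fun_eq_iff)
  have 2: "?g (Suc n) f = (?g n f)(d + n := f (d + n))" for f
    by (auto simp: fun_eq_iff less_Suc_eq)
  have "ex_block d (Suc n) \<phi> = ex_block d n (FExists (d + n) \<phi>)"
    by (simp add: ex_block_def)
  then have "fo_true r (ex_block d (Suc n) \<phi>) \<longleftrightarrow> (\<exists>f a. fo_true ((?g n f)(d + n := a)) \<phi>)"
    using Suc.IH[of "FExists (d + n) \<phi>"] by simp
  also have "\<dots> \<longleftrightarrow> (\<exists>f. fo_true (?g (Suc n) f) \<phi>)"
  proof (intro iffI; elim exE)
    fix f a assume "fo_true ((?g n f)(d + n := a)) \<phi>"
    then show "\<exists>f. fo_true (?g (Suc n) f) \<phi>" unfolding 1 by (intro exI[of _ "f(d + n := a)"])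
  next
    fix f assume "fo_true (?g (Suc n) f) \<phi>"
    then show "\<exists>f a. fo_true ((?g n f)(d + n := a)) \<phi>" unfolding 2 by (intro exI)
  qed
  finally show ?case .
qed

lemma fo_free_ex_block: "fo_free (ex_block d n \<phi>) = fo_free \<phi> - {d..<d + n}"
proof (induction n arbitrary: \<phi>)
  case (Suc n)
  have "ex_block d (Suc n) \<phi> = ex_block d n (FExists (d + n) \<phi>)"
    by (simp add: ex_block_def)
  then have "fo_free (ex_block d (Suc n) \<phi>) = fo_free \<phi> - {d + n} - {d..<d + n}"
    by (simp add: Suc.IH)
  moreover have "{d..<d + Suc n} = insert (d + n) {d..<d + n}" by auto
  ultimately show ?case by (simp only: Diff_insert2[of "fo_free \<phi>" "d + n" "{d..<d + n}"])
qed (simp add: ex_block_def)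

lemma prenex_ex_block: "prenex \<phi> \<Longrightarrow> prenex (ex_block d n \<phi>)"
proof -
  assume "prenex \<phi>"
  then have "prenex (foldr (\<lambda>x. FExists (d + x)) xs \<phi>)" for xs
    by (induction xs) (auto intro: prenex.intros)
  then show ?thesis by (simp add: ex_block_def)
qed

subsection \<open>The game as a prenex sentence\<close>

primrec addresses :: "scl \<Rightarrow> address list" where
  "addresses (Atom \<alpha>) = [[]]"
| "addresses (Neg \<phi>) = [] # map ((#) 0) (addresses \<phi>)"
| "addresses (Conj \<phi> \<psi>) = [] # map ((#) 0) (addresses \<phi>) @ map ((#) 1) (addresses \<psi>)"
| "addresses (Disj \<phi> \<psi>) = [] # map ((#) 0) (addresses \<phi>) @ map ((#) 1) (addresses \<psi>)"
| "addresses (Exists x \<phi>) = [] # map ((#) 0) (addresses \<phi>)"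
| "addresses (Forall x \<phi>) = [] # map ((#) 0) (addresses \<phi>)"
| "addresses (Label L \<phi>) = [] # map ((#) 0) (addresses \<phi>)"
| "addresses (Claim L) = [[]]"

lemma set_addresses: "p \<in> set (addresses \<phi>) \<longleftrightarrow> subformula_at \<phi> p \<noteq> None"
proof (induction \<phi> arbitrary: p)
  case (Atom \<alpha>) then show ?case by (cases p) auto
next
  case (Neg \<phi>) then show ?case by (cases p) auto
next
  case (Conj \<phi> \<psi>) then show ?case by (cases p) (auto simp: less_Suc_eq)
next
  case (Disj \<phi> \<psi>) then show ?case by (cases p) (auto simp: less_Suc_eq)
next
  case (Exists x \<phi>) then show ?case by (cases p) auto
next
  case (Forall x \<phi>) then show ?case by (cases p) auto
next
  case (Label L \<phi>) then show ?case by (cases p) auto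
next
  case (Claim L) then show ?case by (cases p) auto
qed

text \<open>Bound occurrences are included: a claim jumps back to a larger formula with the current
  assignment, so the future of a play may depend on variables that are not free in the current
  subformula.\<close>

primrec scl_atom_vars :: "scl \<Rightarrow> nat set" where
  "scl_atom_vars (Atom \<alpha>) = atom_vars \<alpha>"
| "scl_atom_vars (Neg \<phi>) = scl_atom_vars \<phi>"
| "scl_atom_vars (Conj \<phi> \<psi>) = scl_atom_vars \<phi> \<union> scl_atom_vars \<psi>"
| "scl_atom_vars (Disj \<phi> \<psi>) = scl_atom_vars \<phi> \<union> scl_atom_vars \<psi>"
| "scl_atom_vars (Exists x \<phi>) = scl_atom_vars \<phi>"
| "scl_atom_vars (Forall x \<phi>) = scl_atom_vars \<phi>"
| "scl_atom_vars (Label L \<phi>) = scl_atom_vars \<phi>"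
| "scl_atom_vars (Claim L) = {}"

lemma finite_trm_vars: "finite (trm_vars t)"
  by (induction t) auto

lemma finite_atom_vars: "finite (atom_vars \<alpha>)"
  by (cases \<alpha>) (auto simp: finite_trm_vars)

lemma finite_scl_atom_vars: "finite (scl_atom_vars \<phi>)"
  by (induction \<phi>) (auto simp: finite_atom_vars)

lemma scl_atom_vars_subformula:
  "subformula_at \<phi> p = Some \<psi> \<Longrightarrow> scl_atom_vars \<psi> \<subseteq> scl_atom_vars \<phi>"
proof (induction p arbitrary: \<phi>)
  case (Cons i p)
  then have i: "i < length (children \<phi>)" "subformula_at (children \<phi> ! i) p = Some \<psi>"
    by (auto split: if_splits)
  then have "scl_atom_vars (children \<phi> ! i) \<subseteq> scl_atom_vars \<phi>"
    by (cases \<phi>) (auto simp: less_Suc_eq)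
  with Cons.IH[OF i(2)] show ?case by blast
qed simp

text \<open>The announcements determine the new address and sign without reference to the
  assignment, and an update affects both assignments alike.\<close>

lemma next_state_cong:
  "case next_state \<phi> e a (p, r, b) of (p', q, b') \<Rightarrow>
    case next_state \<phi> e a (p, r', b) of (p'', q', b'') \<Rightarrow>
      p'' = p' \<and> b'' = b' \<and> (\<forall>x. r x = r' x \<longrightarrow> q x = q' x)"
proof (cases "subformula_at \<phi> p")
  case None
  then show ?thesis by simp
next
  case (Some \<psi>)
  then show ?thesis by (cases \<psi>) auto
qed

lemma wins_within_cong:
  "(\<And>x. x \<in> scl_atom_vars \<phi> \<Longrightarrow> r x = r' x) \<Longrightarrow>
    wins_within \<phi> t (p, r, b) \<longleftrightarrow> wins_within \<phi> t (p, r', b)"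
proof (induction t arbitrary: p r r' b)
  case 0
  have "atom_true r \<alpha> \<longleftrightarrow> atom_true r' \<alpha>" if "subformula_at \<phi> p = Some (Atom \<alpha>)" for \<alpha>
    using scl_atom_vars_subformula[OF that] 0 by (intro atom_true_cong) auto
  then show ?case by auto
next
  case (Suc t)
  have "wins_within \<phi> t (next_state \<phi> e a (p, r, b)) \<longleftrightarrow>
      wins_within \<phi> t (next_state \<phi> e a (p, r', b))" for e a
  proof -
    obtain p' b' q where 1: "next_state \<phi> e a (p, r, b) = (p', q, b')" by (metis prod_cases3)
    obtain q' where 2: "next_state \<phi> e a (p, r', b) = (p', q', b')"
      and q: "\<forall>x. r x = r' x \<longrightarrow> q x = q' x"
      using next_state_cong[where \<phi> = \<phi> and e = e and a = a and p = p and r = r and b = b and r' = r'] 1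
      by (auto simp del: next_state.simps split: prod.splits)
    show ?thesis unfolding 1 2 by (rule Suc.IH) (use q Suc.prems in blast)
  qed
  then show ?case by (simp del: next_state.simps)
qed

definition pos_code :: "address \<Rightarrow> sign \<Rightarrow> nat" where
  "pos_code p b = list_encode ((if b = Plus then 0 else 1) # p)"

lemma pos_code_inject [simp]: "pos_code p b = pos_code p' b' \<longleftrightarrow> p = p' \<and> b = b'"
  unfolding pos_code_def
  by (cases b; cases b') (auto simp: list_encode_eq simp del: list_encode.simps)

text \<open>
  A state is stored in \<open>V + 1\<close> consecutive variables: the code of the address and the sign,
  followed by the values of the first \<open>V\<close> variables of the assignment.  The variables \<open>V + 1\<close> and
  \<open>V + 2\<close> hold the numbers announced by Eloise and Abelard, and the next state starts at \<open>V + 3\<close>.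
\<close>

definition goto :: "nat \<Rightarrow> address \<Rightarrow> sign \<Rightarrow> (nat \<Rightarrow> nat) \<Rightarrow> fo" where
  "goto V q b u = FConj (FEq (Var (V + 3)) (num (pos_code q b)))
     (fo_Conj (map (\<lambda>y. FEq (Var (V + 4 + y)) (Var (u y))) [0..<V]))"

definition branch :: "nat \<Rightarrow> fo \<Rightarrow> fo \<Rightarrow> fo" where
  "branch x \<phi> \<psi> = FDisj (FConj (FEq (Var x) Zero) \<phi>) (FConj (FNeg (FEq (Var x) Zero)) \<psi>)"

text \<open>\<open>ex\<close> is the announcement of the player who chooses at disjunctions and
  existential quantifiers, \<open>un\<close> that of the opponent; \<open>Minus\<close> exchanges
  them. The source map \<open>Suc(x := ex)\<close> copies the stored assignment except that
  \<open>x\<close> takes the announced number.\<close>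

definition step_case :: "scl \<Rightarrow> nat \<Rightarrow> address \<Rightarrow> sign \<Rightarrow> fo" where
  "step_case \<phi> V p b =
    (let ex = (if b = Plus then V + 1 else V + 2); un = (if b = Plus then V + 2 else V + 1) in
     case subformula_at \<phi> p of
        None \<Rightarrow> goto V p b Suc
      | Some (Atom \<alpha>) \<Rightarrow> goto V p b Suc
      | Some (Neg \<psi>) \<Rightarrow> goto V (p @ [0]) (flip b) Suc
      | Some (Conj \<psi> \<theta>) \<Rightarrow> branch un (goto V (p @ [0]) b Suc) (goto V (p @ [1]) b Suc)
      | Some (Disj \<psi> \<theta>) \<Rightarrow> branch ex (goto V (p @ [0]) b Suc) (goto V (p @ [1]) b Suc)
      | Some (Exists x \<psi>) \<Rightarrow> goto V (p @ [0]) b (Suc(x := ex))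
      | Some (Forall x \<psi>) \<Rightarrow> goto V (p @ [0]) b (Suc(x := un))
      | Some (Label L \<psi>) \<Rightarrow> goto V (p @ [0]) b Suc
      | Some (Claim L) \<Rightarrow>
          goto V (if \<exists>q. is_reference \<phi> p L q then THE q. is_reference \<phi> p L q else p) b Suc)"

definition at_positions :: "scl \<Rightarrow> (address \<Rightarrow> sign \<Rightarrow> fo) \<Rightarrow> fo" where
  "at_positions \<phi> F = fo_Disj (map (\<lambda>(p, b). FConj (FEq (Var 0) (num (pos_code p b))) (F p b))
     (List.product (addresses \<phi>) [Plus, Minus]))"

definition step_fo :: "scl \<Rightarrow> nat \<Rightarrow> fo" where
  "step_fo \<phi> V = at_positions \<phi> (step_case \<phi> V)"

text \<open>The shift by 1 skips the variable that stores the position code.\<close>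

definition won_case :: "scl \<Rightarrow> address \<Rightarrow> sign \<Rightarrow> fo" where
  "won_case \<phi> p b = (case subformula_at \<phi> p of
     Some (Atom \<alpha>) \<Rightarrow> if b = Plus then FAtom (atom_shift 1 \<alpha>) else FNeg (FAtom (atom_shift 1 \<alpha>))
   | _ \<Rightarrow> FAtom Falsum)"

definition won_fo :: "scl \<Rightarrow> fo" where
  "won_fo \<phi> = at_positions \<phi> (won_case \<phi>)"

lemma fo_true_goto:
  "fo_true r (goto V q b u) \<longleftrightarrow> r (V + 3) = pos_code q b \<and> (\<forall>y<V. r (V + 4 + y) = r (u y))"
  by (auto simp: goto_def)

lemma fo_true_at_positions:
  "fo_true r (at_positions \<phi> F) \<longleftrightarrow>
    (\<exists>p b. subformula_at \<phi> p \<noteq> None \<and> r 0 = pos_code p b \<and> fo_true r (F p b))"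
proof -
  have "b \<in> set [Plus, Minus]" for b by (cases b) auto
  then show ?thesis by (auto simp: at_positions_def set_addresses simp del: set_simps)
qed

lemma fo_true_step_case:
  "fo_true r (step_case \<phi> V p b) \<longleftrightarrow>
    (case next_state \<phi> (r (V + 1)) (r (V + 2)) (p, \<lambda>y. r (Suc y), b) of (p', r', b') \<Rightarrow>
       r (V + 3) = pos_code p' b' \<and> (\<forall>y<V. r (V + 4 + y) = r' y))"
proof (cases "subformula_at \<phi> p")
  case None then show ?thesis by (simp add: step_case_def fo_true_goto)
next
  case (Some \<psi>)
  then show ?thesis
    by (cases \<psi>; cases b) (auto simp: step_case_def fo_true_goto branch_def Let_def)
qed

lemma fo_true_won_fo:
  "fo_true r (won_fo \<phi>) \<longleftrightarrow>
    (\<exists>p b. subformula_at \<phi> p \<noteq> None \<and> r 0 = pos_code p b \<and> wins_within \<phi> 0 (p, \<lambda>y. r (Suc y), b))"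
proof -
  have "fo_true r (won_case \<phi> p b) \<longleftrightarrow> wins_within \<phi> 0 (p, \<lambda>y. r (Suc y), b)" for p b
    by (auto simp: won_case_def atom_true_shift split: option.split scl.split)
  then show ?thesis unfolding won_fo_def fo_true_at_positions by blast
qed

lemma quantifier_free_step_fo: "quantifier_free (step_fo \<phi> V)"
  by (auto simp: step_fo_def at_positions_def step_case_def goto_def branch_def Let_def
      split: option.split scl.split)

lemma quantifier_free_won_fo: "quantifier_free (won_fo \<phi>)"
  by (auto simp: won_fo_def won_case_def at_positions_def split: option.split scl.split)

lemma fo_free_goto:
  assumes "\<And>y. y < V \<Longrightarrow> u y < V + 3"
  shows "fo_free (goto V q b u) \<subseteq> {..<2 * V + 4}"
  using assms by (fastforce simp: goto_def)

lemma fo_free_step_fo: "fo_free (step_fo \<phi> V) \<subseteq> {..<2 * V + 4}"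
proof -
  have "fo_free (step_case \<phi> V p b) \<subseteq> {..<2 * V + 4}" for p b
    using fo_free_goto[of V Suc] fo_free_goto[of V "Suc(x := V + 1)" for x]
      fo_free_goto[of V "Suc(x := V + 2)" for x]
    by (auto simp: step_case_def branch_def Let_def split: option.split scl.split)
  then have "x < 2 * V + 4" if "x \<in> fo_free (step_case \<phi> V p b)" for x p b
    using that by blast
  then show ?thesis by (auto simp: step_fo_def at_positions_def)
qed

lemma fo_free_won_fo:
  assumes "scl_atom_vars \<phi> \<subseteq> {..<V}"
  shows "fo_free (won_fo \<phi>) \<subseteq> {..<V + 1}"
proof -
  have "fo_free (won_case \<phi> p b) \<subseteq> {..<V + 1}" for p b
  proof (cases "\<exists>\<alpha>. subformula_at \<phi> p = Some (Atom \<alpha>)")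
    case True
    then obtain \<alpha> where \<alpha>: "subformula_at \<phi> p = Some (Atom \<alpha>)" by blast
    then have "atom_vars \<alpha> \<subseteq> {..<V}"
      using scl_atom_vars_subformula[OF \<alpha>] assms by simp
    then show ?thesis using \<alpha> by (auto simp: won_case_def atom_vars_shift)
  qed (auto simp: won_case_def split: option.split scl.split)
  then have "x < V + 1" if "x \<in> fo_free (won_case \<phi> p b)" for x p b
    using that by blast
  then show ?thesis unfolding won_fo_def at_positions_def by (auto simp del: One_nat_def)
qed

text \<open>The block for the next state stands behind both announcements. Its values are forced by
  the step formula, so quantifying it existentially gives Eloise no additional choice.\<close>

definition round_prefix :: "nat \<Rightarrow> nat \<Rightarrow> fo \<Rightarrow> fo" where
  "round_prefix V d \<phi> = FExists (d + (V + 1)) (FForall (d + (V + 2)) (ex_block (d + (V + 3)) (V + 1) \<phi>))"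

text \<open>For the prenex form the step formulas of all rounds are collected behind the whole
  prefix. This is sound because the formula of a round does not mention variables quantified in
  later rounds.\<close>

definition game_matrix :: "scl \<Rightarrow> nat \<Rightarrow> nat \<Rightarrow> fo \<Rightarrow> fo" where
  "game_matrix \<phi> V t ini =
    foldr (\<lambda>i. FConj (fo_shift (i * (V + 3)) (step_fo \<phi> V))) [0..<t]
      (FConj (fo_shift (t * (V + 3)) (won_fo \<phi>)) ini)"

definition game_sentence :: "scl \<Rightarrow> nat \<Rightarrow> nat \<Rightarrow> fo \<Rightarrow> fo" where
  "game_sentence \<phi> V t ini =
    ex_block 0 (V + 1) (foldr (\<lambda>i. round_prefix V (i * (V + 3))) [0..<t] (game_matrix \<phi> V t ini))"

definition init_fo :: "nat \<Rightarrow> nat list \<Rightarrow> fo" where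
  "init_fo V ms = FConj (FEq (Var 0) (num (pos_code [] Plus)))
     (fo_Conj (map (\<lambda>y. FEq (Var (Suc y)) (num (if y < length ms then ms ! y else 0))) [0..<V]))"

definition wins_at :: "scl \<Rightarrow> nat \<Rightarrow> nat \<Rightarrow> assignment \<Rightarrow> bool" where
  "wins_at \<phi> n d r \<longleftrightarrow> (\<exists>p b. subformula_at \<phi> p \<noteq> None \<and> r d = pos_code p b \<and>
     wins_within \<phi> n (p, \<lambda>y. r (d + Suc y), b))"

text \<open>\<open>step_fo\<close> is a disjunction over the addresses of \<open>\<phi>\<close>, so
  plays must be known not to leave them.\<close>

lemma subformula_next_state:
  assumes "next_state \<phi> e a (p, r, b) = (p', r', b')" "subformula_at \<phi> p \<noteq> None"
  shows "subformula_at \<phi> p' \<noteq> None"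
proof -
  obtain \<psi> where \<psi>: "subformula_at \<phi> p = Some \<psi>" using assms(2) by blast
  show ?thesis
  proof (cases \<psi>)
    case (Claim L)
    show ?thesis
    proof (cases "\<exists>q. is_reference \<phi> p L q")
      case True
      then obtain q where q: "is_reference \<phi> p L q" by blast
      from q have "Ex (is_reference \<phi> p L)" by blast
      then have "p' = q" using assms \<psi> Claim the_reference[OF q] by simp
      then show ?thesis using q by (auto simp: is_reference_def label_at_def)
    next
      case False
      then have "Ex (is_reference \<phi> p L) = False" by blast
      then have "next_state \<phi> e a (p, r, b) = (p, r, b)"
        by (simp only: next_state.simps \<psi> Claim option.case scl.case if_False)
      then show ?thesis using assms by simp
    qed
  qed (use assms \<psi> in \<open>auto simp: subformula_at_append\<close>)
qed

lemma wins_at_0: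
  "wins_at \<phi> 0 d r \<longleftrightarrow> fo_true r (fo_shift d (won_fo \<phi>))"
  by (simp add: wins_at_def fo_true_shift[OF quantifier_free_won_fo] fo_true_won_fo)

definition block_update :: "nat \<Rightarrow> nat \<Rightarrow> nat \<Rightarrow> nat \<Rightarrow> (nat \<Rightarrow> nat) \<Rightarrow> assignment \<Rightarrow> assignment" where
  "block_update V d e a f r = (\<lambda>x. if d + (V + 3) \<le> x \<and> x < d + (V + 3) + (V + 1) then f x
     else (r(d + (V + 1) := e, d + (V + 2) := a)) x)"

lemma fo_true_round_prefix:
  "fo_true r (round_prefix V d \<phi>) \<longleftrightarrow> (\<exists>e. \<forall>a. \<exists>f. fo_true (block_update V d e a f r) \<phi>)"
  by (simp only: round_prefix_def fo_true.simps fo_true_ex_block block_update_def)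

lemma fo_true_step_block_update:
  "fo_true (block_update V d e a f r) (fo_shift d (step_fo \<phi> V)) \<longleftrightarrow>
    (\<exists>p b. subformula_at \<phi> p \<noteq> None \<and> r d = pos_code p b \<and>
      (case next_state \<phi> e a (p, \<lambda>y. r (d + Suc y), b) of (p', r', b') \<Rightarrow>
        f (d + (V + 3)) = pos_code p' b' \<and> (\<forall>y<V. f (d + (V + 4 + y)) = r' y)))"
proof -
  let ?u = "block_update V d e a f r"
  have u: "?u d = r d" "?u (d + (V + 1)) = e" "?u (d + (V + 2)) = a"
    "?u (d + (V + 3)) = f (d + (V + 3))"
    by (auto simp: block_update_def)
  have u': "?u (d + (V + 4 + y)) = f (d + (V + 4 + y))" "?u (d + Suc y) = r (d + Suc y)"
    if "y < V" for y
    using that by (auto simp: block_update_def)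
  have key: "(case next_state \<phi> e a (p, \<lambda>y. ?u (d + Suc y), b) of (p', r', b') \<Rightarrow>
        ?u (d + (V + 3)) = pos_code p' b' \<and> (\<forall>y<V. ?u (d + (V + 4 + y)) = r' y)) \<longleftrightarrow>
      (case next_state \<phi> e a (p, \<lambda>y. r (d + Suc y), b) of (p', r', b') \<Rightarrow>
        f (d + (V + 3)) = pos_code p' b' \<and> (\<forall>y<V. f (d + (V + 4 + y)) = r' y))" for p b
    using next_state_cong[where \<phi> = \<phi> and e = e and a = a and p = p and b = b
        and r = "\<lambda>y. ?u (d + Suc y)" and r' = "\<lambda>y. r (d + Suc y)"] u(4) u'
    by (auto simp del: next_state.simps split: prod.splits)
  show ?thesis
    unfolding fo_true_shift[OF quantifier_free_step_fo]
    unfolding step_fo_def fo_true_at_positions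
      fo_true_step_case add_0_right u(1-3) key by (rule refl)
qed

text \<open>The step formula pins the next block down to the encoding of the successor state, so the
  quantifier over \<open>f\<close> disappears and the quantifiers over \<open>e\<close> and
  \<open>a\<close> of \<open>wins_within\<close> remain.\<close>

lemma wins_at_Suc:
  assumes V: "scl_atom_vars \<phi> \<subseteq> {..<V}"
  shows "wins_at \<phi> (Suc n) d r \<longleftrightarrow>
    (\<exists>e. \<forall>a. \<exists>f. fo_true (block_update V d e a f r) (fo_shift d (step_fo \<phi> V)) \<and>
       wins_at \<phi> n (d + (V + 3)) (block_update V d e a f r))"
proof -
  let ?r = "\<lambda>y. r (d + Suc y)"
  let ?u = "\<lambda>e a f. block_update V d e a f r"
  have wins: "wins_at \<phi> n (d + (V + 3)) (?u e a f) \<longleftrightarrow> wins_within \<phi> n (p', r', b')"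
    if "subformula_at \<phi> p' \<noteq> None" "f (d + (V + 3)) = pos_code p' b'"
      "\<forall>y<V. f (d + (V + 4 + y)) = r' y" for e a f p' r' b'
  proof -
    have "?u e a f (d + (V + 3)) = pos_code p' b'"
      using that(2) by (simp add: block_update_def)
    moreover have "?u e a f (d + (V + 3) + Suc y) = r' y" if "y < V" for y
    proof -
      have "?u e a f (d + (V + 3) + Suc y) = f (d + (V + 4 + y))"
        using that by (simp add: block_update_def ac_simps)
      then show ?thesis using that \<open>\<forall>y<V. f (d + (V + 4 + y)) = r' y\<close> by simp
    qed
    then have "wins_within \<phi> n (p', \<lambda>y. ?u e a f (d + (V + 3) + Suc y), b')
        \<longleftrightarrow> wins_within \<phi> n (p', r', b')"
      using V by (intro wins_within_cong) blast
    ultimately show ?thesis using that(1) by (auto simp: wins_at_def)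
  qed
  have iff: "(\<exists>f. fo_true (?u e a f) (fo_shift d (step_fo \<phi> V)) \<and> wins_at \<phi> n (d + (V + 3)) (?u e a f))
      \<longleftrightarrow> (\<exists>p b. subformula_at \<phi> p \<noteq> None \<and> r d = pos_code p b \<and>
        wins_within \<phi> n (next_state \<phi> e a (p, ?r, b)))" (is "?L \<longleftrightarrow> ?R") for e a
  proof
    assume ?L
    then obtain f where f: "fo_true (?u e a f) (fo_shift d (step_fo \<phi> V))"
      and 3: "wins_at \<phi> n (d + (V + 3)) (?u e a f)" by blast
    obtain p b where 1: "subformula_at \<phi> p \<noteq> None" "r d = pos_code p b"
      and 2: "case next_state \<phi> e a (p, ?r, b) of (p', r', b') \<Rightarrow>
        f (d + (V + 3)) = pos_code p' b' \<and> (\<forall>y<V. f (d + (V + 4 + y)) = r' y)"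
      using f unfolding fo_true_step_block_update by (elim exE conjE) (rule that)
    obtain p' r' b' where nx: "next_state \<phi> e a (p, ?r, b) = (p', r', b')" by (metis prod_cases3)
    have "wins_within \<phi> n (p', r', b')"
      using 2 3 wins[OF subformula_next_state[OF nx 1(1)]] unfolding nx by blast
    then have "wins_within \<phi> n (next_state \<phi> e a (p, ?r, b))" by (simp only: nx)
    then show ?R using 1 by blast
  next
    assume ?R
    then obtain p b where 1: "subformula_at \<phi> p \<noteq> None" "r d = pos_code p b"
      "wins_within \<phi> n (next_state \<phi> e a (p, ?r, b))" by blast
    obtain p' r' b' where nx: "next_state \<phi> e a (p, ?r, b) = (p', r', b')" by (metis prod_cases3)
    define f where "f x = (if x = d + (V + 3) then pos_code p' b' else r' (x - (d + (V + 4))))" for x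
    have f: "f (d + (V + 3)) = pos_code p' b'" "\<forall>y<V. f (d + (V + 4 + y)) = r' y"
      by (simp_all add: f_def)
    have "fo_true (?u e a f) (fo_shift d (step_fo \<phi> V))"
      unfolding fo_true_step_block_update
      by (intro exI[of _ p] exI[of _ b]) (use 1(1,2) f in \<open>simp only: nx case_prod_conv simp_thms not_False_eq_True\<close>)
    moreover have "wins_at \<phi> n (d + (V + 3)) (?u e a f)"
      using wins[OF subformula_next_state[OF nx 1(1)] f] 1(3) unfolding nx by blast
    ultimately show ?L by blast
  qed
  have "wins_at \<phi> (Suc n) d r \<longleftrightarrow> (\<exists>e. \<forall>a. \<exists>p b. subformula_at \<phi> p \<noteq> None \<and> r d = pos_code p b \<and>
        wins_within \<phi> n (next_state \<phi> e a (p, ?r, b)))"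
  \<comment> \<open>Position codes are injective, so at most one state is stored at \<open>d\<close>
    and decoding it commutes with the quantifiers for the announcements.\<close>
  proof (cases "\<exists>p b. subformula_at \<phi> p \<noteq> None \<and> r d = pos_code p b")
    case True
    then obtain p b where p: "subformula_at \<phi> p \<noteq> None" "r d = pos_code p b" by blast
    have *: "(\<exists>p' b'. subformula_at \<phi> p' \<noteq> None \<and> r d = pos_code p' b' \<and> Q p' b') \<longleftrightarrow> Q p b" for Q
      using p by auto
    show ?thesis unfolding wins_at_def * wins_within.simps by (rule refl)
  next
    case False
    then show ?thesis unfolding wins_at_def by blast
  qed
  then show ?thesis unfolding iff .
qed


lemma fo_true_block_update_below:
  assumes "\<And>x. x \<in> fo_free \<psi> \<Longrightarrow> x < d + (V + 1)"
  shows "fo_true (block_update V d e a f r) \<psi> \<longleftrightarrow> fo_true r \<psi>"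
  using assms by (intro fo_true_cong) (fastforce simp: block_update_def)

text \<open>Consecutive rounds overlap in a state block. As \<open>2 * V + 4\<close> is
  \<open>(V + 3) + (V + 1)\<close>, the formula of round \<open>j\<close> reaches exactly to the end
  of the state block of round \<open>j + 1\<close>.\<close>

lemma fo_free_step_fo_shift:
  assumes "x \<in> fo_free (fo_shift (j * (V + 3)) (step_fo \<phi> V))" "j < i"
  shows "x < i * (V + 3) + (V + 1)"
proof -
  have "x < j * (V + 3) + (2 * V + 4)"
    using assms(1) fo_free_step_fo[of \<phi> V]
    by (auto simp: fo_free_shift[OF quantifier_free_step_fo] simp del: One_nat_def)
  also have "\<dots> = Suc j * (V + 3) + (V + 1)" by simp
  also have "\<dots> \<le> i * (V + 3) + (V + 1)"
    using assms(2) mult_le_mono1[of "Suc j" i "V + 3"] by simp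
  finally show ?thesis .
qed

lemma foldr_FConj_simps:
  "fo_true r (foldr (\<lambda>i. FConj (F i)) xs \<phi>) \<longleftrightarrow> (\<forall>i\<in>set xs. fo_true r (F i)) \<and> fo_true r \<phi>"
  "fo_free (foldr (\<lambda>i. FConj (F i)) xs \<phi>) = (\<Union>i\<in>set xs. fo_free (F i)) \<union> fo_free \<phi>"
  "quantifier_free (foldr (\<lambda>i. FConj (F i)) xs \<phi>) \<longleftrightarrow>
    (\<forall>i\<in>set xs. quantifier_free (F i)) \<and> quantifier_free \<phi>"
  by (induction xs) auto

text \<open>Downward induction on the number \<open>i\<close> of rounds whose variables already have
  values: the step formulas before \<open>i\<close> are then plain conjuncts, and the remaining
  quantifiers amount to \<open>wins_at\<close>.\<close>

lemma fo_true_rounds: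
  assumes V: "scl_atom_vars \<phi> \<subseteq> {..<V}" and ini: "\<And>x. x \<in> fo_free ini \<Longrightarrow> x < V + 1" and "i \<le> t"
  shows "fo_true r (foldr (\<lambda>i. round_prefix V (i * (V + 3))) [i..<t] (game_matrix \<phi> V t ini)) \<longleftrightarrow>
    fo_true r ini \<and> (\<forall>j<i. fo_true r (fo_shift (j * (V + 3)) (step_fo \<phi> V))) \<and>
    wins_at \<phi> (t - i) (i * (V + 3)) r"
  using \<open>i \<le> t\<close>
proof (induction i arbitrary: r rule: inc_induct)
  case base
  show ?case by (auto simp: game_matrix_def foldr_FConj_simps wins_at_0)
next
  case (step i)
  let ?d = "i * (V + 3)"
  let ?u = "\<lambda>e a f. block_update V ?d e a f r"
  have 1: "fo_true (?u e a f) ini \<longleftrightarrow> fo_true r ini" for e a f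
    using ini by (intro fo_true_block_update_below) fastforce
  have 2: "fo_true (?u e a f) (fo_shift (j * (V + 3)) (step_fo \<phi> V)) \<longleftrightarrow>
      fo_true r (fo_shift (j * (V + 3)) (step_fo \<phi> V))" if "j < i" for e a f j
    using fo_free_step_fo_shift[OF _ that] by (intro fo_true_block_update_below) blast
  have 3: "(\<forall>j<Suc i. fo_true (?u e a f) (fo_shift (j * (V + 3)) (step_fo \<phi> V))) \<longleftrightarrow>
      (\<forall>j<i. fo_true r (fo_shift (j * (V + 3)) (step_fo \<phi> V))) \<and>
      fo_true (?u e a f) (fo_shift ?d (step_fo \<phi> V))" for e a f
    using 2 by (auto simp: less_Suc_eq)
  have 4: "t - i = Suc (t - Suc i)" "Suc i * (V + 3) = ?d + (V + 3)" using step.hyps by simp_all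
  have "[i..<t] = i # [Suc i..<t]" using step.hyps by (simp add: upt_conv_Cons)
  then have "fo_true r (foldr (\<lambda>i. round_prefix V (i * (V + 3))) [i..<t] (game_matrix \<phi> V t ini)) \<longleftrightarrow>
    (\<exists>e. \<forall>a. \<exists>f. fo_true (?u e a f)
      (foldr (\<lambda>i. round_prefix V (i * (V + 3))) [Suc i..<t] (game_matrix \<phi> V t ini)))"
    by (simp add: fo_true_round_prefix)
  also have "\<dots> \<longleftrightarrow> (\<exists>e. \<forall>a. \<exists>f. fo_true r ini \<and>
      (\<forall>j<i. fo_true r (fo_shift (j * (V + 3)) (step_fo \<phi> V))) \<and>
      fo_true (?u e a f) (fo_shift ?d (step_fo \<phi> V)) \<and>
      wins_at \<phi> (t - Suc i) (?d + (V + 3)) (?u e a f))"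
    unfolding step.IH 1 3 4(2) by blast
  finally show ?case unfolding 4(1) wins_at_Suc[OF V] by blast
qed

theorem fo_true_game_sentence:
  assumes V: "scl_atom_vars \<phi> \<subseteq> {..<V}" and ms: "length ms \<le> V"
  shows "fo_true r (game_sentence \<phi> V t (init_fo V ms)) \<longleftrightarrow>
    wins_within \<phi> t ([], \<lambda>i. if i < length ms then ms ! i else 0, Plus)"
proof -
  let ?s = "\<lambda>i. if i < length ms then ms ! i else 0"
  let ?r = "\<lambda>f x. if 0 \<le> x \<and> x < 0 + (V + 1) then f x else r x"
  have ini: "x < V + 1" if "x \<in> fo_free (init_fo V ms)" for x
    using that by (auto simp: init_fo_def)
  have *: "fo_true (?r f) (init_fo V ms) \<longleftrightarrow> f 0 = pos_code [] Plus \<and> (\<forall>y<V. f (Suc y) = ?s y)"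
    for f by (auto simp: init_fo_def)
  have **: "wins_at \<phi> t 0 (?r f) \<longleftrightarrow> wins_within \<phi> t ([], ?s, Plus)"
    if "f 0 = pos_code [] Plus" "\<forall>y<V. f (Suc y) = ?s y" for f
  proof -
    have "wins_within \<phi> t ([], \<lambda>y. ?r f (0 + Suc y), Plus) \<longleftrightarrow> wins_within \<phi> t ([], ?s, Plus)"
      using that V by (intro wins_within_cong) auto
    then show ?thesis using that(1) by (auto simp: wins_at_def)
  qed
  have ex: "\<exists>f. f 0 = pos_code [] Plus \<and> (\<forall>y<V. f (Suc y) = ?s y)"
    by (intro exI[of _ "case_nat (pos_code [] Plus) ?s"]) simp
  have "fo_true (?r f) (foldr (\<lambda>i. round_prefix V (i * (V + 3))) [0..<t] (game_matrix \<phi> V t (init_fo V ms)))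
      \<longleftrightarrow> (f 0 = pos_code [] Plus \<and> (\<forall>y<V. f (Suc y) = ?s y)) \<and> wins_within \<phi> t ([], ?s, Plus)" for f
  proof -
    have "fo_true (?r f) (foldr (\<lambda>i. round_prefix V (i * (V + 3))) [0..<t] (game_matrix \<phi> V t (init_fo V ms)))
      \<longleftrightarrow> fo_true (?r f) (init_fo V ms) \<and> wins_at \<phi> t 0 (?r f)"
      using fo_true_rounds[where ini = "init_fo V ms", OF V ini, where i = 0 and t = t and r = "?r f"]
      by simp
    then show ?thesis unfolding *[of f] using **[of f] by blast
  qed
  then show ?thesis
    unfolding game_sentence_def fo_true_ex_block using ex by (simp only:) blast
qed

lemma prenex_game_sentence: "prenex (game_sentence \<phi> V t (init_fo V ms))"
proof -
  have "quantifier_free (game_matrix \<phi> V t (init_fo V ms))"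
    by (simp add: game_matrix_def foldr_FConj_simps quantifier_free_shift quantifier_free_step_fo
        quantifier_free_won_fo) (auto simp: init_fo_def)
  then have "prenex (game_matrix \<phi> V t (init_fo V ms))" by (rule prenex.intros)
  then have "prenex (foldr (\<lambda>i. round_prefix V (i * (V + 3))) xs (game_matrix \<phi> V t (init_fo V ms)))"
    for xs by (induction xs) (auto simp: round_prefix_def intro!: prenex.intros(2,3) prenex_ex_block)
  then show ?thesis by (auto simp: game_sentence_def intro: prenex_ex_block)
qed

lemma fo_free_game_sentence:
  assumes V: "scl_atom_vars \<phi> \<subseteq> {..<V}"
  shows "fo_free (game_sentence \<phi> V t (init_fo V ms)) = {}"
proof -
  let ?M = "game_matrix \<phi> V t (init_fo V ms)"
  have "x < t * (V + 3) + (V + 1)" if "x \<in> fo_free (init_fo V ms)" for x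
    using that by (fastforce simp: init_fo_def)
  moreover have "x < t * (V + 3) + (V + 1)" if "x \<in> fo_free (fo_shift (t * (V + 3)) (won_fo \<phi>))" for x
    using that fo_free_won_fo[OF V] by (auto simp: fo_free_shift[OF quantifier_free_won_fo])
  ultimately have M: "fo_free ?M \<subseteq> {..<t * (V + 3) + (V + 1)}"
    using fo_free_step_fo_shift[of _ _ V \<phi> t]
    unfolding game_matrix_def foldr_FConj_simps fo_free.simps by fastforce
  have "fo_free (foldr (\<lambda>i. round_prefix V (i * (V + 3))) [i..<t] ?M) \<subseteq> {..<i * (V + 3) + (V + 1)}"
    if "i \<le> t" for i
    using that
  proof (induction i rule: inc_induct)
    case base
    then show ?case using M by simp
  next
    case (step i)
    have "[i..<t] = i # [Suc i..<t]" using step.hyps by (simp add: upt_conv_Cons)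
    moreover have "x < i * (V + 3) + (V + 1)"
      if "x < Suc i * (V + 3) + (V + 1)" "x \<noteq> i * (V + 3) + (V + 1)" "x \<noteq> i * (V + 3) + (V + 2)"
        "\<not> (i * (V + 3) + (V + 3) \<le> x \<and> x < i * (V + 3) + (V + 3) + (V + 1))" for x
      using that by simp
    ultimately show ?case
      using step.IH by (auto simp: round_prefix_def fo_free_ex_block subset_iff simp del: mult_Suc)
  qed
  from this[of 0] show ?thesis by (auto simp: game_sentence_def fo_free_ex_block)
qed

lemma game_sentence_in_true_arithmetic:
  assumes V: "scl_atom_vars \<phi> \<subseteq> {..<V}" and ms: "length ms \<le> V"
  shows "goedel (game_sentence \<phi> V t (init_fo V ms)) \<in> true_arithmetic \<longleftrightarrow>
    wins_within \<phi> t ([], \<lambda>i. if i < length ms then ms ! i else 0, Plus)"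
  using prenex_game_sentence fo_free_game_sentence[OF V] fo_true_game_sentence[OF V ms]
  by (auto simp: true_arithmetic_def goedel_inject)

subsection \<open>Computing the sentence\<close>

text \<open>The term is fixed, so its code after shifting by the value of \<open>d\<close> is a
  fixed expression in \<open>d\<close>; no syntax is analysed at run time.\<close>

primrec trm_exp :: "exp \<Rightarrow> trm \<Rightarrow> exp" where
  "trm_exp d (Var x) = EPair (EConst 0) (EAdd d (EConst x))"
| "trm_exp d Zero = EPair (EConst 1) (EConst 0)"
| "trm_exp d (Succ t) = EPair (EConst 2) (trm_exp d t)"
| "trm_exp d (Add t u) = EPair (EConst 3) (EPair (trm_exp d t) (trm_exp d u))"
| "trm_exp d (Mul t u) = EPair (EConst 4) (EPair (trm_exp d t) (trm_exp d u))"

primrec atom_exp :: "exp \<Rightarrow> atom \<Rightarrow> exp" where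
  "atom_exp d Falsum = EPair (EConst 0) (EConst 0)"
| "atom_exp d (Equal t u) = EPair (EConst 1) (EPair (trm_exp d t) (trm_exp d u))"
| "atom_exp d (Less t u) = EPair (EConst 2) (EPair (trm_exp d t) (trm_exp d u))"

primrec fo_exp :: "exp \<Rightarrow> fo \<Rightarrow> exp" where
  "fo_exp d (FAtom \<alpha>) = EPair (EConst 0) (atom_exp d \<alpha>)"
| "fo_exp d (FNeg \<phi>) = EPair (EConst 1) (fo_exp d \<phi>)"
| "fo_exp d (FConj \<phi> \<psi>) = EPair (EConst 2) (EPair (fo_exp d \<phi>) (fo_exp d \<psi>))"
| "fo_exp d (FDisj \<phi> \<psi>) = EPair (EConst 3) (EPair (fo_exp d \<phi>) (fo_exp d \<psi>))"
| "fo_exp d (FExists x \<phi>) = EPair (EConst 4) (EPair (EAdd d (EConst x)) (fo_exp d \<phi>))"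
| "fo_exp d (FForall x \<phi>) = EPair (EConst 5) (EPair (EAdd d (EConst x)) (fo_exp d \<phi>))"

lemma val_trm_exp: "val s (trm_exp d t) = trm_code (trm_shift (val s d) t)"
  by (induction t) auto

lemma val_atom_exp: "val s (atom_exp d \<alpha>) = atom_code (atom_shift (val s d) \<alpha>)"
  by (cases \<alpha>) (auto simp: val_trm_exp)

lemma val_fo_exp: "val s (fo_exp d \<phi>) = goedel (fo_shift (val s d) \<phi>)"
  by (induction \<phi>) (auto simp: val_atom_exp)

lemma exp_regs_trm_exp: "exp_regs (trm_exp d t) \<subseteq> exp_regs d"
  by (induction t) auto

lemma exp_regs_atom_exp: "exp_regs (atom_exp d \<alpha>) \<subseteq> exp_regs d"
  using exp_regs_trm_exp[of d] by (cases \<alpha>) auto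

lemma exp_regs_fo_exp: "exp_regs (fo_exp d \<phi>) \<subseteq> exp_regs d"
  using exp_regs_atom_exp[of d] by (induction \<phi>) auto

primrec scale :: "nat \<Rightarrow> exp \<Rightarrow> exp" where
  "scale 0 e = EConst 0"
| "scale (Suc n) e = EAdd e (scale n e)"

lemma val_scale: "val s (scale n e) = val s e * n"
  by (induction n) auto

lemma exp_regs_scale: "exp_regs (scale n e) \<subseteq> exp_regs e"
  by (induction n) auto

definition conj_exp :: "exp \<Rightarrow> exp \<Rightarrow> exp" where
  "conj_exp e e' = EPair (EConst 2) (EPair e e')"

definition block_exp :: "exp \<Rightarrow> nat \<Rightarrow> exp \<Rightarrow> exp" where
  "block_exp d n = foldr (\<lambda>x e. EPair (EConst 4) (EPair (EAdd d (EConst x)) e)) [0..<n]"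

definition round_exp :: "nat \<Rightarrow> exp \<Rightarrow> exp \<Rightarrow> exp" where
  "round_exp V d e = EPair (EConst 4) (EPair (EAdd d (EConst (V + 1)))
     (EPair (EConst 5) (EPair (EAdd d (EConst (V + 2)))
       (block_exp (EAdd d (EConst (V + 3))) (V + 1) e))))"

lemma val_conj_exp:
  "val s e = goedel \<phi> \<Longrightarrow> val s e' = goedel \<psi> \<Longrightarrow> val s (conj_exp e e') = goedel (FConj \<phi> \<psi>)"
  by (simp add: conj_exp_def)

lemma val_block_exp:
  assumes "val s e = goedel \<phi>"
  shows "val s (block_exp d n e) = goedel (ex_block (val s d) n \<phi>)"
proof -
  have "val s (foldr (\<lambda>x e. EPair (EConst 4) (EPair (EAdd d (EConst x)) e)) xs e) =
    goedel (foldr (\<lambda>x. FExists (val s d + x)) xs \<phi>)" for xs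
    using assms by (induction xs) auto
  then show ?thesis by (simp add: block_exp_def ex_block_def)
qed

lemma val_round_exp:
  "val s e = goedel \<phi> \<Longrightarrow> val s (round_exp V d e) = goedel (round_prefix V (val s d) \<phi>)"
  using val_block_exp[of s e \<phi> "EAdd d (EConst (V + 3))" "V + 1"]
  by (simp add: round_exp_def round_prefix_def)

lemma exp_regs_block_exp: "exp_regs (block_exp d n e) \<subseteq> exp_regs d \<union> exp_regs e"
proof -
  have "exp_regs (foldr (\<lambda>x e. EPair (EConst 4) (EPair (EAdd d (EConst x)) e)) xs e)
    \<subseteq> exp_regs d \<union> exp_regs e" for xs
    by (induction xs) auto
  then show ?thesis by (simp add: block_exp_def)
qed

lemma exp_regs_round_exp: "exp_regs (round_exp V d e) \<subseteq> exp_regs d \<union> exp_regs e"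
  using exp_regs_block_exp[of "EAdd d (EConst (V + 3))" "V + 1" e] by (auto simp: round_exp_def)

text \<open>
  Registers: the arguments are in \<open>0, \<dots>, k - 1\<close> and the number of rounds in \<open>k\<close>; \<open>k + 1\<close> is a loop
  counter, \<open>k + 2\<close> holds the code under construction, \<open>k + 3, \<dots>, 2 * k + 2\<close> the codes of the numerals
  of the arguments, and the registers from \<open>2 * k + 3\<close> on are scratch space.
\<close>

definition set_reg :: "nat \<Rightarrow> nat \<Rightarrow> exp \<Rightarrow> com" where
  "set_reg k = assign_exp (2 * k + 3)"

lemma exec_set_reg:
  assumes "exp_regs e \<subseteq> {..<2 * k + 3}" "x < 2 * k + 3" "\<And>y. 2 * k + 3 \<le> y \<Longrightarrow> s y = 0"
    "s' = s(x := val s e)"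
  shows "exec (set_reg k x e) s s'"
  using exec_assign_exp[OF assms(1-3)] assms(4) by (simp add: set_reg_def)

text \<open>The sentence depends on an argument through its numeral. The argument is counted down
  while \<open>Succ\<close> is wrapped around the numeral, and afterwards only the numeral is
  left.\<close>

primrec numerals_prog :: "nat \<Rightarrow> nat \<Rightarrow> com" where
  "numerals_prog k 0 = Skip"
| "numerals_prog k (Suc m) = numerals_prog k m ;; set_reg k (k + 3 + m) (EPair (EConst 1) (EConst 0)) ;;
     While m (Dec m ;; set_reg k (k + 3 + m) (EPair (EConst 2) (EReg (k + 3 + m))))"

definition numerals_state :: "nat \<Rightarrow> nat list \<Rightarrow> nat \<Rightarrow> nat \<Rightarrow> nat \<Rightarrow> nat" where
  "numerals_state k ms t m = (\<lambda>j. if j < m then 0 else if j < k then ms ! j else if j = k then t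
     else if k + 3 \<le> j \<and> j < k + 3 + m then trm_code (num (ms ! (j - (k + 3)))) else 0)"

lemma exec_numerals_prog:
  "m \<le> k \<Longrightarrow> exec (numerals_prog k m) (numerals_state k ms t 0) (numerals_state k ms t m)"
proof (induction m)
  case 0
  then show ?case by (simp add: exec_Skip)
next
  case (Suc m)
  let ?s = "numerals_state k ms t m"
  define S where "S j = ?s(m := j, k + 3 + m := trm_code (num (ms ! m - j)))" for j
  have 1: "exec (numerals_prog k m) (numerals_state k ms t 0) ?s" using Suc by simp
  have 2: "exec (set_reg k (k + 3 + m) (EPair (EConst 1) (EConst 0))) ?s (S (ms ! m))"
    by (rule exec_set_reg) (use Suc.prems in \<open>auto simp: S_def numerals_state_def fun_eq_iff\<close>)
  have 3: "exec (While m (Dec m ;; set_reg k (k + 3 + m) (EPair (EConst 2) (EReg (k + 3 + m)))))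
      (S (ms ! m)) (S 0)"
  proof (rule exec_For)
    fix j assume j: "j < ms ! m"
    then have "ms ! m - j = Suc (ms ! m - Suc j)" by simp
    then show "exec (set_reg k (k + 3 + m) (EPair (EConst 2) (EReg (k + 3 + m)))) ((S (Suc j))(m := j)) (S j)"
      by (intro exec_set_reg) (use Suc.prems in \<open>auto simp: S_def numerals_state_def fun_eq_iff\<close>)
  qed (simp add: S_def)
  have "S 0 = numerals_state k ms t (Suc m)"
    using Suc.prems by (auto simp: S_def numerals_state_def fun_eq_iff less_Suc_eq)
  then have 4: "exec (While m (Dec m ;; set_reg k (k + 3 + m) (EPair (EConst 2) (EReg (k + 3 + m)))))
      (S (ms ! m)) (numerals_state k ms t (Suc m))" using 3 by simp
  show ?case unfolding numerals_prog.simps by (rule exec_Seq[OF 1 exec_Seq[OF 2 4]])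
qed

text \<open>The code is spelled out by tags, 0 for \<open>FAtom\<close> and 1 for
  \<open>Equal\<close>, because the code of the numeral is read from a register.\<close>

definition init_eq_exp :: "nat \<Rightarrow> nat \<Rightarrow> exp" where
  "init_eq_exp k y = EPair (EConst 0) (EPair (EConst 1) (EPair (EConst (trm_code (Var (Suc y))))
     (if y < k then EReg (k + 3 + y) else EConst (trm_code Zero))))"

definition init_exp :: "nat \<Rightarrow> nat \<Rightarrow> exp" where
  "init_exp V k = conj_exp (EConst (goedel (FEq (Var 0) (num (pos_code [] Plus)))))
     (foldr (\<lambda>y. conj_exp (init_eq_exp k y))
       [0..<V] (EConst (goedel (FNeg (FAtom Falsum)))))"

lemma val_init_exp:
  assumes "\<And>y. y < k \<Longrightarrow> s (k + 3 + y) = trm_code (num (ms ! y))" "length ms = k"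
  shows "val s (init_exp V k) = goedel (init_fo V ms)"
proof -
  have "val s (foldr (\<lambda>y. conj_exp (init_eq_exp k y))
       xs (EConst (goedel (FNeg (FAtom Falsum))))) =
    goedel (foldr FConj (map (\<lambda>y. FEq (Var (Suc y)) (num (if y < length ms then ms ! y else 0))) xs)
       (FNeg (FAtom Falsum)))" for xs
    using assms by (induction xs) (auto simp: conj_exp_def init_eq_exp_def)
  then show ?thesis unfolding init_exp_def init_fo_def fo_Conj_def
    by (intro val_conj_exp) simp_all
qed

lemma exp_regs_init_exp: "exp_regs (init_exp V k) \<subseteq> {..<2 * k + 3}"
proof -
  have "exp_regs (foldr (\<lambda>y. conj_exp (init_eq_exp k y))
       xs (EConst (goedel (FNeg (FAtom Falsum))))) \<subseteq> {..<2 * k + 3}" for xs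
    by (induction xs) (auto simp: conj_exp_def init_eq_exp_def)
  then show ?thesis by (auto simp: init_exp_def conj_exp_def)
qed

text \<open>Round 0 is the outermost layer, so the code is built from the inside out with descending
  loop counters: the conjuncts of the matrix, then the prefix. Both loops use up their counter,
  hence the copies of register \<open>k\<close>.\<close>

definition sentence_prog :: "scl \<Rightarrow> nat \<Rightarrow> nat \<Rightarrow> com" where
  "sentence_prog \<phi> V k = numerals_prog k k ;;
     set_reg k (k + 2) (conj_exp (fo_exp (scale (V + 3) (EReg k)) (won_fo \<phi>)) (init_exp V k)) ;;
     set_reg k (k + 1) (EReg k) ;;
     While (k + 1) (Dec (k + 1) ;; set_reg k (k + 2)
       (conj_exp (fo_exp (scale (V + 3) (EReg (k + 1))) (step_fo \<phi> V)) (EReg (k + 2)))) ;;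
     set_reg k (k + 1) (EReg k) ;;
     While (k + 1) (Dec (k + 1) ;; set_reg k (k + 2)
       (round_exp V (scale (V + 3) (EReg (k + 1))) (EReg (k + 2)))) ;;
     set_reg k (k + 2) (block_exp (EConst 0) (V + 1) (EReg (k + 2)))"

lemma exec_sentence_prog:
  assumes ms: "length ms = k"
  shows "\<exists>s'. exec (sentence_prog \<phi> V k) (\<lambda>j. if j < Suc k then (ms @ [t]) ! j else 0) s' \<and>
    s' (k + 2) = goedel (game_sentence \<phi> V t (init_fo V ms))"
proof -
  let ?s = "numerals_state k ms t k"
  have s: "?s k = t" "?s y = 0" if "2 * k + 3 \<le> y" for y
    using that by (auto simp: numerals_state_def)
  have s_num: "?s (k + 3 + y) = trm_code (num (ms ! y))" if "y < k" for y
    using that by (auto simp: numerals_state_def)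
  have sk: "?s k = t" "?s (k + 1) = 0" by (auto simp: numerals_state_def)
  define core where "core = FConj (fo_shift (t * (V + 3)) (won_fo \<phi>)) (init_fo V ms)"
  define mat where "mat m = foldr (\<lambda>i. FConj (fo_shift (i * (V + 3)) (step_fo \<phi> V))) [m..<t] core" for m
  define pre where "pre m = foldr (\<lambda>i. round_prefix V (i * (V + 3))) [m..<t] (mat 0)" for m
  define S where "S m = ?s(k + 1 := m, k + 2 := goedel (mat m))" for m
  define S' where "S' m = ?s(k + 1 := m, k + 2 := goedel (pre m))" for m
  have "(\<lambda>j. if j < Suc k then (ms @ [t]) ! j else 0) = numerals_state k ms t 0"
    using ms by (auto simp: numerals_state_def fun_eq_iff nth_append less_Suc_eq)
  then have e1: "exec (numerals_prog k k) (\<lambda>j. if j < Suc k then (ms @ [t]) ! j else 0) ?s"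
    using exec_numerals_prog[of k k ms t] by simp
  have core: "val ?s (conj_exp (fo_exp (scale (V + 3) (EReg k)) (won_fo \<phi>)) (init_exp V k)) = goedel core"
    unfolding core_def
    by (rule val_conj_exp) (simp_all add: val_fo_exp val_scale sk val_init_exp[OF s_num ms] mult.commute)
  have e2: "exec (set_reg k (k + 2) (conj_exp (fo_exp (scale (V + 3) (EReg k)) (won_fo \<phi>)) (init_exp V k)))
      ?s (?s(k + 2 := goedel core))"
    by (rule exec_set_reg)
      (use exp_regs_fo_exp[of "scale (V + 3) (EReg k)" "won_fo \<phi>"] exp_regs_scale[of "V + 3" "EReg k"]
         exp_regs_init_exp[of V k] s core in \<open>auto simp: conj_exp_def\<close>)
  have "mat t = core" by (simp add: mat_def)
  then have e3: "exec (set_reg k (k + 1) (EReg k)) (?s(k + 2 := goedel core)) (S t)"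
    by (intro exec_set_reg) (auto simp: S_def s sk fun_eq_iff)
  have e4: "exec (While (k + 1) (Dec (k + 1) ;; set_reg k (k + 2)
       (conj_exp (fo_exp (scale (V + 3) (EReg (k + 1))) (step_fo \<phi> V)) (EReg (k + 2))))) (S t) (S 0)"
  proof (rule exec_For)
    fix m assume m: "m < t"
    let ?e = "conj_exp (fo_exp (scale (V + 3) (EReg (k + 1))) (step_fo \<phi> V)) (EReg (k + 2))"
    have "[m..<t] = m # [Suc m..<t]" using m by (simp add: upt_conv_Cons)
    then have "mat m = FConj (fo_shift (m * (V + 3)) (step_fo \<phi> V)) (mat (Suc m))"
      by (simp add: mat_def)
    then have "val ((S (Suc m))(k + 1 := m)) ?e = goedel (mat m)"
      by (simp only:) (rule val_conj_exp, simp_all add: val_fo_exp val_scale S_def mult.commute)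
    then show "exec (set_reg k (k + 2) ?e) ((S (Suc m))(k + 1 := m)) (S m)"
      by (intro exec_set_reg) (use exp_regs_fo_exp[of "scale (V + 3) (EReg (k + 1))" "step_fo \<phi> V"]
          exp_regs_scale[of "V + 3" "EReg (k + 1)"] s in \<open>auto simp: conj_exp_def S_def fun_eq_iff\<close>)
  qed (simp add: S_def)
  have "pre t = mat 0" by (simp add: pre_def)
  then have e5: "exec (set_reg k (k + 1) (EReg k)) (S 0) (S' t)"
    by (intro exec_set_reg) (auto simp: S_def S'_def s sk fun_eq_iff)
  have e6: "exec (While (k + 1) (Dec (k + 1) ;; set_reg k (k + 2)
       (round_exp V (scale (V + 3) (EReg (k + 1))) (EReg (k + 2))))) (S' t) (S' 0)"
  proof (rule exec_For)
    fix m assume m: "m < t"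
    let ?e = "round_exp V (scale (V + 3) (EReg (k + 1))) (EReg (k + 2))"
    let ?s' = "(S' (Suc m))(k + 1 := m)"
    have "[m..<t] = m # [Suc m..<t]" using m by (simp add: upt_conv_Cons)
    then have pre: "pre m = round_prefix V (m * (V + 3)) (pre (Suc m))"
      by (simp add: pre_def)
    have "val ?s' (EReg (k + 2)) = goedel (pre (Suc m))" by (simp add: S'_def)
    from val_round_exp[OF this, of V "scale (V + 3) (EReg (k + 1))"]
    have "val ?s' ?e = goedel (pre m)"
      by (simp add: pre val_scale)
    moreover have "exp_regs ?e \<subseteq> {k + 1, k + 2}"
      using exp_regs_round_exp[of V "scale (V + 3) (EReg (k + 1))" "EReg (k + 2)"]
        exp_regs_scale[of "V + 3" "EReg (k + 1)"] by auto
    then have "exp_regs ?e \<subseteq> {..<2 * k + 3}" by (rule subset_trans) auto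
    ultimately show "exec (set_reg k (k + 2) ?e) ?s' (S' m)"
      by (intro exec_set_reg) (use s in \<open>auto simp: S'_def fun_eq_iff\<close>)
  qed (simp add: S'_def)
  let ?e = "block_exp (EConst 0) (V + 1) (EReg (k + 2))"
  have "val (S' 0) (EReg (k + 2)) = goedel (pre 0)" by (simp add: S'_def)
  from val_block_exp[OF this, of "EConst 0" "V + 1"]
  have final: "val (S' 0) ?e = goedel (game_sentence \<phi> V t (init_fo V ms))"
    by (simp add: game_sentence_def game_matrix_def pre_def mat_def core_def)
  have e7: "exec (set_reg k (k + 2) ?e) (S' 0)
      ((S' 0)(k + 2 := goedel (game_sentence \<phi> V t (init_fo V ms))))"
    by (rule exec_set_reg) (use exp_regs_block_exp[of "EConst 0" "V + 1" "EReg (k + 2)"] s final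
        in \<open>auto simp: S'_def\<close>)
  show ?thesis
    unfolding sentence_prog_def
    by (intro exI[of _ "(S' 0)(k + 2 := goedel (game_sentence \<phi> V t (init_fo V ms)))"] conjI
        exec_Seq[OF e1 exec_Seq[OF e2 exec_Seq[OF e3 exec_Seq[OF e4 exec_Seq[OF e5 exec_Seq[OF e6 e7]]]]]])
      simp
qed

theorem sigma_if_definable:
  assumes "bndscl_definable k X"
  shows "sigma_omega_plus_1 k X"
proof -
  obtain \<phi> where X: "X \<subseteq> {xs. length xs = k}"
    and \<phi>: "\<And>ms. length ms = k \<Longrightarrow>
      ms \<in> X \<longleftrightarrow> models_omega (\<lambda>i. if i < k then ms ! i else 0) \<phi>"
    using assms unfolding bndscl_definable_def by blast
  \<comment> \<open>Every argument needs a slot in the stored initial state, hence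
    \<open>k \<le> V\<close>.\<close>
  obtain V where V: "scl_atom_vars \<phi> \<subseteq> {..<V}" "k \<le> V"
  proof -
    obtain n where "\<forall>x\<in>scl_atom_vars \<phi>. x < n"
      using finite_scl_atom_vars[of \<phi>] finite_nat_set_iff_bounded by blast
    then show ?thesis by (intro that[of "max n k"]) fastforce+
  qed
  \<comment> \<open>One additional argument suffices, the number of moves within which Eloise is to
    win.\<close>
  define R where "R = {ms @ [t] | ms t. length ms = k \<and>
    goedel (game_sentence \<phi> V t (init_fo V ms)) \<in> true_arithmetic}"
  have "computable_in true_arithmetic (k + 1) R"
  proof (rule computable_in_if_exec)
    show "R \<subseteq> {xs. length xs = k + 1}" by (auto simp: R_def)
    fix xs :: "nat list" assume "length xs = k + 1"
    then obtain ms t where xs: "xs = ms @ [t]" "length ms = k"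
      by (metis Suc_eq_plus1 length_Suc_conv_rev)
    show "\<exists>s'. exec (sentence_prog \<phi> V k) (\<lambda>j. if j < k + 1 then xs ! j else 0) s' \<and>
        (s' (k + 2) \<in> true_arithmetic \<longleftrightarrow> xs \<in> R)"
      using exec_sentence_prog[OF xs(2), of \<phi> V t] xs by (auto simp: R_def)
  qed
  moreover have "ms \<in> X \<longleftrightarrow> (\<exists>ys. length ys = 1 \<and> ms @ ys \<in> R)" if "length ms = k" for ms
  proof -
    have "ms \<in> X \<longleftrightarrow> (\<exists>t. wins_within \<phi> t ([], \<lambda>i. if i < length ms then ms ! i else 0, Plus))"
      using \<phi>[OF that] that by (simp add: models_omega_iff_wins_within)
    also have "\<dots> \<longleftrightarrow> (\<exists>t. ms @ [t] \<in> R)"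
      using game_sentence_in_true_arithmetic[OF V(1), of ms] V(2) that by (simp add: R_def)
    also have "\<dots> \<longleftrightarrow> (\<exists>ys. length ys = 1 \<and> ms @ ys \<in> R)"
      by (auto simp: length_Suc_conv)
    finally show ?thesis .
  qed
  ultimately show ?thesis using X unfolding sigma_omega_plus_1_def by blast
qed

section \<open>Recursive definitions in BndSCL\<close>

text \<open>
  \<open>Q\<close> and \<open>D\<close> tell for which assignments and signs Eloise wins from a claim and from a labelled
  subformula.
\<close>

primrec eval_scl :: "(assignment \<Rightarrow> sign \<Rightarrow> bool) \<Rightarrow> (assignment \<Rightarrow> sign \<Rightarrow> bool) \<Rightarrow>
    scl \<Rightarrow> assignment \<Rightarrow> sign \<Rightarrow> bool" where
  "eval_scl Q D (Atom \<alpha>) r b = (atom_true r \<alpha> \<longleftrightarrow> b = Plus)"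
| "eval_scl Q D (Neg \<phi>) r b = eval_scl Q D \<phi> r (flip b)"
| "eval_scl Q D (Conj \<phi> \<psi>) r b =
    (if b = Plus then eval_scl Q D \<phi> r b \<and> eval_scl Q D \<psi> r b
     else eval_scl Q D \<phi> r b \<or> eval_scl Q D \<psi> r b)"
| "eval_scl Q D (Disj \<phi> \<psi>) r b =
    (if b = Plus then eval_scl Q D \<phi> r b \<or> eval_scl Q D \<psi> r b
     else eval_scl Q D \<phi> r b \<and> eval_scl Q D \<psi> r b)"
| "eval_scl Q D (Exists x \<phi>) r b =
    (if b = Plus then \<exists>a. eval_scl Q D \<phi> (r(x := a)) b else \<forall>a. eval_scl Q D \<phi> (r(x := a)) b)"
| "eval_scl Q D (Forall x \<phi>) r b =
    (if b = Plus then \<forall>a. eval_scl Q D \<phi> (r(x := a)) b else \<exists>a. eval_scl Q D \<phi> (r(x := a)) b)"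
| "eval_scl Q D (Label L \<phi>) r b = D r b"
| "eval_scl Q D (Claim L) r b = Q r b"

text \<open>The last node of the path is exempt: evaluation stops at labels and thus reaches the
  occurrences with no label strictly above them.\<close>

fun unlabelled_path :: "scl \<Rightarrow> address \<Rightarrow> bool" where
  "unlabelled_path \<phi> [] \<longleftrightarrow> True"
| "unlabelled_path \<phi> (i # q) \<longleftrightarrow>
     (\<forall>L \<chi>. \<phi> \<noteq> Label L \<chi>) \<and> (i < length (children \<phi>) \<longrightarrow> unlabelled_path (children \<phi> ! i) q)"

lemma unlabelled_pathD:
  "unlabelled_path \<phi> (p @ i # q) \<Longrightarrow> subformula_at \<phi> p \<noteq> Some (Label L \<chi>)"
  by (induction p arbitrary: \<phi>) auto

text \<open>The clock changes at claims only. Up to the first claim or label it is constant, and the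
  game is ordinary evaluation.\<close>

lemma Win_eval_scl:
  assumes "subformula_at \<Phi> p = Some \<psi>"
    and "\<And>q L r b. subformula_at \<psi> q = Some (Claim L) \<Longrightarrow> unlabelled_path \<psi> q \<Longrightarrow>
      Win \<Phi> s (Position (p @ q) r b m) \<longleftrightarrow> Q r b"
    and "\<And>q L \<chi> r b. subformula_at \<psi> q = Some (Label L \<chi>) \<Longrightarrow>
      Win \<Phi> s (Position (p @ q) r b m) \<longleftrightarrow> D r b"
  shows "Win \<Phi> s (Position p r b m) \<longleftrightarrow> eval_scl Q D \<psi> r b"
  using assms
proof (induction \<psi> arbitrary: p r b rule: measure_induct_rule[of size])
  case (less \<psi>)
  show ?case
  proof (cases "\<exists>L \<chi>. \<psi> = Label L \<chi>")
    case True
    then show ?thesis using less.prems(3)[of "[]"] by auto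
  next
    case False
    have child: "Win \<Phi> s (Position (p @ [i]) r b m) \<longleftrightarrow> eval_scl Q D (children \<psi> ! i) r b"
      if i: "i < length (children \<psi>)" for i r b
    proof (rule less.IH)
      show "size (children \<psi> ! i) < size \<psi>" using i by (cases \<psi>) (auto simp: less_Suc_eq)
      show "subformula_at \<Phi> (p @ [i]) = Some (children \<psi> ! i)"
        using less.prems(1) i by (simp add: subformula_at_append)
    qed (use less.prems(2,3)[of "i # _"] i False in simp_all)
    show ?thesis
      using less.prems(1) less.prems(2)[of "[]"] False child[of 0] child[of 1]
      by (cases \<psi>) (simp_all add: Win_Position[of \<Phi> s p])
  qed
qed

text \<open>With no label inside, every claim of the body refers to the label put around it.\<close>

primrec loop_body :: "scl \<Rightarrow> bool" where
  "loop_body (Atom \<alpha>) \<longleftrightarrow> True"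
| "loop_body (Neg \<phi>) \<longleftrightarrow> loop_body \<phi>"
| "loop_body (Conj \<phi> \<psi>) \<longleftrightarrow> loop_body \<phi> \<and> loop_body \<psi>"
| "loop_body (Disj \<phi> \<psi>) \<longleftrightarrow> loop_body \<phi> \<and> loop_body \<psi>"
| "loop_body (Exists x \<phi>) \<longleftrightarrow> loop_body \<phi>"
| "loop_body (Forall x \<phi>) \<longleftrightarrow> loop_body \<phi>"
| "loop_body (Label L \<phi>) \<longleftrightarrow> False"
| "loop_body (Claim L) \<longleftrightarrow> L = 0"

lemma loop_body_subformula:
  "loop_body \<phi> \<Longrightarrow> subformula_at \<phi> p = Some \<psi> \<Longrightarrow> loop_body \<psi>"
proof (induction p arbitrary: \<phi>)
  case (Cons i p)
  then show ?case
    by (cases \<phi>) (auto simp: less_Suc_eq split: if_splits)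
qed simp

text \<open>Approximation by recursion depth. At depth 0 a claim counts as lost under both signs, as
  the play ends there without a winner.\<close>

primrec stage :: "scl \<Rightarrow> nat \<Rightarrow> assignment \<Rightarrow> sign \<Rightarrow> bool" where
  "stage B 0 = eval_scl (\<lambda>_ _. False) (\<lambda>_ _. False) B"
| "stage B (Suc m) = eval_scl (stage B m) (\<lambda>_ _. False) B"

text \<open>A claim of the body leads back to \<open>p\<close> with clock \<open>m - 1\<close>, so
  the game from \<open>p\<close> obeys the recursion of the stages.\<close>

lemma Win_Label_stage:
  assumes "subformula_at \<Phi> p = Some (Label 0 B)" "loop_body B"
  shows "Win \<Phi> s (Position p r b m) \<longleftrightarrow> stage B m r b"
proof (induction m arbitrary: r b)
  have sub: "subformula_at \<Phi> (p @ 0 # q) = subformula_at B q" for q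
    using assms(1) by (simp add: subformula_at_append)
  have ref: "is_reference \<Phi> (p @ 0 # q) 0 q' \<longleftrightarrow> q' = p" if "subformula_at B q = Some (Claim 0)" for q q'
  proof -
    have "is_reference \<Phi> (p @ 0 # q) 0 p"
      unfolding is_reference_def
    proof (intro conjI allI impI)
      show "strict_prefix p (p @ 0 # q)" by (simp add: strict_prefix_def)
      show "label_at \<Phi> p 0" using assms(1) by (simp add: label_at_def)
      fix q' assume q': "strict_prefix p q' \<and> strict_prefix q' (p @ 0 # q)"
      then obtain u where u: "q' = p @ u" "u \<noteq> []" by (auto simp: strict_prefix_def prefix_def)
      with q' have "prefix u (0 # q)" by (auto simp: strict_prefix_def)
      then obtain q'' where "q' = p @ 0 # q''" using u by (cases u) auto
      then show "\<not> label_at \<Phi> q' 0"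
        using loop_body_subformula[OF assms(2)] by (fastforce simp: label_at_def sub)
    qed
    then show ?thesis using is_reference_unique by blast
  qed
  have body: "Win \<Phi> s (Position p r b m) \<longleftrightarrow> eval_scl Q (\<lambda>_ _. False) B r b"
    if "\<And>r b. (m > 0 \<and> Win \<Phi> s (Position p r b (m - 1))) \<longleftrightarrow> Q r b" for m Q r b
  proof -
    have "Win \<Phi> s (Position (p @ [0]) r b m) \<longleftrightarrow> eval_scl Q (\<lambda>_ _. False) B r b"
    proof (rule Win_eval_scl)
      show "subformula_at \<Phi> (p @ [0]) = Some B" using sub[of "[]"] by simp
    next
      fix q L r b assume q: "subformula_at B q = Some (Claim L)"
      then have "L = 0" using loop_body_subformula[OF assms(2) q] by simp
      then show "Win \<Phi> s (Position ((p @ [0]) @ q) r b m) \<longleftrightarrow> Q r b"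
        using q that by (subst Win_Position) (simp add: sub ref)
    next
      fix q L \<chi> r b assume q: "subformula_at B q = Some (Label L \<chi>)"
      then show "Win \<Phi> s (Position ((p @ [0]) @ q) r b m) \<longleftrightarrow> False"
        using loop_body_subformula[OF assms(2) q] by simp
    qed
    then show ?thesis using assms(1) by (simp add: Win_Position[of \<Phi> s p])
  qed
  {
    case 0
    then show ?case using body[of 0 "\<lambda>_ _. False"] by simp
  next
    case (Suc m)
    then show ?case using body[of "Suc m" "stage B m"] by simp
  }
qed

primrec claim_free :: "scl \<Rightarrow> bool" where
  "claim_free (Atom \<alpha>) \<longleftrightarrow> True"
| "claim_free (Neg \<phi>) \<longleftrightarrow> claim_free \<phi>"
| "claim_free (Conj \<phi> \<psi>) \<longleftrightarrow> claim_free \<phi> \<and> claim_free \<psi>"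
| "claim_free (Disj \<phi> \<psi>) \<longleftrightarrow> claim_free \<phi> \<and> claim_free \<psi>"
| "claim_free (Exists x \<phi>) \<longleftrightarrow> claim_free \<phi>"
| "claim_free (Forall x \<phi>) \<longleftrightarrow> claim_free \<phi>"
| "claim_free (Label L \<phi>) \<longleftrightarrow> False"
| "claim_free (Claim L) \<longleftrightarrow> False"

lemma claim_free_subformula:
  "claim_free \<phi> \<Longrightarrow> subformula_at \<phi> p = Some \<psi> \<Longrightarrow> claim_free \<psi>"
proof (induction p arbitrary: \<phi>)
  case (Cons i p)
  then show ?case
    by (cases \<phi>) (auto simp: less_Suc_eq split: if_splits)
qed simp

lemma eval_scl_foldr_Exists:
  "eval_scl Q D (foldr Exists [k..<N] \<psi>) r Plus \<longleftrightarrow>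
    (\<exists>f. eval_scl Q D \<psi> (\<lambda>x. if k \<le> x \<and> x < N then f x else r x) Plus)"
proof (induction N arbitrary: \<psi>)
  case 0
  then show ?case by simp
next
  case (Suc N)
  let ?g = "\<lambda>N f x. if k \<le> x \<and> x < N then f x else r x"
  show ?case
  proof (cases "k \<le> N")
    case True
    have 1: "(?g N f)(N := a) = ?g (Suc N) (f(N := a))" for f and a :: nat
      using True by (auto simp: fun_eq_iff)
    have 2: "?g (Suc N) f = (?g N f)(N := f N)" for f
      using True by (auto simp: fun_eq_iff less_Suc_eq)
    have "eval_scl Q D (foldr Exists [k..<Suc N] \<psi>) r Plus \<longleftrightarrow>
        (\<exists>f a. eval_scl Q D \<psi> ((?g N f)(N := a)) Plus)"
      using True Suc.IH[of "Exists N \<psi>"] by simp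
    also have "\<dots> \<longleftrightarrow> (\<exists>f. eval_scl Q D \<psi> (?g (Suc N) f) Plus)"
    proof (intro iffI; elim exE)
      fix f a assume "eval_scl Q D \<psi> ((?g N f)(N := a)) Plus"
      then show "\<exists>f. eval_scl Q D \<psi> (?g (Suc N) f) Plus"
        unfolding 1 by (intro exI[of _ "f(N := a)"])
    next
      fix f assume "eval_scl Q D \<psi> (?g (Suc N) f) Plus"
      then show "\<exists>f a. eval_scl Q D \<psi> ((?g N f)(N := a)) Plus" unfolding 2 by (intro exI)
    qed
    finally show ?thesis .
  next
    case False
    then have "?g (Suc N) f = r" for f by (auto simp: fun_eq_iff)
    then show ?thesis using False by simp
  qed
qed

lemma subformula_at_foldr_Exists:
  "subformula_at (foldr Exists xs \<psi>) (replicate (length xs) 0) = Some \<psi>"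
  by (induction xs) auto

lemma subformula_at_foldr_Exists_Label:
  assumes "claim_free I" "subformula_at (foldr Exists xs (Conj I (Label 0 B))) q = Some \<chi>"
    "\<chi> = Label L \<chi>' \<or> \<chi> = Claim L"
  shows "prefix (replicate (length xs) 0 @ [1]) q"
  using assms(2)
proof (induction xs arbitrary: q)
  case Nil
  then obtain i p where q: "q = i # p" "i < 2" using assms(3) by (cases q) (auto split: if_splits)
  show ?case
  proof (cases "i = 0")
    case True
    then have "claim_free \<chi>" using Nil q claim_free_subformula[OF assms(1)] by simp
    then show ?thesis using assms(3) by auto
  next
    case False
    then show ?thesis using q by (simp add: less_2_cases_iff)
  qed
next
  case (Cons x xs)
  then obtain p where q: "q = 0 # p" using assms(3) by (cases q) (auto split: if_splits)
  then show ?case using Cons by simp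
qed

text \<open>\<open>I\<close> sets the initial values of the variables bound by the prefix. Claims
  occur only behind the label, so the loop is entered with the full clock.\<close>

lemma models_omega_loop:
  assumes "claim_free I" "loop_body B" "\<Phi> = foldr Exists [k..<N] (Conj I (Label 0 B))"
  shows "models_omega s \<Phi> \<longleftrightarrow>
    (\<exists>f. let r = (\<lambda>x. if k \<le> x \<and> x < N then f x else s x) in
      eval_scl (\<lambda>_ _. False) (\<lambda>_ _. False) I r Plus \<and> (\<exists>m. stage B m r Plus))"
proof -
  let ?q = "replicate (N - k) 0 @ [1]"
  have sub: "subformula_at \<Phi> (?q @ u) = subformula_at (Label 0 B) u" for u
    using subformula_at_foldr_Exists[of "[k..<N]" "Conj I (Label 0 B)"] assms(3)
    by (simp add: subformula_at_append del: subformula_at.simps) simp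
  have prefix: "\<exists>u. q = ?q @ u" if "subformula_at \<Phi> q = Some \<chi>" "\<chi> = Label L \<chi>' \<or> \<chi> = Claim L"
    for q \<chi> L \<chi>'
    using subformula_at_foldr_Exists_Label[OF assms(1) that(1)[unfolded assms(3)] that(2)]
    by (auto simp: prefix_def)
  have "Win \<Phi> s (Position [] s Plus m) \<longleftrightarrow>
      eval_scl (\<lambda>_ _. False) (\<lambda>r b. stage B m r b) \<Phi> s Plus" for m
  proof (rule Win_eval_scl)
    fix q L r b assume q: "subformula_at \<Phi> q = Some (Claim L)" "unlabelled_path \<Phi> q"
    obtain u where u: "q = ?q @ u" using prefix[OF q(1)] by blast
    \<comment> \<open>Claims lie inside the body, so their paths pass the label; evaluation of the
      whole formula never meets them.\<close>
    then obtain i v where "u = i # v" using sub[of u] q by (cases u) auto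
    then show "Win \<Phi> s (Position ([] @ q) r b m) \<longleftrightarrow> False"
      using unlabelled_pathD[of \<Phi> ?q i v 0 B] sub[of "[]"] q(2) u by auto
  next
    fix q L \<chi> r b assume q: "subformula_at \<Phi> q = Some (Label L \<chi>)"
    obtain u where u: "q = ?q @ u" using prefix[OF q] by blast
    have "u = []"
    proof (rule ccontr)
      assume "u \<noteq> []"
      then obtain i v where "u = i # v" by (cases u) auto
      then have "subformula_at B v = Some (Label L \<chi>)"
        using q u sub[of u] by (auto split: if_splits)
      then show False using loop_body_subformula[OF assms(2)] by fastforce
    qed
    then show "Win \<Phi> s (Position ([] @ q) r b m) \<longleftrightarrow> stage B m r b"
      using Win_Label_stage[OF _ assms(2)] sub[of "[]"] u by simp
  qed simp
  moreover have I: "eval_scl (\<lambda>_ _. False) D I r b \<longleftrightarrow> eval_scl (\<lambda>_ _. False) (\<lambda>_ _. False) I r b"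
    for D r b
    using assms(1) by (induction I arbitrary: r b) auto
  ultimately have "Win \<Phi> s (Position [] s Plus m) \<longleftrightarrow>
    (\<exists>f. let r = (\<lambda>x. if k \<le> x \<and> x < N then f x else s x) in
      eval_scl (\<lambda>_ _. False) (\<lambda>_ _. False) I r Plus \<and> stage B m r Plus)" for m
    unfolding assms(3) eval_scl_foldr_Exists Let_def
    by (simp add: I[of "stage B m"] del: stage.simps)
  then show ?thesis unfolding models_omega_iff Let_def by blast
qed

section \<open>Consistency of the stages, and formulas acting as program constructs\<close>

abbreviation ev :: "(assignment \<Rightarrow> sign \<Rightarrow> bool) \<Rightarrow> scl \<Rightarrow> assignment \<Rightarrow> sign \<Rightarrow> bool" where
  "ev Q \<equiv> eval_scl Q (\<lambda>_ _. False)"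

lemma flip_eq [simp]: "flip b = Plus \<longleftrightarrow> b \<noteq> Plus" "flip b = Minus \<longleftrightarrow> b \<noteq> Minus"
  by (cases b; simp)+

lemma ev_mono:
  "(\<And>r b. Q r b \<Longrightarrow> Q' r b) \<Longrightarrow> ev Q \<phi> r b \<Longrightarrow> ev Q' \<phi> r b"
  by (induction \<phi> arbitrary: r b) (auto split: if_splits)

lemma stage_mono:
  assumes "stage B m r b" "m \<le> m'"
  shows "stage B m' r b"
proof -
  have step: "stage B m r b \<Longrightarrow> stage B (Suc m) r b" for m r b
  proof (induction m arbitrary: r b)
    case 0
    then have "ev (\<lambda>_ _. False) B r b" by simp
    from ev_mono[OF _ this, of "stage B 0"] show ?case by simp
  next
    case (Suc m)
    from Suc.prems have "ev (stage B m) B r b" by simp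
    from ev_mono[OF Suc.IH this] show ?case by simp
  qed
  from assms(2,1) show ?thesis by (induction rule: dec_induct) (blast intro: step)+
qed

text \<open>The sign \<open>Minus\<close> exchanges the players, so the two signs exclude each other
  as soon as they do so at claims.\<close>

lemma ev_consistent:
  assumes "\<And>r. \<not> (Q r Plus \<and> Q r Minus)"
  shows "\<not> (ev Q \<phi> r Plus \<and> ev Q \<phi> r Minus)"
  using assms by (induction \<phi> arbitrary: r) auto

lemma stage_consistent: "\<not> (stage B m r Plus \<and> stage B m r Minus)"
  by (induction m arbitrary: r) (simp_all add: ev_consistent del: de_Morgan_conj)

text \<open>The guessed value is unique, so the construct acts alike under both signs: under
  \<open>Minus\<close> a wrong value chosen by Abelard is refuted at the equation. The term must not
  contain \<open>x\<close>, and so an update of a variable in terms of itself goes through an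
  auxiliary one.\<close>

definition Assign :: "nat \<Rightarrow> trm \<Rightarrow> scl \<Rightarrow> scl" where
  "Assign x t \<phi> = Exists x (Conj (Atom (Equal (Var x) t)) \<phi>)"

text \<open>Twice the Cantor pairing \<open>(u + v) * (u + v + 1) / 2 + u\<close>, which avoids the
  division.\<close>

definition pair_eq :: "trm \<Rightarrow> trm \<Rightarrow> trm \<Rightarrow> atom" where
  "pair_eq t u v = Equal (Add t t) (Add (Mul (Add u v) (Succ (Add u v))) (Add u u))"

definition Unpair :: "nat \<Rightarrow> nat \<Rightarrow> nat \<Rightarrow> scl \<Rightarrow> scl" where
  "Unpair x y z \<phi> = Exists y (Exists z (Conj (Atom (pair_eq (Var x) (Var y) (Var z))) \<phi>))"

definition MkPair :: "nat \<Rightarrow> nat \<Rightarrow> nat \<Rightarrow> scl \<Rightarrow> scl" where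
  "MkPair x y z \<phi> = Exists z (Conj (Atom (pair_eq (Var z) (Var x) (Var y))) \<phi>)"

definition Pred :: "nat \<Rightarrow> nat \<Rightarrow> scl \<Rightarrow> scl" where
  "Pred x y \<phi> = Exists y (Conj (Atom (Equal (Var x) (Succ (Var y)))) \<phi>)"

definition Ite :: "atom \<Rightarrow> scl \<Rightarrow> scl \<Rightarrow> scl" where
  "Ite \<alpha> \<phi> \<psi> = Disj (Conj (Atom \<alpha>) \<phi>) (Conj (Neg (Atom \<alpha>)) \<psi>)"

definition pfst :: "nat \<Rightarrow> nat" where "pfst n = fst (prod_decode n)"
definition psnd :: "nat \<Rightarrow> nat" where "psnd n = snd (prod_decode n)"

lemma pfst_pair [simp]: "pfst (prod_encode (a, b)) = a"
  and psnd_pair [simp]: "psnd (prod_encode (a, b)) = b"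
  by (simp_all add: pfst_def psnd_def)

lemma pair_pfst_psnd [simp]: "prod_encode (pfst n, psnd n) = n"
  by (simp add: pfst_def psnd_def)

lemma eq_pair_iff: "n = prod_encode (a, b) \<longleftrightarrow> a = pfst n \<and> b = psnd n"
  by auto

lemma atom_true_pair_eq [simp]:
  "atom_true r (pair_eq t u v) \<longleftrightarrow> trm_val r t = prod_encode (trm_val r u, trm_val r v)"
proof -
  have "2 * triangle n = n * Suc n" for n by (induction n) auto
  then have "2 * prod_encode (x, y) = (x + y) * Suc (x + y) + 2 * x" for x y
    by (simp add: prod_encode_def)
  from this[of "trm_val r u" "trm_val r v"] show ?thesis by (auto simp: pair_eq_def)
qed

lemma trm_val_fresh [simp]: "x \<notin> trm_vars t \<Longrightarrow> trm_val (r(x := a)) t = trm_val r t"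
  by (rule trm_val_cong) auto

lemma ev_Assign [simp]:
  "x \<notin> trm_vars t \<Longrightarrow> ev Q (Assign x t \<phi>) r b \<longleftrightarrow> ev Q \<phi> (r(x := trm_val r t)) b"
  by (cases b) (auto simp: Assign_def)

lemma ev_Unpair [simp]:
  assumes "x \<noteq> y" "x \<noteq> z" "y \<noteq> z"
  shows "ev Q (Unpair x y z \<phi>) r b \<longleftrightarrow> ev Q \<phi> (r(y := pfst (r x), z := psnd (r x))) b"
  using assms by (cases b) (auto simp: Unpair_def eq_pair_iff)

lemma ev_MkPair [simp]:
  assumes "x \<noteq> z" "y \<noteq> z"
  shows "ev Q (MkPair x y z \<phi>) r b \<longleftrightarrow> ev Q \<phi> (r(z := prod_encode (r x, r y))) b"
  using assms by (cases b) (auto simp: MkPair_def)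

lemma ev_Pred [simp]:
  assumes "x \<noteq> y"
  shows "ev Q (Pred x y \<phi>) r b \<longleftrightarrow>
    (if r x = 0 then b \<noteq> Plus else ev Q \<phi> (r(y := r x - 1)) b)"
  using assms by (cases b; cases "r x") (auto simp: Pred_def)

lemma ev_Ite [simp]:
  "ev Q (Ite \<alpha> \<phi> \<psi>) r b \<longleftrightarrow> (if atom_true r \<alpha> then ev Q \<phi> r b else ev Q \<psi> r b)"
  by (cases b) (auto simp: Ite_def)

lemma loop_body_combinators [simp]:
  "loop_body (Assign x t \<phi>) \<longleftrightarrow> loop_body \<phi>"
  "loop_body (Unpair x y z \<phi>) \<longleftrightarrow> loop_body \<phi>"
  "loop_body (MkPair x y z \<phi>) \<longleftrightarrow> loop_body \<phi>"
  "loop_body (Pred x y \<phi>) \<longleftrightarrow> loop_body \<phi>"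
  "loop_body (Ite \<alpha> \<phi> \<psi>) \<longleftrightarrow> loop_body \<phi> \<and> loop_body \<psi>"
  by (auto simp: Assign_def Unpair_def MkPair_def Pred_def Ite_def)

subsection \<open>Truth of prenex sentences\<close>

text \<open>\<open>map_of\<close> takes the first match, so rebinding a variable is adding a pair in
  front of the list.\<close>

definition env :: "nat \<Rightarrow> nat \<rightharpoonup> nat" where
  "env e = map_of (map prod_decode (list_decode e))"

definition env_assignment :: "(nat \<rightharpoonup> nat) \<Rightarrow> assignment" where
  "env_assignment m x = (case m x of None \<Rightarrow> 0 | Some v \<Rightarrow> v)"

lemma env_simps [simp]:
  "env 0 = Map.empty"
  "env (Suc (prod_encode (prod_encode (x, a), e))) = (env e)(x \<mapsto> a)"
  by (simp_all add: env_def fun_upd_def fun_eq_iff)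

lemma env_assignment_upd: "env_assignment (m(x \<mapsto> a)) = (env_assignment m)(x := a)"
  by (auto simp: env_assignment_def fun_eq_iff)

text \<open>A relation that is false on numbers coding no term and on terms with unbound variables,
  so that it is meaningful on every input. In the same way, being a sentence is tested by evaluating
  in the empty environment.\<close>

definition trm_value :: "(nat \<rightharpoonup> nat) \<Rightarrow> nat \<Rightarrow> nat \<Rightarrow> bool" where
  "trm_value m c v \<longleftrightarrow>
     (\<exists>t. c = trm_code t \<and> trm_vars t \<subseteq> dom m \<and> v = trm_val (env_assignment m) t)"

definition atom_value :: "(nat \<rightharpoonup> nat) \<Rightarrow> nat \<Rightarrow> nat \<Rightarrow> bool" where
  "atom_value m c v \<longleftrightarrow>
     (\<exists>\<alpha>. c = atom_code \<alpha> \<and> atom_vars \<alpha> \<subseteq> dom m \<and> v = of_bool (atom_true (env_assignment m) \<alpha>))"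

definition qf_value :: "(nat \<rightharpoonup> nat) \<Rightarrow> nat \<Rightarrow> nat \<Rightarrow> bool" where
  "qf_value m c v \<longleftrightarrow>
     (\<exists>\<phi>. c = goedel \<phi> \<and> quantifier_free \<phi> \<and> fo_free \<phi> \<subseteq> dom m \<and>
        v = of_bool (fo_true (env_assignment m) \<phi>))"

definition prenex_true :: "(nat \<rightharpoonup> nat) \<Rightarrow> nat \<Rightarrow> bool" where
  "prenex_true m c \<longleftrightarrow>
     (\<exists>\<phi>. c = goedel \<phi> \<and> prenex \<phi> \<and> fo_free \<phi> \<subseteq> dom m \<and> fo_true (env_assignment m) \<phi>)"

lemma prenex_true_empty: "prenex_true Map.empty c \<longleftrightarrow> c \<in> true_arithmetic"
proof -
  have "fo_true r \<phi> \<longleftrightarrow> fo_true r' \<phi>" if "fo_free \<phi> = {}" for r r' \<phi>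
    using that by (intro fo_true_cong) simp
  then show ?thesis unfolding prenex_true_def true_arithmetic_def by fastforce
qed

text \<open>Valid for arbitrary numbers \<open>c\<close>; the formula for the evaluation of terms
  copies this recursion clause by clause.\<close>

lemma trm_value_unfold:
  "trm_value m c v \<longleftrightarrow>
    (if pfst c = 0 then m (psnd c) = Some v
     else if pfst c = 1 then psnd c = 0 \<and> v = 0
     else if pfst c = 2 then v > 0 \<and> trm_value m (psnd c) (v - 1)
     else if pfst c = 3 then \<exists>v1 v2. v = v1 + v2 \<and> trm_value m (pfst (psnd c)) v1 \<and> trm_value m (psnd (psnd c)) v2
     else if pfst c = 4 then \<exists>v1 v2. v = v1 * v2 \<and> trm_value m (pfst (psnd c)) v1 \<and> trm_value m (psnd (psnd c)) v2
     else False)" (is "_ \<longleftrightarrow> ?R")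
proof
  assume "trm_value m c v"
  then obtain t where "c = trm_code t" "trm_vars t \<subseteq> dom m" "v = trm_val (env_assignment m) t"
    unfolding trm_value_def by blast
  then show ?R by (cases t) (auto simp: trm_value_def env_assignment_def)
next
  assume R: ?R
  have c: "c = prod_encode (pfst c, psnd c)" "psnd c = prod_encode (pfst (psnd c), psnd (psnd c))" by simp_all
  have code: "(\<exists>t. c = trm_code t \<and> P t)" if "trm_code t = c" "P t" for t P using that by blast
  consider "pfst c = 0" | "pfst c = 1" | "pfst c = 2" | "pfst c = 3" | "pfst c = 4"
    using R by (auto split: if_splits)
  then show "trm_value m c v"
  proof cases
    case 1
    then show ?thesis unfolding trm_value_def using R c(1)
      by (intro code[of "Var (psnd c)"]) (auto simp: env_assignment_def)
  next
    case 2
    then show ?thesis unfolding trm_value_def using R c(1)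
      by (intro code[of Zero]) auto
  next
    case 3
    then obtain t where "psnd c = trm_code t" "trm_vars t \<subseteq> dom m" "v = Suc (trm_val (env_assignment m) t)"
      using R by (auto simp: trm_value_def)
    then show ?thesis unfolding trm_value_def using c(1) 3
      by (intro code[of "Succ t"]) auto
  next
    case 4
    then obtain t u where "pfst (psnd c) = trm_code t" "psnd (psnd c) = trm_code u"
      "trm_vars t \<union> trm_vars u \<subseteq> dom m" "v = trm_val (env_assignment m) (Add t u)"
      using R by (auto simp: trm_value_def)
    then show ?thesis unfolding trm_value_def using c 4
      by (intro code[of "Add t u"]) auto
  next
    case 5
    then obtain t u where "pfst (psnd c) = trm_code t" "psnd (psnd c) = trm_code u"
      "trm_vars t \<union> trm_vars u \<subseteq> dom m" "v = trm_val (env_assignment m) (Mul t u)"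
      using R by (auto simp: trm_value_def)
    then show ?thesis unfolding trm_value_def using c 5
      by (intro code[of "Mul t u"]) auto
  qed
qed

lemma atom_value_unfold:
  "atom_value m c v \<longleftrightarrow>
    (if pfst c = 0 then psnd c = 0 \<and> v = 0
     else if pfst c = 1 then \<exists>v1 v2. trm_value m (pfst (psnd c)) v1 \<and> trm_value m (psnd (psnd c)) v2 \<and>
       v = of_bool (v1 = v2)
     else if pfst c = 2 then \<exists>v1 v2. trm_value m (pfst (psnd c)) v1 \<and> trm_value m (psnd (psnd c)) v2 \<and>
       v = of_bool (v1 < v2)
     else False)" (is "_ \<longleftrightarrow> ?R")
proof
  assume "atom_value m c v"
  then obtain \<alpha> where "c = atom_code \<alpha>" "atom_vars \<alpha> \<subseteq> dom m"
    "v = of_bool (atom_true (env_assignment m) \<alpha>)"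
    unfolding atom_value_def by blast
  then show ?R by (cases \<alpha>) (auto simp: trm_value_def)
next
  assume R: ?R
  have c: "c = prod_encode (pfst c, psnd c)" "psnd c = prod_encode (pfst (psnd c), psnd (psnd c))" by simp_all
  have code: "(\<exists>t. c = atom_code t \<and> P t)" if "atom_code t = c" "P t" for t P using that by blast
  consider "pfst c = 0" | "pfst c = 1" | "pfst c = 2"
    using R by (auto split: if_splits)
  then show "atom_value m c v"
  proof cases
    case 1
    then show ?thesis unfolding atom_value_def using R c(1)
      by (intro code[of Falsum]) auto
  next
    case 2
    then obtain t u where "pfst (psnd c) = trm_code t" "psnd (psnd c) = trm_code u"
      "trm_vars t \<union> trm_vars u \<subseteq> dom m" "v = of_bool (atom_true (env_assignment m) (Equal t u))"
      using R by (auto simp: trm_value_def)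
    then show ?thesis unfolding atom_value_def using c 2
      by (intro code[of "Equal t u"]) auto
  next
    case 3
    then obtain t u where "pfst (psnd c) = trm_code t" "psnd (psnd c) = trm_code u"
      "trm_vars t \<union> trm_vars u \<subseteq> dom m" "v = of_bool (atom_true (env_assignment m) (Less t u))"
      using R by (auto simp: trm_value_def)
    then show ?thesis unfolding atom_value_def using c 3
      by (intro code[of "Less t u"]) auto
  qed
qed

lemma qf_value_goedel:
  "quantifier_free \<phi> \<Longrightarrow> fo_free \<phi> \<subseteq> dom m \<Longrightarrow>
    qf_value m (goedel \<phi>) (of_bool (fo_true (env_assignment m) \<phi>))"
  unfolding qf_value_def by blast

text \<open>Connectives as arithmetic on the truth values 0 and 1: \<open>v + v1 = 1\<close> is
  negation, and \<open>v + v1 * v2 = v1 + v2\<close> is disjunction without subtraction.\<close>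

lemma qf_value_unfold:
  "qf_value m c v \<longleftrightarrow>
    (if pfst c = 0 then atom_value m (psnd c) v
     else if pfst c = 1 then \<exists>v1. qf_value m (psnd c) v1 \<and> v + v1 = 1
     else if pfst c = 2 then \<exists>v1 v2. qf_value m (pfst (psnd c)) v1 \<and> qf_value m (psnd (psnd c)) v2 \<and>
       v = v1 * v2
     else if pfst c = 3 then \<exists>v1 v2. qf_value m (pfst (psnd c)) v1 \<and> qf_value m (psnd (psnd c)) v2 \<and>
       v + v1 * v2 = v1 + v2
     else False)" (is "_ \<longleftrightarrow> ?R")
proof
  assume "qf_value m c v"
  then obtain \<phi> where "c = goedel \<phi>" "quantifier_free \<phi>" "fo_free \<phi> \<subseteq> dom m"
    "v = of_bool (fo_true (env_assignment m) \<phi>)"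
    unfolding qf_value_def by blast
  note * = this
  show ?R
  proof (cases \<phi>)
    case (FAtom \<alpha>)
    then show ?thesis using * by (auto simp: atom_value_def)
  next
    case (FNeg \<psi>)
    then show ?thesis using * qf_value_goedel[of \<psi> m]
      by (auto intro!: exI[of _ "of_bool (fo_true (env_assignment m) \<psi>)"])
  next
    case (FConj \<psi> \<chi>)
    then have "qf_value m (pfst (psnd c)) (of_bool (fo_true (env_assignment m) \<psi>))"
      "qf_value m (psnd (psnd c)) (of_bool (fo_true (env_assignment m) \<chi>))"
      using * qf_value_goedel[of \<psi> m] qf_value_goedel[of \<chi> m] by simp_all
    then have "\<exists>v1 v2. qf_value m (pfst (psnd c)) v1 \<and> qf_value m (psnd (psnd c)) v2 \<and> v = v1 * v2"
      using * FConj by (intro exI conjI) auto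
    moreover have "pfst c = 2" using * FConj by simp
    ultimately show ?thesis by simp
  next
    case (FDisj \<psi> \<chi>)
    then have "qf_value m (pfst (psnd c)) (of_bool (fo_true (env_assignment m) \<psi>))"
      "qf_value m (psnd (psnd c)) (of_bool (fo_true (env_assignment m) \<chi>))"
      using * qf_value_goedel[of \<psi> m] qf_value_goedel[of \<chi> m] by simp_all
    then have "\<exists>v1 v2. qf_value m (pfst (psnd c)) v1 \<and> qf_value m (psnd (psnd c)) v2 \<and> v + v1 * v2 = v1 + v2"
      using * FDisj by (intro exI conjI) auto
    moreover have "pfst c = 3" using * FDisj by simp
    ultimately show ?thesis by simp
  qed (use * in auto)
next
  assume R: ?R
  have c: "c = prod_encode (pfst c, psnd c)" "psnd c = prod_encode (pfst (psnd c), psnd (psnd c))" by simp_all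
  have code: "(\<exists>t. c = goedel t \<and> P t)" if "goedel t = c" "P t" for t P using that by blast
  consider "pfst c = 0" | "pfst c = 1" | "pfst c = 2" | "pfst c = 3"
    using R by (auto split: if_splits)
  then show "qf_value m c v"
  proof cases
    case 1
    then obtain \<alpha> where "psnd c = atom_code \<alpha>" "atom_vars \<alpha> \<subseteq> dom m"
      "v = of_bool (atom_true (env_assignment m) \<alpha>)" using R by (auto simp: atom_value_def)
    then show ?thesis unfolding qf_value_def using c(1) 1
      by (intro code[of "FAtom \<alpha>"]) auto
  next
    case 2
    then obtain \<phi> where \<phi>: "psnd c = goedel \<phi>" "quantifier_free \<phi>" "fo_free \<phi> \<subseteq> dom m"
      "v + of_bool (fo_true (env_assignment m) \<phi>) = 1"
      using R by (auto simp: qf_value_def)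
    then have "v = of_bool (fo_true (env_assignment m) (FNeg \<phi>))"
      by (cases "fo_true (env_assignment m) \<phi>") simp_all
    with \<phi>(1-3) show ?thesis unfolding qf_value_def using c 2
      by (intro code[of "FNeg \<phi>"]) auto
  next
    case 3
    then obtain \<phi> \<psi> where "pfst (psnd c) = goedel \<phi>" "psnd (psnd c) = goedel \<psi>"
      "quantifier_free \<phi> \<and> quantifier_free \<psi>" "fo_free \<phi> \<union> fo_free \<psi> \<subseteq> dom m"
      "v = of_bool (fo_true (env_assignment m) (FConj \<phi> \<psi>))"
      using R by (auto simp: qf_value_def)
    then show ?thesis unfolding qf_value_def using c 3
      by (intro code[of "FConj \<phi> \<psi>"]) auto
  next
    case 4
    then obtain \<phi> \<psi> where *: "pfst (psnd c) = goedel \<phi>" "psnd (psnd c) = goedel \<psi>"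
      "quantifier_free \<phi> \<and> quantifier_free \<psi>" "fo_free \<phi> \<union> fo_free \<psi> \<subseteq> dom m"
      "v + of_bool (fo_true (env_assignment m) \<phi>) * of_bool (fo_true (env_assignment m) \<psi>) =
        of_bool (fo_true (env_assignment m) \<phi>) + of_bool (fo_true (env_assignment m) \<psi>)"
      using R by (auto simp: qf_value_def)
    then have "v = of_bool (fo_true (env_assignment m) (FDisj \<phi> \<psi>))"
      by (cases "fo_true (env_assignment m) \<phi>"; cases "fo_true (env_assignment m) \<psi>") simp_all
    with *(1-4) show ?thesis unfolding qf_value_def using c 4
      by (intro code[of "FDisj \<phi> \<psi>"]) auto
  qed
qed

lemma prenex_true_unfold:
  "prenex_true m c \<longleftrightarrow>
    (if pfst c = 4 then \<exists>a. prenex_true (m(pfst (psnd c) \<mapsto> a)) (psnd (psnd c))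
     else if pfst c = 5 then \<forall>a. prenex_true (m(pfst (psnd c) \<mapsto> a)) (psnd (psnd c))
     else qf_value m c 1)" (is "_ \<longleftrightarrow> ?R")
proof
  assume "prenex_true m c"
  then obtain \<phi> where \<phi>: "c = goedel \<phi>" "prenex \<phi>" "fo_free \<phi> \<subseteq> dom m" "fo_true (env_assignment m) \<phi>"
    unfolding prenex_true_def by blast
  from \<phi>(2) show ?R
  proof cases
    case 1
    then have "qf_value m c 1" using \<phi> qf_value_goedel[of \<phi> m] by simp
    moreover have "pfst c \<noteq> 4 \<and> pfst c \<noteq> 5" using 1 \<phi>(1) by (cases \<phi>) auto
    ultimately show ?thesis by simp
  next
    case (2 \<psi> x)
    then show ?thesis using \<phi> by (auto simp: prenex_true_def env_assignment_upd)
  next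
    case (3 \<psi> x)
    then show ?thesis using \<phi> by (auto simp: prenex_true_def env_assignment_upd)
  qed
next
  assume R: ?R
  have c: "c = prod_encode (pfst c, psnd c)" "psnd c = prod_encode (pfst (psnd c), psnd (psnd c))" by simp_all
  have code: "(\<exists>t. c = goedel t \<and> P t)" if "goedel t = c" "P t" for t P using that by blast
  consider "pfst c = 4" | "pfst c = 5" | "pfst c \<noteq> 4" "pfst c \<noteq> 5" by blast
  then show "prenex_true m c"
  proof cases
    case 1
    then obtain a \<phi> where "psnd (psnd c) = goedel \<phi>" "prenex \<phi>" "fo_free \<phi> - {pfst (psnd c)} \<subseteq> dom m"
      "fo_true ((env_assignment m)(pfst (psnd c) := a)) \<phi>"
      using R by (auto simp: prenex_true_def env_assignment_upd)
    then show ?thesis unfolding prenex_true_def using c 1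
      by (intro code[of "FExists (pfst (psnd c)) \<phi>"]) (auto intro: prenex.intros)
  next
    case 2
    then have *: "\<exists>\<phi>. psnd (psnd c) = goedel \<phi> \<and> prenex \<phi> \<and> fo_free \<phi> - {pfst (psnd c)} \<subseteq> dom m \<and>
      fo_true ((env_assignment m)(pfst (psnd c) := a)) \<phi>" for a
      using R by (fastforce simp: prenex_true_def env_assignment_upd)
    \<comment> \<open>A priori the formula depends on \<open>a\<close>; its code does not, and
      injectivity of the numbering makes it a single formula.\<close>
    from *[of 0] obtain \<phi> where \<phi>: "psnd (psnd c) = goedel \<phi>" "prenex \<phi>"
      "fo_free \<phi> - {pfst (psnd c)} \<subseteq> dom m" by blast
    have "fo_true ((env_assignment m)(pfst (psnd c) := a)) \<phi>" for a
      using *[of a] \<phi>(1) by (auto simp: goedel_inject)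
    then show ?thesis unfolding prenex_true_def using c 2 \<phi>
      by (intro code[of "FForall (pfst (psnd c)) \<phi>"]) (auto intro: prenex.intros)
  next
    case 3
    then obtain \<phi> where \<phi>: "c = goedel \<phi>" "quantifier_free \<phi>" "fo_free \<phi> \<subseteq> dom m"
      "1 = (of_bool (fo_true (env_assignment m) \<phi>) :: nat)"
      using R by (auto simp: qf_value_def)
    then have "fo_true (env_assignment m) \<phi>" by (metis of_bool_eq(1) zero_neq_one)
    then show ?thesis unfolding prenex_true_def using \<phi> by (auto intro: prenex.intros)
  qed
qed

lemma env_unfold:
  "env e x = Some v \<longleftrightarrow> e \<noteq> 0 \<and>
    (if pfst (pfst (e - 1)) = x then v = psnd (pfst (e - 1)) else env (psnd (e - 1)) x = Some v)"
proof (cases e)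
  case (Suc n)
  have "n = prod_encode (prod_encode (pfst (pfst n), psnd (pfst n)), psnd n)" by simp
  then have "env (Suc n) = (env (psnd n))(pfst (pfst n) \<mapsto> psnd (pfst n))"
    by (metis env_simps(2))
  then show ?thesis using Suc by auto
qed simp

section \<open>The recursive formula evaluating prenex sentences\<close>

datatype reg = RIn nat | RMode | RC | RE | RV | RT nat | RState | RPos | RNeg
  | RLeft nat | RRight nat | RSym nat | RRest nat | RLSym nat | RLRest nat

instance reg :: countable
  by countable_datatype

text \<open>Registers are variables from \<open>k\<close> on, distinct by countability of
  \<open>reg\<close>, so the parameters \<open>0, ..., k - 1\<close> stay untouched.\<close>

definition vr :: "nat \<Rightarrow> reg \<Rightarrow> nat" where
  "vr k X = k + to_nat X"

lemma vr_inject [simp]: "vr k X = vr k Y \<longleftrightarrow> X = Y"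
  by (simp add: vr_def)

primrec switch :: "nat \<Rightarrow> nat \<Rightarrow> scl list \<Rightarrow> scl \<Rightarrow> scl" where
  "switch x i [] d = d"
| "switch x i (\<phi> # \<phi>s) d = Ite (Equal (Var x) (num i)) \<phi> (switch x (Suc i) \<phi>s d)"

text \<open>
  The subformulas below are the bodies of mutually recursive procedures with the arguments \<open>RC\<close> (a
  code), \<open>RE\<close> (a list of variable bindings) and \<open>RV\<close> (a value); \<open>RMode\<close> selects the procedure.
\<close>

definition call :: "nat \<Rightarrow> nat \<Rightarrow> nat \<Rightarrow> nat \<Rightarrow> scl" where
  "call k md i j = Assign (vr k RC) (Var (vr k (RT i))) (Assign (vr k RV) (Var (vr k (RT j)))
     (Assign (vr k RMode) (num md) (Claim 0)))"

text \<open>The values of both components are guessed and each guess is verified by a call;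
  \<open>\<phi>\<close> compares them with the value in \<open>RV\<close>.\<close>

definition call2 :: "nat \<Rightarrow> nat \<Rightarrow> scl \<Rightarrow> scl" where
  "call2 k md \<phi> = Unpair (vr k (RT 1)) (vr k (RT 2)) (vr k (RT 3))
     (Exists (vr k (RT 4)) (Exists (vr k (RT 5))
       (Conj (call k md 2 4) (Conj (call k md 3 5) \<phi>))))"

definition lookup_scl :: "nat \<Rightarrow> scl" where
  "lookup_scl k = Pred (vr k RE) (vr k (RT 0)) (Unpair (vr k (RT 0)) (vr k (RT 1)) (vr k (RT 2))
     (Unpair (vr k (RT 1)) (vr k (RT 3)) (vr k (RT 4))
       (Ite (Equal (Var (vr k (RT 3))) (Var (vr k RC)))
         (Atom (Equal (Var (vr k RV)) (Var (vr k (RT 4)))))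
         (Assign (vr k RE) (Var (vr k (RT 2))) (Claim 0)))))"

definition trm_scl :: "nat \<Rightarrow> scl" where
  "trm_scl k = Unpair (vr k RC) (vr k (RT 0)) (vr k (RT 1)) (switch (vr k (RT 0)) 0
     [Assign (vr k (RT 2)) (Var (vr k RV)) (call k 5 1 2),
      Conj (Atom (Equal (Var (vr k (RT 1))) Zero)) (Atom (Equal (Var (vr k RV)) Zero)),
      Pred (vr k RV) (vr k (RT 2)) (call k 4 1 2),
      call2 k 4 (Atom (Equal (Var (vr k RV)) (Add (Var (vr k (RT 4))) (Var (vr k (RT 5)))))),
      call2 k 4 (Atom (Equal (Var (vr k RV)) (Mul (Var (vr k (RT 4))) (Var (vr k (RT 5))))))]
     (Atom Falsum))"

definition truth_test :: "nat \<Rightarrow> atom \<Rightarrow> scl" where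
  "truth_test k \<alpha> = Ite \<alpha> (Atom (Equal (Var (vr k RV)) (num 1))) (Atom (Equal (Var (vr k RV)) Zero))"

definition atom_scl :: "nat \<Rightarrow> scl" where
  "atom_scl k = Unpair (vr k RC) (vr k (RT 0)) (vr k (RT 1)) (switch (vr k (RT 0)) 0
     [Conj (Atom (Equal (Var (vr k (RT 1))) Zero)) (Atom (Equal (Var (vr k RV)) Zero)),
      call2 k 4 (truth_test k (Equal (Var (vr k (RT 4))) (Var (vr k (RT 5))))),
      call2 k 4 (truth_test k (Less (Var (vr k (RT 4))) (Var (vr k (RT 5)))))]
     (Atom Falsum))"

definition qf_scl :: "nat \<Rightarrow> scl" where
  "qf_scl k = Unpair (vr k RC) (vr k (RT 0)) (vr k (RT 1)) (switch (vr k (RT 0)) 0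
     [Assign (vr k (RT 2)) (Var (vr k RV)) (call k 3 1 2),
      Exists (vr k (RT 4)) (Conj (call k 2 1 4)
        (Atom (Equal (Add (Var (vr k RV)) (Var (vr k (RT 4)))) (num 1)))),
      call2 k 2 (Atom (Equal (Var (vr k RV)) (Mul (Var (vr k (RT 4))) (Var (vr k (RT 5)))))),
      call2 k 2 (Atom (Equal (Add (Var (vr k RV)) (Mul (Var (vr k (RT 4))) (Var (vr k (RT 5)))))
        (Add (Var (vr k (RT 4))) (Var (vr k (RT 5))))))]
     (Atom Falsum))"

definition extend_call :: "nat \<Rightarrow> scl" where
  "extend_call k = MkPair (vr k (RT 2)) (vr k (RT 4)) (vr k (RT 5))
     (MkPair (vr k (RT 5)) (vr k RE) (vr k (RT 6))
       (Assign (vr k RE) (Succ (Var (vr k (RT 6)))) (Assign (vr k RC) (Var (vr k (RT 3))) (Claim 0))))"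

text \<open>Tags 4 and 5 are the quantifiers. Everything else, numbers coding nothing included, is
  passed on to the quantifier-free evaluation with the value 1.\<close>

definition prenex_scl :: "nat \<Rightarrow> scl" where
  "prenex_scl k = Unpair (vr k RC) (vr k (RT 0)) (vr k (RT 1))
     (Unpair (vr k (RT 1)) (vr k (RT 2)) (vr k (RT 3))
     (switch (vr k (RT 0)) 4
       [Exists (vr k (RT 4)) (extend_call k), Forall (vr k (RT 4)) (extend_call k)]
       (Assign (vr k RV) (num 1) (Assign (vr k RMode) (num 2) (Claim 0)))))"

text \<open>The place in the list is the mode: 0 runs \<open>\<phi>\<close>, later the machine; 1 to
  5 evaluate prenex formulas, quantifier-free formulas, atoms, terms and variables. Larger modes go
  to \<open>\<psi>\<close>, later the loading of the input.\<close>

definition truth_body :: "nat \<Rightarrow> scl \<Rightarrow> scl \<Rightarrow> scl" where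
  "truth_body k \<phi> \<psi> = switch (vr k RMode) 0
     [\<phi>, prenex_scl k, qf_scl k, atom_scl k, trm_scl k, lookup_scl k] \<psi>"

lemmas truth_defs = call_def call2_def lookup_scl_def trm_scl_def truth_test_def
  atom_scl_def qf_scl_def extend_call_def prenex_scl_def

lemma loop_body_truth_body: "loop_body (truth_body k \<phi> \<psi>) \<longleftrightarrow> loop_body \<phi> \<and> loop_body \<psi>"
  by (simp add: truth_body_def truth_defs)

section \<open>Correctness of the evaluation and the depth of its calls\<close>

definition spec :: "nat \<Rightarrow> assignment \<Rightarrow> bool" where
  "spec k r \<longleftrightarrow>
    (if r (vr k RMode) = 1 then prenex_true (env (r (vr k RE))) (r (vr k RC))
     else if r (vr k RMode) = 2 then qf_value (env (r (vr k RE))) (r (vr k RC)) (r (vr k RV))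
     else if r (vr k RMode) = 3 then atom_value (env (r (vr k RE))) (r (vr k RC)) (r (vr k RV))
     else if r (vr k RMode) = 4 then trm_value (env (r (vr k RE))) (r (vr k RC)) (r (vr k RV))
     else env (r (vr k RE)) (r (vr k RC)) = Some (r (vr k RV)))"

text \<open>Opening a quantifier shortens the code but lengthens the environment by one, so in mode
  1 the code counts twice. The constants pay for passages to a later mode that need not shorten the
  code. Only the length of the environment enters, which makes the bound uniform in the values
  chosen at quantifiers.\<close>

definition rank :: "nat \<Rightarrow> assignment \<Rightarrow> nat" where
  "rank k r =
    (if r (vr k RMode) = 1 then 2 * r (vr k RC) + length (list_decode (r (vr k RE))) + 4
     else if r (vr k RMode) = 2 then r (vr k RC) + length (list_decode (r (vr k RE))) + 3
     else if r (vr k RMode) = 3 then r (vr k RC) + length (list_decode (r (vr k RE))) + 2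
     else if r (vr k RMode) = 4 then r (vr k RC) + length (list_decode (r (vr k RE))) + 1
     else length (list_decode (r (vr k RE))))"

text \<open>A triangular number is at least its index, so \<open>prod_encode (a, b)\<close> is at
  least \<open>2 * a + b\<close>.\<close>

lemma psnd_less: "pfst c > 0 \<Longrightarrow> psnd c < c"
proof -
  assume "pfst c > 0"
  moreover have "n \<le> triangle n" for n by (induction n) auto
  then have "pfst c + (pfst c + psnd c) \<le> prod_encode (pfst c, psnd c)"
    by (simp add: prod_encode_def)
  ultimately show ?thesis by simp
qed

lemma pfst_le: "pfst c \<le> c" and psnd_le: "psnd c \<le> c"
  using le_prod_encode_1[of "pfst c" "psnd c"] le_prod_encode_2[of "psnd c" "pfst c"] by simp_all

lemma rank_args:
  assumes "pfst c > 0"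
  shows "pfst (psnd c) < c" "psnd (psnd c) < c" "psnd c < c"
  using psnd_less[OF assms] pfst_le[of "psnd c"] psnd_le[of "psnd c"] by simp_all

lemma length_list_decode_Suc:
  "length (list_decode (Suc n)) = Suc (length (list_decode (psnd n)))"
  by (simp add: psnd_def split: prod.split)

lemma spec_cong:
  "(\<And>X. X \<in> {RMode, RC, RE, RV} \<Longrightarrow> r (vr k X) = r' (vr k X)) \<Longrightarrow> spec k r \<longleftrightarrow> spec k r'"
  by (simp add: spec_def)

lemma rank_cong:
  "(\<And>X. X \<in> {RMode, RC, RE} \<Longrightarrow> r (vr k X) = r' (vr k X)) \<Longrightarrow> rank k r = rank k r'"
  by (simp add: rank_def)

text \<open>One unfolding of the recursion: \<open>Q\<close>, later a stage, is assumed correct on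
  arguments of smaller rank. The sign is a parameter, so verification under \<open>Plus\<close> and
  refutation under \<open>Minus\<close> are shown together.\<close>

context
  fixes k :: nat and Q :: "assignment \<Rightarrow> sign \<Rightarrow> bool" and r :: assignment
  assumes Q: "\<And>r' b. r' (vr k RMode) \<in> {1..5} \<Longrightarrow> rank k r' < rank k r \<Longrightarrow>
    (spec k r' \<longleftrightarrow> b = Plus) \<Longrightarrow> Q r' b"
begin

lemma ev_lookup:
  assumes "r (vr k RMode) = 5" "spec k r \<longleftrightarrow> b = Plus"
  shows "ev Q (lookup_scl k) r b"
proof (cases "r (vr k RE)")
  case 0
  then show ?thesis using assms by (simp add: lookup_scl_def spec_def)
next
  case (Suc n)
  show ?thesis
  proof (cases "pfst (pfst n) = r (vr k RC)")
    case True
    then show ?thesis using assms Suc env_unfold[of "Suc n" "r (vr k RC)" "r (vr k RV)"]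
      by (auto simp: lookup_scl_def spec_def)
  next
    case False
    then show ?thesis using assms Suc env_unfold[of "Suc n" "r (vr k RC)" "r (vr k RV)"]
      by (auto simp: lookup_scl_def intro!: Q)
        (auto simp: spec_def rank_def length_list_decode_Suc simp del: list_decode.simps)
  qed
qed

lemma ev_call:
  assumes "md \<in> {1..5}" "r' (vr k RE) = r (vr k RE)"
    and "rank k (r(vr k RC := r' (vr k (RT i)), vr k RMode := md)) < rank k r"
    and "spec k (r(vr k RC := r' (vr k (RT i)), vr k RV := r' (vr k (RT j)), vr k RMode := md))
      \<longleftrightarrow> b = Plus"
  shows "ev Q (call k md i j) r' b"
proof -
  have "ev Q (call k md i j) r' b \<longleftrightarrow>
      Q (r'(vr k RC := r' (vr k (RT i)), vr k RV := r' (vr k (RT j)), vr k RMode := md)) b"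
    by (simp add: call_def)
  also have \<dots>
  proof (rule Q)
    let ?r' = "r'(vr k RC := r' (vr k (RT i)), vr k RV := r' (vr k (RT j)), vr k RMode := md)"
    have "rank k ?r' = rank k (r(vr k RC := r' (vr k (RT i)), vr k RMode := md))"
      by (rule rank_cong) (use assms(2) in auto)
    then show "rank k ?r' < rank k r" using assms(3) by simp
    have "spec k ?r' = spec k (r(vr k RC := r' (vr k (RT i)), vr k RV := r' (vr k (RT j)), vr k RMode := md))"
      by (rule spec_cong) (use assms(2) in auto)
    then show "spec k ?r' \<longleftrightarrow> b = Plus" using assms(4) by simp
  qed (use assms(1) in simp)
  finally show ?thesis .
qed

text \<open>Under \<open>Plus\<close> Eloise guesses the right values; under \<open>Minus\<close>
  each guess of Abelard violates one of the three conjuncts, and she moves there.\<close>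

lemma ev_call2:
  assumes "md \<in> {1..5}" "r' (vr k RE) = r (vr k RE)" "c = r' (vr k (RT 1))"
    and "rank k (r(vr k RC := pfst c, vr k RMode := md)) < rank k r"
    and "rank k (r(vr k RC := psnd c, vr k RMode := md)) < rank k r"
    and "\<And>v1 v2 b. ev Q \<phi> (r'(vr k (RT 2) := pfst c, vr k (RT 3) := psnd c,
        vr k (RT 4) := v1, vr k (RT 5) := v2)) b \<longleftrightarrow> (P v1 v2 \<longleftrightarrow> b = Plus)"
    and "(\<exists>v1 v2. spec k (r(vr k RC := pfst c, vr k RV := v1, vr k RMode := md)) \<and>
      spec k (r(vr k RC := psnd c, vr k RV := v2, vr k RMode := md)) \<and> P v1 v2) \<longleftrightarrow> b = Plus"
  shows "ev Q (call2 k md \<phi>) r' b"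
proof -
  let ?r = "\<lambda>v1 v2. r'(vr k (RT 2) := pfst c, vr k (RT 3) := psnd c, vr k (RT 4) := v1, vr k (RT 5) := v2)"
  have 1: "ev Q (call k md 2 4) (?r v1 v2) b"
    if "spec k (r(vr k RC := pfst c, vr k RV := v1, vr k RMode := md)) \<longleftrightarrow> b = Plus" for v1 v2 b
    using assms that by (intro ev_call) simp_all
  have 2: "ev Q (call k md 3 5) (?r v1 v2) b"
    if "spec k (r(vr k RC := psnd c, vr k RV := v2, vr k RMode := md)) \<longleftrightarrow> b = Plus" for v1 v2 b
    using assms that by (intro ev_call) simp_all
  show ?thesis
  proof (cases b)
    case Plus
    then obtain v1 v2 where "spec k (r(vr k RC := pfst c, vr k RV := v1, vr k RMode := md))"
      "spec k (r(vr k RC := psnd c, vr k RV := v2, vr k RMode := md))" "P v1 v2"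
      using assms(7) by blast
    then have "ev Q (call k md 2 4) (?r v1 v2) Plus \<and> ev Q (call k md 3 5) (?r v1 v2) Plus \<and>
      ev Q \<phi> (?r v1 v2) Plus" using 1 2 assms(6) by simp
    then show ?thesis unfolding call2_def using Plus assms(3)
      by (simp, rule_tac x = v1 in exI, rule_tac x = v2 in exI, simp)
  next
    case Minus
    have "ev Q (call k md 2 4) (?r v1 v2) Minus \<or> ev Q (call k md 3 5) (?r v1 v2) Minus \<or>
      ev Q \<phi> (?r v1 v2) Minus" for v1 v2
    proof -
      have "\<not> spec k (r(vr k RC := pfst c, vr k RV := v1, vr k RMode := md)) \<or>
        \<not> spec k (r(vr k RC := psnd c, vr k RV := v2, vr k RMode := md)) \<or> \<not> P v1 v2"
        using assms(7) Minus by (simp only: sign.distinct) blast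
      then show ?thesis
      proof (elim disjE)
        assume "\<not> P v1 v2"
        then have "ev Q \<phi> (?r v1 v2) Minus" unfolding assms(6) by simp
        then show ?thesis by simp
      qed (use 1[where b = Minus] 2[where b = Minus] in simp_all)
    qed
    then show ?thesis unfolding call2_def using Minus assms(3) by simp
  qed
qed

lemma ev_trm:
  assumes "r (vr k RMode) = 4" "spec k r \<longleftrightarrow> b = Plus"
  shows "ev Q (trm_scl k) r b"
proof -
  let ?c = "r (vr k RC)" and ?m = "env (r (vr k RE))" and ?v = "r (vr k RV)"
  let ?r = "r(vr k (RT 0) := pfst ?c, vr k (RT 1) := psnd ?c)"
  have spec: "trm_value ?m ?c ?v \<longleftrightarrow> b = Plus" using assms by (simp add: spec_def)
  note unf = spec[unfolded trm_value_unfold[of ?m ?c]]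
  consider "pfst ?c = 0" | "pfst ?c = 1" | "pfst ?c = 2" | "pfst ?c = 3" | "pfst ?c = 4" | "pfst ?c > 4"
    by linarith
  then show ?thesis
  proof cases
    case 1
    then have "ev Q (call k 5 1 2) (?r(vr k (RT 2) := ?v)) b"
      using unf assms(1) by (intro ev_call) (simp_all add: rank_def spec_def)
    then show ?thesis using 1 by (simp add: trm_scl_def)
  next
    case 2
    then show ?thesis using unf by (cases b) (simp_all add: trm_scl_def)
  next
    case 3
    then have "ev Q (call k 4 1 2) (?r(vr k (RT 2) := ?v - 1)) b" if "?v > 0"
      using unf assms(1) that rank_args[of ?c] by (intro ev_call) (simp_all add: rank_def spec_def)
    then show ?thesis using 3 unf by (cases b) (auto simp: trm_scl_def)
  next
    case 4
    then have "ev Q (call2 k 4 (Atom (Equal (Var (vr k RV)) (Add (Var (vr k (RT 4))) (Var (vr k (RT 5))))))) ?r b"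
      using unf assms(1) rank_args[of ?c]
      by (intro ev_call2[where P = "\<lambda>v1 v2. ?v = v1 + v2"]) (simp_all add: rank_def spec_def conj_ac)
    then show ?thesis using 4 by (simp add: trm_scl_def)
  next
    case 5
    then have "ev Q (call2 k 4 (Atom (Equal (Var (vr k RV)) (Mul (Var (vr k (RT 4))) (Var (vr k (RT 5))))))) ?r b"
      using unf assms(1) rank_args[of ?c]
      by (intro ev_call2[where P = "\<lambda>v1 v2. ?v = v1 * v2"]) (simp_all add: rank_def spec_def conj_ac)
    then show ?thesis using 5 by (simp add: trm_scl_def)
  next
    case 6
    then show ?thesis using unf by (simp add: trm_scl_def)
  qed
qed

lemma ev_truth_test:
  "ev Q (truth_test k \<alpha>) r' b \<longleftrightarrow> (r' (vr k RV) = of_bool (atom_true r' \<alpha>) \<longleftrightarrow> b = Plus)"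
  by (simp add: truth_test_def)

lemma ev_atom:
  assumes "r (vr k RMode) = 3" "spec k r \<longleftrightarrow> b = Plus"
  shows "ev Q (atom_scl k) r b"
proof -
  let ?c = "r (vr k RC)" and ?m = "env (r (vr k RE))" and ?v = "r (vr k RV)"
  let ?r = "r(vr k (RT 0) := pfst ?c, vr k (RT 1) := psnd ?c)"
  have spec: "atom_value ?m ?c ?v \<longleftrightarrow> b = Plus" using assms by (simp add: spec_def)
  note unf = spec[unfolded atom_value_unfold[of ?m ?c]]
  consider "pfst ?c = 0" | "pfst ?c = 1" | "pfst ?c = 2" | "pfst ?c > 2"
    by linarith
  then show ?thesis
  proof cases
    case 1
    then show ?thesis using unf by (cases b) (simp_all add: atom_scl_def)
  next
    case 2
    then have "ev Q (call2 k 4 (truth_test k (Equal (Var (vr k (RT 4))) (Var (vr k (RT 5)))))) ?r b"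
      using unf assms(1) rank_args[of ?c]
      by (intro ev_call2[where P = "\<lambda>v1 v2. ?v = of_bool (v1 = v2)"])
        (simp_all add: rank_def spec_def ev_truth_test)
    then show ?thesis using 2 by (simp add: atom_scl_def)
  next
    case 3
    then have "ev Q (call2 k 4 (truth_test k (Less (Var (vr k (RT 4))) (Var (vr k (RT 5)))))) ?r b"
      using unf assms(1) rank_args[of ?c]
      by (intro ev_call2[where P = "\<lambda>v1 v2. ?v = of_bool (v1 < v2)"])
        (simp_all add: rank_def spec_def ev_truth_test)
    then show ?thesis using 3 by (simp add: atom_scl_def)
  next
    case 4
    then show ?thesis using unf by (simp add: atom_scl_def)
  qed
qed

lemma ev_qf:
  assumes "r (vr k RMode) = 2" "spec k r \<longleftrightarrow> b = Plus"
  shows "ev Q (qf_scl k) r b"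
proof -
  let ?c = "r (vr k RC)" and ?m = "env (r (vr k RE))" and ?v = "r (vr k RV)"
  let ?r = "r(vr k (RT 0) := pfst ?c, vr k (RT 1) := psnd ?c)"
  have spec: "qf_value ?m ?c ?v \<longleftrightarrow> b = Plus" using assms by (simp add: spec_def)
  note unf = spec[unfolded qf_value_unfold[of ?m ?c]]
  consider "pfst ?c = 0" | "pfst ?c = 1" | "pfst ?c = 2" | "pfst ?c = 3" | "pfst ?c > 3"
    by linarith
  then show ?thesis
  proof cases
    case 1
    then have "ev Q (call k 3 1 2) (?r(vr k (RT 2) := ?v)) b"
      using unf assms(1) psnd_le[of ?c] by (intro ev_call) (simp_all add: rank_def spec_def)
    then show ?thesis using 1 by (simp add: qf_scl_def)
  next
    case 2
    have *: "ev Q (call k 2 1 4) (?r(vr k (RT 4) := v)) b'" if "qf_value ?m (psnd ?c) v \<longleftrightarrow> b' = Plus" for v b'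
      using 2 unf assms(1) that rank_args[of ?c] by (intro ev_call) (simp_all add: rank_def spec_def)
    show ?thesis
    proof (cases b)
      case Plus
      then obtain v where "qf_value ?m (psnd ?c) v" "?v + v = 1" using unf 2 by auto
      then show ?thesis using 2 Plus *[of v Plus] by (auto simp: qf_scl_def)
    next
      case Minus
      then have "\<not> qf_value ?m (psnd ?c) v \<or> ?v + v \<noteq> 1" for v using unf 2 by auto
      then show ?thesis using 2 Minus *[of _ Minus] by (auto simp: qf_scl_def)
    qed
  next
    case 3
    then have "ev Q (call2 k 2 (Atom (Equal (Var (vr k RV)) (Mul (Var (vr k (RT 4))) (Var (vr k (RT 5))))))) ?r b"
      using unf assms(1) rank_args[of ?c]
      by (intro ev_call2[where P = "\<lambda>v1 v2. ?v = v1 * v2"]) (simp_all add: rank_def spec_def)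
    then show ?thesis using 3 by (simp add: qf_scl_def)
  next
    case 4
    then have "ev Q (call2 k 2 (Atom (Equal (Add (Var (vr k RV)) (Mul (Var (vr k (RT 4))) (Var (vr k (RT 5)))))
        (Add (Var (vr k (RT 4))) (Var (vr k (RT 5))))))) ?r b"
      using unf assms(1) rank_args[of ?c]
      by (intro ev_call2[where P = "\<lambda>v1 v2. ?v + v1 * v2 = v1 + v2"]) (simp_all add: rank_def spec_def)
    then show ?thesis using 4 by (simp add: qf_scl_def)
  next
    case 5
    then show ?thesis using unf by (simp add: qf_scl_def)
  qed
qed

lemma ev_prenex:
  assumes "r (vr k RMode) = 1" "spec k r \<longleftrightarrow> b = Plus"
  shows "ev Q (prenex_scl k) r b"
proof -
  let ?c = "r (vr k RC)" and ?m = "env (r (vr k RE))"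
  let ?r = "r(vr k (RT 0) := pfst ?c, vr k (RT 1) := psnd ?c,
    vr k (RT 2) := pfst (psnd ?c), vr k (RT 3) := psnd (psnd ?c))"
  have spec: "prenex_true ?m ?c \<longleftrightarrow> b = Plus" using assms by (simp add: spec_def)
  note unf = spec[unfolded prenex_true_unfold[of ?m ?c]]
  have ext: "ev Q (extend_call k) (?r(vr k (RT 4) := a)) b'"
    if "pfst ?c > 0" "prenex_true (?m(pfst (psnd ?c) \<mapsto> a)) (psnd (psnd ?c)) \<longleftrightarrow> b' = Plus" for a b'
  proof -
    let ?e = "Suc (prod_encode (prod_encode (pfst (psnd ?c), a), r (vr k RE)))"
    have "ev Q (extend_call k) (?r(vr k (RT 4) := a)) b' \<longleftrightarrow>
      Q (?r(vr k (RT 4) := a, vr k (RT 5) := prod_encode (pfst (psnd ?c), a),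
        vr k (RT 6) := prod_encode (prod_encode (pfst (psnd ?c), a), r (vr k RE)),
        vr k RE := ?e, vr k RC := psnd (psnd ?c))) b'"
      by (simp add: extend_call_def)
    also have \<dots>
      using assms(1) that(2) rank_args[OF that(1)]
      by (intro Q) (simp_all add: spec_def rank_def length_list_decode_Suc del: list_decode.simps)
    finally show ?thesis .
  qed
  consider "pfst ?c = 4" | "pfst ?c = 5" | "pfst ?c \<noteq> 4" "pfst ?c \<noteq> 5" by blast
  then show ?thesis
  proof cases
    case 1
    then show ?thesis using unf ext by (cases b) (auto simp: prenex_scl_def)
  next
    case 2
    then show ?thesis using unf ext by (cases b) (auto simp: prenex_scl_def)
  next
    case 3
    then have "Q (?r(vr k RV := 1, vr k RMode := 2)) b"
      using unf assms(1) by (intro Q) (simp_all add: spec_def rank_def)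
    then show ?thesis using 3 by (simp add: prenex_scl_def)
  qed
qed

lemma ev_truth_body:
  assumes "r (vr k RMode) \<in> {1..5}" "spec k r \<longleftrightarrow> b = Plus"
  shows "ev Q (truth_body k \<phi> \<psi>) r b"
proof -
  consider "r (vr k RMode) = 1" | "r (vr k RMode) = 2" | "r (vr k RMode) = 3" | "r (vr k RMode) = 4"
    | "r (vr k RMode) = 5" using assms(1) by fastforce
  then show ?thesis
    by cases (use assms(2) ev_prenex ev_qf ev_atom ev_trm ev_lookup in \<open>simp_all add: truth_body_def\<close>)
qed

end

lemma stage_truth_body:
  assumes "r (vr k RMode) \<in> {1..5}" "spec k r \<longleftrightarrow> b = Plus" "rank k r \<le> m"
  shows "stage (truth_body k \<phi> \<psi>) m r b"
  using assms
proof (induction m arbitrary: r b)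
  case 0
  then show ?case unfolding stage.simps by (intro ev_truth_body) simp_all
next
  case (Suc m)
  show ?case unfolding stage.simps
    by (rule ev_truth_body[OF Suc.IH]) (use Suc.prems in simp_all)
qed

text \<open>At a clock above the rank the right sign wins. By monotonicity a wrong sign winning at
  some smaller clock would win there too, against consistency.\<close>

lemma stage_truth_body_iff:
  assumes "r (vr k RMode) \<in> {1..5}" "stage (truth_body k \<phi> \<psi>) m r b"
  shows "spec k r \<longleftrightarrow> b = Plus"
proof (rule ccontr)
  assume "\<not> (spec k r \<longleftrightarrow> b = Plus)"
  then have "spec k r \<longleftrightarrow> flip b = Plus" by auto
  then have "stage (truth_body k \<phi> \<psi>) (max m (rank k r)) r (flip b)"
    using assms(1) by (intro stage_truth_body) auto
  moreover have "stage (truth_body k \<phi> \<psi>) (max m (rank k r)) r b"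
    by (rule stage_mono[OF assms(2)]) simp
  ultimately show False using stage_consistent by (cases b) auto
qed

subsection \<open>Simulation of oracle machines\<close>

text \<open>
  A number stands for the infinite sequence of its iterated first components; as \<open>prod_decode 0\<close> is
  \<open>(0, 0)\<close>, 0 stands for the blank half tape.
\<close>

primrec cell :: "nat \<Rightarrow> nat \<Rightarrow> nat" where
  "cell n 0 = pfst n"
| "cell n (Suc i) = cell (psnd n) i"

lemma pfst_0 [simp]: "pfst 0 = 0" and psnd_0 [simp]: "psnd 0 = 0"
  using pfst_le[of 0] psnd_le[of 0] by simp_all

lemma cell_0 [simp]: "cell 0 i = 0"
  by (induction i) auto

text \<open>\<open>R\<close> begins with the scanned cell, \<open>L\<close> with its left neighbour
  and runs leftwards.\<close>

definition represents :: "nat \<Rightarrow> nat \<Rightarrow> (int \<Rightarrow> nat) \<Rightarrow> int \<Rightarrow> bool" where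
  "represents L R f h \<longleftrightarrow> (\<forall>i. f (h + int i) = cell R i) \<and> (\<forall>i. f (h - 1 - int i) = cell L i)"

lemma represents_scan: "represents L R f h \<Longrightarrow> f h = pfst R"
  unfolding represents_def by (metis add.right_neutral cell.simps(1) of_nat_0)

lemma represents_stay:
  assumes "represents L R f h"
  shows "represents L (prod_encode (w, psnd R)) (f(h := w)) h"
proof -
  have "(f(h := w)) (h + int i) = cell (prod_encode (w, psnd R)) i" for i
    using assms by (cases i) (auto simp: represents_def dest: spec[of _ i])
  then show ?thesis using assms by (auto simp: represents_def)
qed

lemma represents_right:
  assumes "represents L R f h"
  shows "represents (prod_encode (w, L)) (psnd R) (f(h := w)) (h + 1)"
proof -
  have R: "f (h + int i) = cell R i" and L: "f (h - 1 - int i) = cell L i" for i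
    using assms by (auto simp: represents_def)
  have "(f(h := w)) (h + 1 + int i) = cell (psnd R) i" for i
    using R[of "Suc i"] by (simp add: add.assoc)
  moreover have "(f(h := w)) (h + 1 - 1 - int i) = cell (prod_encode (w, L)) i" for i
  proof (cases i)
    case (Suc j)
    then have "h + 1 - 1 - int i = h - 1 - int j" by simp
    then show ?thesis using L[of j] Suc by (simp only: fun_upd_apply) simp
  qed simp
  ultimately show ?thesis by (simp add: represents_def)
qed

lemma represents_left:
  assumes "represents L R f h"
  shows "represents (psnd L) (prod_encode (pfst L, prod_encode (w, psnd R))) (f(h := w)) (h - 1)"
proof -
  have R: "f (h + int i) = cell R i" and L: "f (h - 1 - int i) = cell L i" for i
    using assms by (auto simp: represents_def)
  have "(f(h := w)) (h - 1 + int i) = cell (prod_encode (pfst L, prod_encode (w, psnd R))) i" for i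
  proof (cases i)
    case 0
    then show ?thesis using L[of 0] by simp
  next
    case (Suc j)
    then have "h - 1 + int i = h + int j" by simp
    then show ?thesis using R[of j] Suc by (cases j) (simp_all add: algebra_simps)
  qed
  moreover have "(f(h := w)) (h - 1 - 1 - int i) = cell (psnd L) i" for i
  proof -
    have "(f(h := w)) (h - 1 - 1 - int i) = f (h - 1 - int (Suc i))" by (simp add: algebra_simps)
    then show ?thesis using L[of "Suc i"] by (simp only: cell.simps)
  qed
  ultimately show ?thesis by (simp add: represents_def)
qed

primrec push :: "nat list \<Rightarrow> nat \<Rightarrow> nat" where
  "push [] R = R"
| "push (w # ws) R = prod_encode (w, push ws R)"

lemma cell_push: "cell (push ws 0) i = (if i < length ws then ws ! i else 0)"
proof (induction ws arbitrary: i)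
  case (Cons w ws)
  then show ?case by (cases i) auto
qed simp

section \<open>Formulas for the steps of a machine\<close>

definition scl_Conj :: "scl list \<Rightarrow> scl" where
  "scl_Conj \<phi>s = foldr Conj \<phi>s (Atom (Equal Zero Zero))"

definition scl_Disj :: "scl list \<Rightarrow> scl" where
  "scl_Disj \<phi>s = foldr Disj \<phi>s (Atom Falsum)"

lemma ev_scl_Conj [simp]: "ev Q (scl_Conj \<phi>s) r Plus \<longleftrightarrow> (\<forall>\<phi>\<in>set \<phi>s. ev Q \<phi> r Plus)"
  unfolding scl_Conj_def by (induction \<phi>s) auto

lemma ev_scl_Disj [simp]: "ev Q (scl_Disj \<phi>s) r Plus \<longleftrightarrow> (\<exists>\<phi>\<in>set \<phi>s. ev Q \<phi> r Plus)"
  unfolding scl_Disj_def by (induction \<phi>s) auto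

lemma loop_body_scl_Conj [simp]: "loop_body (scl_Conj \<phi>s) \<longleftrightarrow> (\<forall>\<phi>\<in>set \<phi>s. loop_body \<phi>)"
  and loop_body_scl_Disj [simp]: "loop_body (scl_Disj \<phi>s) \<longleftrightarrow> (\<forall>\<phi>\<in>set \<phi>s. loop_body \<phi>)"
  and claim_free_scl_Conj [simp]: "claim_free (scl_Conj \<phi>s) \<longleftrightarrow> (\<forall>\<phi>\<in>set \<phi>s. claim_free \<phi>)"
  unfolding scl_Conj_def scl_Disj_def by (induction \<phi>s) auto

text \<open>The half tapes are split before a transition is guessed. The left one is split as well
  because a left move brings its first cell under the head.\<close>

primrec unpack :: "nat \<Rightarrow> nat \<Rightarrow> scl \<Rightarrow> scl" where
  "unpack k 0 \<phi> = \<phi>"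
| "unpack k (Suc t) \<phi> = unpack k t
     (Unpair (vr k (RRight t)) (vr k (RSym t)) (vr k (RRest t))
     (Unpair (vr k (RLeft t)) (vr k (RLSym t)) (vr k (RLRest t)) \<phi>))"

primrec unpacked :: "nat \<Rightarrow> assignment \<Rightarrow> nat \<Rightarrow> assignment" where
  "unpacked k r 0 = r"
| "unpacked k r (Suc t) = (unpacked k r t)
     (vr k (RSym t) := pfst (unpacked k r t (vr k (RRight t))),
      vr k (RRest t) := psnd (unpacked k r t (vr k (RRight t))),
      vr k (RLSym t) := pfst (unpacked k r t (vr k (RLeft t))),
      vr k (RLRest t) := psnd (unpacked k r t (vr k (RLeft t))))"

lemma ev_unpack: "ev Q (unpack k n \<phi>) r b \<longleftrightarrow> ev Q \<phi> (unpacked k r n) b"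
  by (induction n arbitrary: \<phi>) simp_all

lemma loop_body_unpack [simp]: "loop_body (unpack k n \<phi>) \<longleftrightarrow> loop_body \<phi>"
  by (induction n arbitrary: \<phi>) simp_all

lemma unpacked_other:
  "(\<And>t. X \<noteq> RSym t \<and> X \<noteq> RRest t \<and> X \<noteq> RLSym t \<and> X \<noteq> RLRest t) \<Longrightarrow>
    unpacked k r n (vr k X) = r (vr k X)"
  by (induction n) simp_all

lemma unpacked_tape:
  assumes "t < n"
  shows "unpacked k r n (vr k (RSym t)) = pfst (r (vr k (RRight t)))"
    and "unpacked k r n (vr k (RRest t)) = psnd (r (vr k (RRight t)))"
    and "unpacked k r n (vr k (RLSym t)) = pfst (r (vr k (RLeft t)))"
    and "unpacked k r n (vr k (RLRest t)) = psnd (r (vr k (RLeft t)))"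
  using assms by (induction n) (auto simp: less_Suc_eq unpacked_other)

text \<open>\<open>MkPair\<close> may not overwrite its own components, so for \<open>MRight\<close>
  the new left half is built in \<open>RT 1\<close> and then copied.\<close>

definition write_tape :: "nat \<Rightarrow> nat \<Rightarrow> nat \<Rightarrow> move \<Rightarrow> scl \<Rightarrow> scl" where
  "write_tape k t w d \<phi> = Assign (vr k (RT 0)) (num w) (case d of
      MStay \<Rightarrow> MkPair (vr k (RT 0)) (vr k (RRest t)) (vr k (RRight t)) \<phi>
    | MRight \<Rightarrow> MkPair (vr k (RT 0)) (vr k (RLeft t)) (vr k (RT 1))
        (Assign (vr k (RLeft t)) (Var (vr k (RT 1)))
        (Assign (vr k (RRight t)) (Var (vr k (RRest t))) \<phi>))
    | MLeft \<Rightarrow> MkPair (vr k (RT 0)) (vr k (RRest t)) (vr k (RT 1))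
        (MkPair (vr k (RLSym t)) (vr k (RT 1)) (vr k (RRight t))
        (Assign (vr k (RLeft t)) (Var (vr k (RLRest t))) \<phi>)))"

definition written_tape :: "nat \<Rightarrow> nat \<Rightarrow> nat \<Rightarrow> move \<Rightarrow> assignment \<Rightarrow> assignment" where
  "written_tape k t w d r = (case d of
      MStay \<Rightarrow> r(vr k (RT 0) := w, vr k (RRight t) := prod_encode (w, r (vr k (RRest t))))
    | MRight \<Rightarrow> r(vr k (RT 0) := w, vr k (RT 1) := prod_encode (w, r (vr k (RLeft t))),
        vr k (RLeft t) := prod_encode (w, r (vr k (RLeft t))),
        vr k (RRight t) := r (vr k (RRest t)))
    | MLeft \<Rightarrow> r(vr k (RT 0) := w, vr k (RT 1) := prod_encode (w, r (vr k (RRest t))),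
        vr k (RRight t) := prod_encode (r (vr k (RLSym t)), prod_encode (w, r (vr k (RRest t)))),
        vr k (RLeft t) := r (vr k (RLRest t))))"

lemma ev_write_tape: "ev Q (write_tape k t w d \<phi>) r b \<longleftrightarrow> ev Q \<phi> (written_tape k t w d r) b"
  by (cases d) (simp_all add: write_tape_def written_tape_def)

lemma loop_body_write_tape [simp]: "loop_body (write_tape k t w d \<phi>) \<longleftrightarrow> loop_body \<phi>"
  by (cases d) (simp_all add: write_tape_def)

primrec write_tapes :: "nat \<Rightarrow> nat \<Rightarrow> nat list \<Rightarrow> move list \<Rightarrow> scl \<Rightarrow> scl" where
  "write_tapes k 0 w d \<phi> = \<phi>"
| "write_tapes k (Suc t) w d \<phi> = write_tapes k t w d (write_tape k t (w ! t) (d ! t) \<phi>)"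

primrec written :: "nat \<Rightarrow> nat list \<Rightarrow> move list \<Rightarrow> assignment \<Rightarrow> nat \<Rightarrow> assignment" where
  "written k w d r 0 = r"
| "written k w d r (Suc t) = written_tape k t (w ! t) (d ! t) (written k w d r t)"

lemma ev_write_tapes: "ev Q (write_tapes k n w d \<phi>) r b \<longleftrightarrow> ev Q \<phi> (written k w d r n) b"
  by (induction n arbitrary: \<phi>) (simp_all add: ev_write_tape)

lemma loop_body_write_tapes [simp]: "loop_body (write_tapes k n w d \<phi>) \<longleftrightarrow> loop_body \<phi>"
  by (induction n arbitrary: \<phi>) simp_all

lemma written_other:
  "(\<And>i. X \<noteq> RT i) \<Longrightarrow> (\<And>t. t < n \<Longrightarrow> X \<noteq> RLeft t \<and> X \<noteq> RRight t) \<Longrightarrow>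
    written k w d r n (vr k X) = r (vr k X)"
  by (induction n) (simp_all add: written_tape_def split: move.split)

lemma written_represents:
  assumes "t < n" "represents (r (vr k (RLeft t))) (r (vr k (RRight t))) f h"
    "r (vr k (RRest t)) = psnd (r (vr k (RRight t)))"
    "r (vr k (RLSym t)) = pfst (r (vr k (RLeft t)))"
    "r (vr k (RLRest t)) = psnd (r (vr k (RLeft t)))"
  shows "represents (written k w d r n (vr k (RLeft t))) (written k w d r n (vr k (RRight t)))
    (f(h := w ! t)) (h + offset (d ! t))"
  using assms(1)
proof (induction n)
  case (Suc n)
  show ?case
  proof (cases "t = n")
    case True
    have "written k w d r n (vr k X) = r (vr k X)"
      if "X \<in> {RLeft n, RRight n, RRest n, RLSym n, RLRest n}" for X
      using that by (intro written_other) auto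
    then have eqs: "written k w d r n (vr k (RLeft n)) = r (vr k (RLeft n))"
      "written k w d r n (vr k (RRight n)) = r (vr k (RRight n))"
      "written k w d r n (vr k (RRest n)) = r (vr k (RRest n))"
      "written k w d r n (vr k (RLSym n)) = r (vr k (RLSym n))"
      "written k w d r n (vr k (RLRest n)) = r (vr k (RLRest n))" by simp_all
    show ?thesis
      using True assms(3-5) represents_stay[OF assms(2), of "w ! t"]
        represents_left[OF assms(2), of "w ! t"] represents_right[OF assms(2), of "w ! t"]
      by (cases "d ! t") (simp_all add: written_tape_def eqs fun_upd_def)
  next
    case False
    then show ?thesis using Suc by (simp add: written_tape_def split: move.split)
  qed
qed simp

text \<open>The oracle head may stand left of the origin. Variables hold natural numbers, so its
  position is kept as the difference of \<open>RPos\<close> and \<open>RNeg\<close>.\<close>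

definition move_oracle :: "nat \<Rightarrow> move \<Rightarrow> scl \<Rightarrow> scl" where
  "move_oracle k e \<phi> = (case e of MStay \<Rightarrow> \<phi>
    | MRight \<Rightarrow> Assign (vr k (RT 0)) (Succ (Var (vr k RPos))) (Assign (vr k RPos) (Var (vr k (RT 0))) \<phi>)
    | MLeft \<Rightarrow> Assign (vr k (RT 0)) (Succ (Var (vr k RNeg))) (Assign (vr k RNeg) (Var (vr k (RT 0))) \<phi>))"

definition moved_oracle :: "nat \<Rightarrow> move \<Rightarrow> assignment \<Rightarrow> assignment" where
  "moved_oracle k e r = (case e of MStay \<Rightarrow> r
    | MRight \<Rightarrow> r(vr k (RT 0) := Suc (r (vr k RPos)), vr k RPos := Suc (r (vr k RPos)))
    | MLeft \<Rightarrow> r(vr k (RT 0) := Suc (r (vr k RNeg)), vr k RNeg := Suc (r (vr k RNeg))))"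

lemma ev_move_oracle: "ev Q (move_oracle k e \<phi>) r b \<longleftrightarrow> ev Q \<phi> (moved_oracle k e r) b"
  by (cases e) (simp_all add: move_oracle_def moved_oracle_def)

lemma loop_body_move_oracle [simp]: "loop_body (move_oracle k e \<phi>) \<longleftrightarrow> loop_body \<phi>"
  by (cases e) (simp_all add: move_oracle_def)

text \<open>A blank means a negative position. Otherwise \<open>RT 0\<close> is the position, and
  the answer is verified by calling mode 1 in the empty environment; a negative answer is a call
  under the opposite sign.\<close>

primrec oracle_scl :: "nat \<Rightarrow> bool option \<Rightarrow> scl" where
  "oracle_scl k None = Atom (Less (Var (vr k RPos)) (Var (vr k RNeg)))"
| "oracle_scl k (Some a) = Exists (vr k (RT 0))
     (Conj (Atom (Equal (Var (vr k RPos)) (Add (Var (vr k RNeg)) (Var (vr k (RT 0))))))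
     (Assign (vr k RC) (Var (vr k (RT 0))) (Assign (vr k RE) Zero (Assign (vr k RMode) (num 1)
       (if a then Claim 0 else Neg (Claim 0))))))"

definition oracle_query :: "nat \<Rightarrow> assignment \<Rightarrow> assignment" where
  "oracle_query k r = r(vr k (RT 0) := r (vr k RPos) - r (vr k RNeg),
     vr k RC := r (vr k RPos) - r (vr k RNeg), vr k RE := 0, vr k RMode := 1)"

lemma ev_oracle_scl:
  "ev Q (oracle_scl k (Some a)) r Plus \<longleftrightarrow>
    r (vr k RNeg) \<le> r (vr k RPos) \<and> Q (oracle_query k r) (if a then Plus else Minus)"
proof -
  have "ev Q (oracle_scl k (Some a)) r Plus \<longleftrightarrow> (\<exists>i. r (vr k RPos) = r (vr k RNeg) + i \<and>
      Q (r(vr k (RT 0) := i, vr k RC := i, vr k RE := 0, vr k RMode := 1)) (if a then Plus else Minus))"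
    by simp
  also have "\<dots> \<longleftrightarrow> r (vr k RNeg) \<le> r (vr k RPos) \<and> Q (oracle_query k r) (if a then Plus else Minus)"
    unfolding oracle_query_def by (auto simp: le_iff_add)
  finally show ?thesis .
qed

text \<open>Eloise proposes a transition, and Abelard attacks one of its conditions or lets the run
  continue. The registers set for the oracle query are changed in their own conjunct and do not
  reach the continuation.\<close>

definition branch_scl :: "nat \<Rightarrow> otm \<Rightarrow> nat \<times> nat list \<times> bool option \<Rightarrow> scl" where
  "branch_scl k M = (\<lambda>(q, v, o'). case delta M q v o' of (q', w, d, e) \<Rightarrow>
     scl_Conj [Atom (Equal (Var (vr k RState)) (num q)),
       scl_Conj (map (\<lambda>t. Atom (Equal (Var (vr k (RSym t))) (num (v ! t)))) [0..<ntapes M]),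
       oracle_scl k o',
       write_tapes k (ntapes M) w d (Assign (vr k RState) (num q') (move_oracle k e (Claim 0)))])"

definition branches :: "otm \<Rightarrow> (nat \<times> nat list \<times> bool option) list" where
  "branches M = List.product (filter (\<lambda>q. q \<noteq> accept M \<and> q \<noteq> reject M) [0..<nstates M])
     (List.product (List.n_lists (ntapes M) [0..<nsymbols M]) [None, Some True, Some False])"

definition run_scl :: "nat \<Rightarrow> otm \<Rightarrow> scl" where
  "run_scl k M = Ite (Equal (Var (vr k RState)) (num (accept M))) (Atom (Equal Zero Zero))
     (unpack k (ntapes M) (scl_Disj (map (branch_scl k M) (branches M))))"

lemma loop_body_run_scl: "loop_body (run_scl k M)"
proof -
  have "loop_body (oracle_scl k o')" for o' by (cases o') simp_all
  then show ?thesis by (auto simp: run_scl_def branch_scl_def split: prod.split)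
qed

text \<open>The bounds on the state and the symbols ensure that the transition to be taken is listed
  in \<open>branches\<close>.\<close>

definition abstracts :: "nat \<Rightarrow> otm \<Rightarrow> assignment \<Rightarrow> config \<Rightarrow> bool" where
  "abstracts k M r c \<longleftrightarrow> r (vr k RMode) = 0 \<and> r (vr k RState) = state c \<and>
     int (r (vr k RPos)) - int (r (vr k RNeg)) = ohead c \<and> state c < nstates M \<and>
     (\<forall>t<ntapes M. represents (r (vr k (RLeft t))) (r (vr k (RRight t))) (tape c t) (head c t)) \<and>
     (\<forall>t<ntapes M. \<forall>i. tape c t i < nsymbols M)"

definition branch_result :: "nat \<Rightarrow> otm \<Rightarrow> assignment \<Rightarrow> nat \<times> nat list \<times> bool option \<Rightarrow> assignment" where
  "branch_result k M r = (\<lambda>(q, v, o'). case delta M q v o' of (q', w, d, e) \<Rightarrow>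
     moved_oracle k e ((written k w d r (ntapes M))(vr k RState := q')))"

lemma ev_branch_scl:
  "ev Q (branch_scl k M (q, v, o')) r Plus \<longleftrightarrow> r (vr k RState) = q \<and>
     (\<forall>t<ntapes M. r (vr k (RSym t)) = v ! t) \<and> ev Q (oracle_scl k o') r Plus \<and>
     Q (branch_result k M r (q, v, o')) Plus"
  by (auto simp: branch_scl_def branch_result_def ev_write_tapes ev_move_oracle split: prod.split)

text \<open>State and scanned symbols are determined by the registers; the freedom left to Eloise is
  the claimed oracle symbol.\<close>

lemma ev_run_scl:
  assumes M: "wf_otm M" and r: "abstracts k M r c"
  shows "ev Q (run_scl k M) r Plus \<longleftrightarrow> state c = accept M \<or>
    (state c \<noteq> reject M \<and> (\<exists>o'. ev Q (oracle_scl k o') (unpacked k r (ntapes M)) Plus \<and>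
       Q (branch_result k M (unpacked k r (ntapes M))
         (state c, map (\<lambda>t. tape c t (head c t)) [0..<ntapes M], o')) Plus))"
proof -
  let ?r = "unpacked k r (ntapes M)" and ?v = "map (\<lambda>t. tape c t (head c t)) [0..<ntapes M]"
  have st: "r (vr k RState) = state c" "?r (vr k RState) = state c" "state c < nstates M"
    using r by (simp_all add: abstracts_def unpacked_other)
  have sym: "?r (vr k (RSym t)) = ?v ! t" if "t < ntapes M" for t
  proof -
    have "tape c t (head c t) = pfst (r (vr k (RRight t)))"
      using r that by (intro represents_scan) (auto simp: abstracts_def)
    then show ?thesis using that by (simp add: unpacked_tape)
  qed
  have v: "?v \<in> set (List.n_lists (ntapes M) [0..<nsymbols M])"
    using r by (auto simp: set_n_lists abstracts_def)
  have o': "x \<in> set [None, Some True, Some False]" for x :: "bool option"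
    by (cases x) auto
  have "ev Q (scl_Disj (map (branch_scl k M) (branches M))) ?r Plus \<longleftrightarrow>
    (\<exists>q v o'. (q, v, o') \<in> set (branches M) \<and> ev Q (branch_scl k M (q, v, o')) ?r Plus)"
    by auto
  also have "\<dots> \<longleftrightarrow> state c \<noteq> accept M \<and> state c \<noteq> reject M \<and>
    (\<exists>o'. ev Q (oracle_scl k o') ?r Plus \<and> Q (branch_result k M ?r (state c, ?v, o')) Plus)"
    (is "?A \<longleftrightarrow> ?B")
  proof
    assume ?A
    then obtain q v o' where b: "(q, v, o') \<in> set (branches M)" "ev Q (branch_scl k M (q, v, o')) ?r Plus"
      by blast
    from b(2) have q: "q = state c" "\<forall>t<ntapes M. ?r (vr k (RSym t)) = v ! t"
      "ev Q (oracle_scl k o') ?r Plus" "Q (branch_result k M ?r (q, v, o')) Plus"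
      using st unfolding ev_branch_scl by auto
    have "length v = ntapes M" using b(1) by (auto simp: branches_def set_n_lists)
    then have "v = ?v" using q(2) sym by (intro nth_equalityI) auto
    then show ?B using b(1) q by (auto simp: branches_def)
  next
    assume ?B
    then obtain o' where B: "state c \<noteq> accept M" "state c \<noteq> reject M" "ev Q (oracle_scl k o') ?r Plus"
      "Q (branch_result k M ?r (state c, ?v, o')) Plus" by blast
    have "(state c, ?v, o') \<in> set (branches M)"
      unfolding branches_def set_product mem_Times_iff fst_conv snd_conv
      using B(1,2) st(3) v o'[of o'] by simp
    moreover have "ev Q (branch_scl k M (state c, ?v, o')) ?r Plus"
      unfolding ev_branch_scl using B st sym by auto
    ultimately show ?A by blast
  qed
  finally show ?thesis using st by (auto simp: run_scl_def ev_unpack)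
qed

lemma abstracts_step:
  assumes M: "wf_otm M" and r: "abstracts k M r c" and c: "state c \<noteq> accept M" "state c \<noteq> reject M"
  shows "abstracts k M (branch_result k M (unpacked k r (ntapes M))
    (state c, map (\<lambda>t. tape c t (head c t)) [0..<ntapes M], oracle_cell A (ohead c))) (step M A c)"
proof -
  let ?r = "unpacked k r (ntapes M)" and ?v = "map (\<lambda>t. tape c t (head c t)) [0..<ntapes M]"
  obtain q' w d e where \<delta>: "delta M (state c) ?v (oracle_cell A (ohead c)) = (q', w, d, e)"
    by (metis prod_cases4)
  have "set ?v \<subseteq> {..<nsymbols M}" "state c < nstates M" "length ?v = ntapes M"
    using r by (auto simp: abstracts_def)
  moreover have "\<forall>q v c. q < nstates M \<and> length v = ntapes M \<and> set v \<subseteq> {..<nsymbols M} \<longrightarrow>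
      (case delta M q v c of (q', w, d, e) \<Rightarrow>
        q' < nstates M \<and> length w = ntapes M \<and> set w \<subseteq> {..<nsymbols M} \<and> length d = ntapes M)"
    using M unfolding wf_otm_def by (elim conjE)
  ultimately have "case delta M (state c) ?v (oracle_cell A (ohead c)) of (q', w, d, e) \<Rightarrow>
      q' < nstates M \<and> length w = ntapes M \<and> set w \<subseteq> {..<nsymbols M} \<and> length d = ntapes M"
    by (elim allE impE) (intro conjI)
  then have wf: "q' < nstates M" "length w = ntapes M" "set w \<subseteq> {..<nsymbols M}"
    unfolding \<delta> by simp_all
  let ?r1 = "written k w d ?r (ntapes M)"
  let ?r2 = "moved_oracle k e (?r1(vr k RState := q'))"
  have other: "?r1 (vr k X) = r (vr k X)" if "X \<in> {RMode, RPos, RNeg}" for X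
    using that by (auto simp: written_other unpacked_other)
  have tapes: "?r2 (vr k X) = ?r1 (vr k X)" if "X = RLeft t \<or> X = RRight t" for X t
    using that by (auto simp: moved_oracle_def split: move.split)
  have "represents (?r1 (vr k (RLeft t))) (?r1 (vr k (RRight t))) ((tape c t)(head c t := w ! t))
      (head c t + offset (d ! t))" if "t < ntapes M" for t
    using r that by (intro written_represents) (auto simp: abstracts_def unpacked_other unpacked_tape)
  moreover have "((tape c t)(head c t := w ! t)) i < nsymbols M" if "t < ntapes M" for t i
    using r that wf(2,3) nth_mem[of t w] by (auto simp: abstracts_def simp del: nth_mem)
  moreover have "int (?r2 (vr k RPos)) - int (?r2 (vr k RNeg)) = ohead c + offset e"
    using r other by (cases e) (auto simp: abstracts_def moved_oracle_def)
  moreover have "?r2 (vr k RMode) = 0" "?r2 (vr k RState) = q'"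
    using r other by (cases e; simp add: abstracts_def moved_oracle_def)+
  ultimately have "abstracts k M ?r2 \<lparr>state = q',
      tape = (\<lambda>t. if t < ntapes M then (tape c t)(head c t := w ! t) else tape c t),
      head = (\<lambda>t. if t < ntapes M then head c t + offset (d ! t) else head c t),
      ohead = ohead c + offset e\<rparr>"
    using wf(1) unfolding abstracts_def by (simp add: tapes)
  then show ?thesis using c \<delta> by (simp add: branch_result_def step_def)
qed

text \<open>Since \<open>Q\<close> is sound in mode 1 under both signs, a false claim about the
  oracle cannot be defended.\<close>

lemma ev_oracle_cell:
  assumes r: "abstracts k M r c"
    and Q: "\<And>r' b. r' (vr k RMode) = 1 \<Longrightarrow> Q r' b \<Longrightarrow> spec k r' \<longleftrightarrow> b = Plus"
    and ev: "ev Q (oracle_scl k o') (unpacked k r (ntapes M)) Plus"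
  shows "o' = oracle_cell true_arithmetic (ohead c)"
proof -
  let ?r = "unpacked k r (ntapes M)"
  have pos: "?r (vr k RPos) = r (vr k RPos)" "?r (vr k RNeg) = r (vr k RNeg)"
    by (simp_all add: unpacked_other)
  have oh: "ohead c = int (r (vr k RPos)) - int (r (vr k RNeg))" using r by (simp add: abstracts_def)
  show ?thesis
  proof (cases o')
    case None
    then show ?thesis using ev pos oh by (simp add: oracle_cell_def)
  next
    case (Some a)
    let ?q = "oracle_query k ?r"
    have 1: "r (vr k RNeg) \<le> r (vr k RPos)" "Q ?q (if a then Plus else Minus)"
      using ev[unfolded Some ev_oracle_scl] pos by auto
    have "spec k ?q \<longleftrightarrow> a"
      using Q[OF _ 1(2)] by (cases a) (simp_all add: oracle_query_def)
    moreover have "spec k ?q \<longleftrightarrow> r (vr k RPos) - r (vr k RNeg) \<in> true_arithmetic"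
      by (simp add: spec_def oracle_query_def prenex_true_empty pos)
    ultimately show ?thesis using Some 1(1) oh
      by (simp add: oracle_cell_def flip: of_nat_diff)
  qed
qed

lemma ev_oracle_cell_complete:
  assumes r: "abstracts k M r c"
    and Q: "\<And>b. (spec k (oracle_query k (unpacked k r (ntapes M))) \<longleftrightarrow> b = Plus) \<Longrightarrow>
      Q (oracle_query k (unpacked k r (ntapes M))) b"
  shows "ev Q (oracle_scl k (oracle_cell true_arithmetic (ohead c))) (unpacked k r (ntapes M)) Plus"
proof -
  let ?r = "unpacked k r (ntapes M)"
  have pos: "?r (vr k RPos) = r (vr k RPos)" "?r (vr k RNeg) = r (vr k RNeg)"
    by (simp_all add: unpacked_other)
  have oh: "ohead c = int (r (vr k RPos)) - int (r (vr k RNeg))" using r by (simp add: abstracts_def)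
  show ?thesis
  proof (cases "ohead c < 0")
    case True
    then show ?thesis using pos oh by (simp add: oracle_cell_def)
  next
    case False
    then have le: "r (vr k RNeg) \<le> r (vr k RPos)" "nat (ohead c) = r (vr k RPos) - r (vr k RNeg)"
      using oh by auto
    have "spec k (oracle_query k ?r) \<longleftrightarrow> nat (ohead c) \<in> true_arithmetic"
      by (simp add: spec_def oracle_query_def prenex_true_empty pos le(2))
    then have "Q (oracle_query k ?r) (if nat (ohead c) \<in> true_arithmetic then Plus else Minus)"
      by (intro Q) auto
    moreover have "oracle_cell true_arithmetic (ohead c) = Some (nat (ohead c) \<in> true_arithmetic)"
      using False by (simp add: oracle_cell_def)
    ultimately show ?thesis using le(1) pos by (simp only: ev_oracle_scl)
  qed
qed

section \<open>Acceptance by the machine and stages of the loop\<close>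

definition accepts :: "otm \<Rightarrow> nat set \<Rightarrow> config \<Rightarrow> bool" where
  "accepts M A c \<longleftrightarrow> (\<exists>t. state ((step M A ^^ t) c) = accept M)"

lemma accepts_step: "accepts M A (step M A c) \<Longrightarrow> accepts M A c"
  unfolding accepts_def by (metis comp_apply funpow_Suc_right)

lemma halted_funpow:
  "state c = accept M \<or> state c = reject M \<Longrightarrow> (step M A ^^ t) c = c"
  by (induction t) (auto simp: step_def)

text \<open>Halted configurations are fixed points, so a run cannot visit both halting
  states.\<close>

lemma accepts_iff:
  assumes "\<exists>t. state ((step M A ^^ t) c) = (if P then accept M else reject M)" "wf_otm M"
  shows "accepts M A c \<longleftrightarrow> P"
proof
  assume "accepts M A c"
  then obtain t where t: "state ((step M A ^^ t) c) = accept M" unfolding accepts_def by blast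
  show P
  proof (rule ccontr)
    assume "\<not> P"
    then obtain u where u: "state ((step M A ^^ u) c) = reject M" using assms(1) by auto
    have "(step M A ^^ (u + t)) c = (step M A ^^ t) c" "(step M A ^^ (t + u)) c = (step M A ^^ u) c"
      using t u halted_funpow[where c = "(step M A ^^ t) c" and t = u]
        halted_funpow[where c = "(step M A ^^ u) c" and t = t]
      by (simp_all add: funpow_add)
    then have "accept M = reject M" using t u by (simp add: add.commute)
    then show False using assms(2) by (simp add: wf_otm_def)
  qed
qed (use assms(1) in \<open>auto simp: accepts_def\<close>)

context
  fixes k :: nat and M :: otm and \<psi> :: scl
  assumes M: "wf_otm M"
begin

abbreviation body :: scl where
  "body \<equiv> truth_body k (run_scl k M) \<psi>"

lemma ev_body_run: "r (vr k RMode) = 0 \<Longrightarrow> ev Q body r b \<longleftrightarrow> ev Q (run_scl k M) r b"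
  by (simp add: truth_body_def)

text \<open>Each recursion in mode 0 is one machine step. However small the stage left for a query
  is, a win in it is sound.\<close>

lemma accepts_if_stage:
  "stage body m r Plus \<Longrightarrow> abstracts k M r c \<Longrightarrow> accepts M true_arithmetic c"
proof (induction m arbitrary: r c)
  case 0
  have "ev (\<lambda>_ _. False) (run_scl k M) r Plus"
    using 0 ev_body_run[of r] by (simp add: abstracts_def)
  then have "state c = accept M" unfolding ev_run_scl[OF M 0(2)] by blast
  then show ?case unfolding accepts_def by (intro exI[of _ 0]) simp
next
  case (Suc m)
  let ?r = "unpacked k r (ntapes M)" and ?v = "map (\<lambda>t. tape c t (head c t)) [0..<ntapes M]"
  have "ev (stage body m) (run_scl k M) r Plus"
    using Suc.prems ev_body_run[of r] by (simp add: abstracts_def)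
  then consider "state c = accept M"
    | o' where "state c \<noteq> accept M" "state c \<noteq> reject M" "ev (stage body m) (oracle_scl k o') ?r Plus"
      "stage body m (branch_result k M ?r (state c, ?v, o')) Plus"
    unfolding ev_run_scl[OF M Suc.prems(2)] by blast
  then show ?case
  proof cases
    case 1
    then show ?thesis unfolding accepts_def by (intro exI[of _ 0]) simp
  next
    case 2
    have "spec k r' \<longleftrightarrow> b = Plus" if "r' (vr k RMode) = 1" "stage body m r' b" for r' b
      by (rule stage_truth_body_iff[OF _ that(2)]) (simp add: that(1))
    then have "o' = oracle_cell true_arithmetic (ohead c)"
      using ev_oracle_cell[OF Suc.prems(2) _ 2(3)] by blast
    then show ?thesis
      using Suc.IH[OF 2(4)] abstracts_step[OF M Suc.prems(2) 2(1,2)] accepts_step by blast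
  qed
qed

text \<open>The clock has to cover both the rest of the run and the rank of the current query;
  monotonicity permits the maximum.\<close>

lemma stage_if_accepts:
  "state ((step M true_arithmetic ^^ t) c) = accept M \<Longrightarrow> abstracts k M r c \<Longrightarrow> \<exists>m. stage body m r Plus"
proof (induction t arbitrary: r c)
  case 0
  then have "ev (\<lambda>_ _. False) (run_scl k M) r Plus" unfolding ev_run_scl[OF M 0(2)] by simp
  then have "stage body 0 r Plus" using ev_body_run 0(2) by (simp add: abstracts_def)
  then show ?case by blast
next
  case (Suc t)
  let ?r = "unpacked k r (ntapes M)" and ?v = "map (\<lambda>t. tape c t (head c t)) [0..<ntapes M]"
  have run: "stage body (Suc m) r Plus" if "ev (stage body m) (run_scl k M) r Plus" for m
    using that ev_body_run Suc.prems(2) by (simp add: abstracts_def)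
  show ?case
  proof (cases "state c = accept M \<or> state c = reject M")
    case True
    then have "state c = accept M" using Suc.prems(1) by (metis halted_funpow)
    then show ?thesis using run[of 0] unfolding ev_run_scl[OF M Suc.prems(2)] by blast
  next
    case False
    let ?b = "branch_result k M ?r (state c, ?v, oracle_cell true_arithmetic (ohead c))"
    let ?q = "oracle_query k ?r"
    have "state ((step M true_arithmetic ^^ t) (step M true_arithmetic c)) = accept M"
      using Suc.prems(1) by (simp only: funpow_Suc_right comp_apply)
    then obtain m where m: "stage body m ?b Plus"
      using Suc.IH abstracts_step[OF M Suc.prems(2), of true_arithmetic] False by blast
    define m' where "m' = max m (rank k ?q)"
    have "stage body m' ?b Plus" using m by (rule stage_mono) (simp add: m'_def)
    moreover have "ev (stage body m') (oracle_scl k (oracle_cell true_arithmetic (ohead c))) ?r Plus"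
    proof (rule ev_oracle_cell_complete[OF Suc.prems(2)])
      fix b assume "spec k ?q \<longleftrightarrow> b = Plus"
      then show "stage body m' ?q b"
        by (intro stage_truth_body) (simp_all add: oracle_query_def m'_def)
    qed
    ultimately have "ev (stage body m') (run_scl k M) r Plus"
      unfolding ev_run_scl[OF M Suc.prems(2)] using False by blast
    then show ?thesis using run by blast
  qed
qed

lemma stage_iff_accepts:
  "abstracts k M r c \<Longrightarrow> (\<exists>m. stage body m r Plus) \<longleftrightarrow> accepts M true_arithmetic c"
  using accepts_if_stage stage_if_accepts unfolding accepts_def by blast

end

section \<open>Loading the input and assembling the formula\<close>

lemma ev_switch:
  "ev Q (switch x i \<phi>s d) r b \<longleftrightarrow>
    (if i \<le> r x \<and> r x < i + length \<phi>s then ev Q (\<phi>s ! (r x - i)) r b else ev Q d r b)"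
proof (induction \<phi>s arbitrary: i)
  case (Cons \<phi> \<phi>s)
  have "r x = i \<or> r x - i = Suc (r x - Suc i) \<or> r x < i" by arith
  then show ?case using Cons[of "Suc i"] by auto
qed auto

text \<open>
  In mode \<open>6 + j\<close> the inputs from \<open>j\<close> on are already on tape 0, preceded by one superfluous blank
  which mode 6 removes; mode \<open>7 + j\<close> pushes the input \<open>j\<close> in unary.
\<close>

definition push_scl :: "nat \<Rightarrow> nat \<Rightarrow> scl \<Rightarrow> scl" where
  "push_scl k w \<phi> = Assign (vr k (RT 0)) (num w) (MkPair (vr k (RT 0)) (vr k (RRight 0)) (vr k (RT 1))
     (Assign (vr k (RRight 0)) (Var (vr k (RT 1))) \<phi>))"

definition init_scl :: "nat \<Rightarrow> nat \<Rightarrow> scl" where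
  "init_scl k n = switch (vr k RMode) 6
     (Unpair (vr k (RRight 0)) (vr k (RT 0)) (vr k (RT 1))
        (Assign (vr k (RRight 0)) (Var (vr k (RT 1))) (Assign (vr k RMode) Zero (Claim 0))) #
      map (\<lambda>j. Ite (Equal (Var (vr k (RIn j))) Zero)
         (push_scl k 0 (Assign (vr k RMode) (num (6 + j)) (Claim 0)))
         (Pred (vr k (RIn j)) (vr k (RT 2)) (Assign (vr k (RIn j)) (Var (vr k (RT 2)))
           (push_scl k 1 (Claim 0))))) [0..<n])
     (Atom Falsum)"

definition pushed :: "nat \<Rightarrow> nat \<Rightarrow> assignment \<Rightarrow> assignment" where
  "pushed k w r = r(vr k (RT 0) := w, vr k (RT 1) := prod_encode (w, r (vr k (RRight 0))),
     vr k (RRight 0) := prod_encode (w, r (vr k (RRight 0))))"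

lemma ev_push_scl: "ev Q (push_scl k w \<phi>) r b \<longleftrightarrow> ev Q \<phi> (pushed k w r) b"
  by (simp add: push_scl_def pushed_def)

lemma loop_body_init_scl: "loop_body (init_scl k n)"
proof -
  have "loop_body (switch x i \<phi>s d) \<longleftrightarrow> (\<forall>\<phi>\<in>set \<phi>s. loop_body \<phi>) \<and> loop_body d" for x i \<phi>s d
    by (induction \<phi>s arbitrary: i) auto
  then show ?thesis by (auto simp: init_scl_def push_scl_def)
qed

text \<open>Inputs below \<open>j\<close> still wait in their registers; \<open>ws\<close> is the
  word pushed so far.\<close>

definition initial :: "nat \<Rightarrow> otm \<Rightarrow> nat list \<Rightarrow> nat \<Rightarrow> nat list \<Rightarrow> assignment \<Rightarrow> bool" where
  "initial k M xs j ws r \<longleftrightarrow> r (vr k RMode) = 6 + j \<and> (\<forall>i<j. r (vr k (RIn i)) = xs ! i) \<and>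
     r (vr k RState) = start M \<and> r (vr k RPos) = 0 \<and> r (vr k RNeg) = 0 \<and>
     r (vr k (RRight 0)) = push ws 0 \<and>
     (\<forall>t<ntapes M. r (vr k (RLeft t)) = 0 \<and> (t > 0 \<longrightarrow> r (vr k (RRight t)) = 0))"

context
  fixes k :: nat and M :: otm and xs :: "nat list"
  assumes M: "wf_otm M"
begin

abbreviation loop :: scl where
  "loop \<equiv> truth_body k (run_scl k M) (init_scl k (length xs))"

lemma ev_loop_init:
  "r (vr k RMode) \<ge> 6 \<Longrightarrow> ev Q loop r b \<longleftrightarrow> ev Q (init_scl k (length xs)) r b"
  by (simp add: truth_body_def)

text \<open>With a single forced continuation, the two assignments differ by one unit of the
  clock.\<close>

lemma stage_forward:
  assumes "\<And>Q. ev Q loop r Plus \<longleftrightarrow> Q r' Plus"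
  shows "(\<exists>m. stage loop m r Plus) \<longleftrightarrow> (\<exists>m. stage loop m r' Plus)"
proof
  assume "\<exists>m. stage loop m r Plus"
  then obtain m where "stage loop m r Plus" by blast
  then show "\<exists>m. stage loop m r' Plus" using assms by (cases m) auto
next
  assume "\<exists>m. stage loop m r' Plus"
  then obtain m where "stage loop m r' Plus" by blast
  then have "stage loop (Suc m) r Plus" using assms by simp
  then show "\<exists>m. stage loop m r Plus" by blast
qed

lemma abstracts_init:
  assumes "initial k M xs 0 (0 # input_word xs) r"
  shows "abstracts k M (r(vr k (RT 0) := 0, vr k (RT 1) := push (input_word xs) 0,
    vr k (RRight 0) := push (input_word xs) 0, vr k RMode := 0)) (init_config M xs)"
proof -
  let ?W = "input_word xs"
  have W: "\<forall>w\<in>set ?W. w \<le> 1" by (auto simp: input_word_def)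
  have "?W ! i < nsymbols M" if "i < length ?W" for i
  proof -
    have "?W ! i \<le> 1" using W that nth_mem by blast
    then show ?thesis using M by (simp add: wf_otm_def)
  qed
  moreover have "0 < nsymbols M" "start M < nstates M" using M by (simp_all add: wf_otm_def)
  ultimately show ?thesis
    using assms by (auto simp: abstracts_def initial_def init_config_def represents_def cell_push)
qed

lemma stage_initial:
  assumes "initial k M xs j (0 # input_word (drop j xs)) r" "j \<le> length xs"
  shows "(\<exists>m. stage loop m r Plus) \<longleftrightarrow> accepts M true_arithmetic (init_config M xs)"
  using assms
proof (induction j arbitrary: r)
  case 0
  let ?r = "r(vr k (RT 0) := 0, vr k (RT 1) := push (input_word xs) 0,
    vr k (RRight 0) := push (input_word xs) 0, vr k RMode := 0)"
  have init: "initial k M xs 0 (0 # input_word xs) r" using 0 by simp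
  then have "ev Q loop r Plus \<longleftrightarrow> Q ?r Plus" for Q
    by (subst ev_loop_init) (simp_all add: initial_def init_scl_def)
  from stage_forward[OF this] stage_iff_accepts[OF M abstracts_init[OF init]]
  show ?case by simp
next
  case (Suc j)
  let ?W = "0 # input_word (drop (Suc j) xs)"
  note IH = Suc.IH
  have j_le: "j \<le> length xs" using Suc.prems(2) by simp
  have j: "drop j xs = xs ! j # drop (Suc j) xs" using Suc.prems(2) by (simp add: Cons_nth_drop_Suc)
  have ev: "ev Q loop r Plus \<longleftrightarrow> (if r (vr k (RIn j)) = 0 then Q ((pushed k 0 r)(vr k RMode := 6 + j)) Plus
      else Q (pushed k 1 (r(vr k (RT 2) := r (vr k (RIn j)) - 1, vr k (RIn j) := r (vr k (RIn j)) - 1))) Plus)"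
    if "r (vr k RMode) = 7 + j" for Q r
    using Suc.prems(2) that
    by (subst ev_loop_init) (simp_all add: init_scl_def ev_switch ev_push_scl del: switch.simps)
  \<comment> \<open>Inner induction on what is left of input \<open>j\<close>, with \<open>a\<close>
    units already on the tape. The invariant is stated for mode \<open>6 + j\<close>, which is
    entered when the register is empty.\<close>
  have "(\<exists>m. stage loop m r Plus) \<longleftrightarrow> accepts M true_arithmetic (init_config M xs)"
    if "initial k M xs j (replicate a 1 @ ?W) (r(vr k RMode := 6 + j))" "r (vr k RMode) = 7 + j"
      "a + r (vr k (RIn j)) = xs ! j" for a r
    using that
  proof (induction "r (vr k (RIn j))" arbitrary: r a)
    case 0
    let ?r = "(pushed k 0 r)(vr k RMode := 6 + j)"
    have "ev Q loop r Plus \<longleftrightarrow> Q ?r Plus" for Q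
      using ev[where r = r, OF 0(3)] 0(1) by simp
    note fw = stage_forward[OF this]
    have "initial k M xs j (0 # input_word (drop j xs)) ?r"
      using 0 j by (auto simp: initial_def pushed_def input_word_def)
    then show ?case unfolding fw by (rule IH[OF _ j_le])
  next
    case (Suc x)
    let ?r = "pushed k 1 (r(vr k (RT 2) := r (vr k (RIn j)) - 1, vr k (RIn j) := r (vr k (RIn j)) - 1))"
    have "ev Q loop r Plus \<longleftrightarrow> Q ?r Plus" for Q
      using ev[where r = r, OF Suc.prems(2)] Suc.hyps(2) by simp
    note fw = stage_forward[OF this]
    have 1: "initial k M xs j (replicate (Suc a) 1 @ ?W) (?r(vr k RMode := 6 + j))"
      using Suc.prems(1) by (auto simp: initial_def pushed_def)
    have 2: "x = ?r (vr k (RIn j))" "?r (vr k RMode) = 7 + j" "Suc a + ?r (vr k (RIn j)) = xs ! j"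
      using Suc.hyps(2) Suc.prems by (auto simp: pushed_def)
    show ?case unfolding fw by (rule Suc.hyps(1)[where a = "Suc a"]) (fact 2 | fact 1)+
  qed
  from this[of 0 r] Suc.prems show ?case by (auto simp: initial_def)
qed

end

lemma scl_free_foldr_Exists: "scl_free (foldr Exists xs \<phi>) = scl_free \<phi> - set xs"
  by (induction xs) auto

lemma finite_scl_free: "finite (scl_free \<phi>)"
  by (induction \<phi>) (auto simp: finite_atom_vars)

text \<open>The registers \<open>RIn j\<close> with \<open>k \<le> j\<close> are left open: their
  values become the existential witnesses \<open>ys\<close>.\<close>

definition start_scl :: "nat \<Rightarrow> otm \<Rightarrow> nat \<Rightarrow> scl" where
  "start_scl k M n = scl_Conj
     ([Atom (Equal (Var (vr k RMode)) (num (6 + n))), Atom (Equal (Var (vr k RState)) (num (start M))),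
       Atom (Equal (Var (vr k RPos)) Zero), Atom (Equal (Var (vr k RNeg)) Zero),
       Atom (Equal (Var (vr k (RRight 0))) Zero)] @
      map (\<lambda>t. Atom (Equal (Var (vr k (RLeft t))) Zero)) [0..<ntapes M] @
      map (\<lambda>t. Atom (Equal (Var (vr k (RRight t))) Zero)) [0..<ntapes M] @
      map (\<lambda>j. Atom (Equal (Var (vr k (RIn j))) (Var j))) [0..<k])"

lemma ev_start_scl:
  "ev Q (start_scl k M n) r Plus \<longleftrightarrow> r (vr k RMode) = 6 + n \<and> r (vr k RState) = start M \<and>
     r (vr k RPos) = 0 \<and> r (vr k RNeg) = 0 \<and> r (vr k (RRight 0)) = 0 \<and>
     (\<forall>t<ntapes M. r (vr k (RLeft t)) = 0 \<and> r (vr k (RRight t)) = 0) \<and>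
     (\<forall>j<k. r (vr k (RIn j)) = r j)"
  by (auto simp: start_scl_def ball_Un)

theorem definable_if_sigma:
  assumes "sigma_omega_plus_1 k X"
  shows "bndscl_definable k X"
proof -
  obtain l R where X: "X \<subseteq> {xs. length xs = k}" and comp: "computable_in true_arithmetic (k + l) R"
    and XR: "\<And>xs. length xs = k \<Longrightarrow> xs \<in> X \<longleftrightarrow> (\<exists>ys. length ys = l \<and> xs @ ys \<in> R)"
    using assms unfolding sigma_omega_plus_1_def by blast
  obtain M where M: "wf_otm M" and MR: "\<And>xs. length xs = k + l \<Longrightarrow>
      \<exists>t. state ((step M true_arithmetic ^^ t) (init_config M xs)) = (if xs \<in> R then accept M else reject M)"
    using comp unfolding computable_in_def by blast
  define B where "B = truth_body k (run_scl k M) (init_scl k (k + l))"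
  define \<theta> where "\<theta> = Conj (start_scl k M (k + l)) (Label 0 B)"
  \<comment> \<open>The prefix has to bind every free variable of \<open>\<theta>\<close> except the
    parameters, and all listed registers must receive their values through it.\<close>
  have "finite (scl_free \<theta> \<union> vr k ` ({RMode, RState, RPos, RNeg} \<union> RIn ` {..<k + l} \<union>
      RLeft ` {..<ntapes M} \<union> RRight ` {..<Suc (ntapes M)}))"
    by (simp add: finite_scl_free)
  then obtain N where "\<forall>x\<in>scl_free \<theta> \<union> vr k ` ({RMode, RState, RPos, RNeg} \<union> RIn ` {..<k + l} \<union>
      RLeft ` {..<ntapes M} \<union> RRight ` {..<Suc (ntapes M)}). x < N"
    unfolding finite_nat_set_iff_bounded by blast
  then have N: "scl_free \<theta> \<subseteq> {..<N}" "vr k RMode < N" "vr k RState < N" "vr k RPos < N" "vr k RNeg < N"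
    "\<And>j. j < k + l \<Longrightarrow> vr k (RIn j) < N" "\<And>t. t < ntapes M \<Longrightarrow> vr k (RLeft t) < N"
    "vr k (RRight 0) < N" "\<And>t. t < ntapes M \<Longrightarrow> vr k (RRight t) < N"
    by auto
  define \<Phi> where "\<Phi> = foldr Exists [k..<N] \<theta>"
  have "models_omega (\<lambda>i. if i < k then ms ! i else 0) \<Phi> \<longleftrightarrow> ms \<in> X" if ms: "length ms = k" for ms
  proof -
    let ?s = "\<lambda>i. if i < k then ms ! i else 0"
    let ?r = "\<lambda>f x. if k \<le> x \<and> x < N then f x else ?s x"
    have "claim_free (start_scl k M (k + l))" "loop_body B"
      by (auto simp: start_scl_def B_def loop_body_truth_body loop_body_run_scl loop_body_init_scl)
    then have models: "models_omega ?s \<Phi> \<longleftrightarrow>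
        (\<exists>f. ev (\<lambda>_ _. False) (start_scl k M (k + l)) (?r f) Plus \<and> (\<exists>m. stage B m (?r f) Plus))"
      unfolding \<Phi>_def \<theta>_def by (subst models_omega_loop) (simp_all only: Let_def)
    have init: "initial k M (ms @ ys) (k + l) (0 # input_word (drop (k + l) (ms @ ys))) r"
      if start: "ev (\<lambda>_ _. False) (start_scl k M (k + l)) r Plus" and ys: "length ys = l"
        and inputs: "\<And>i. i < k \<Longrightarrow> r i = ms ! i" "\<And>i. i < l \<Longrightarrow> r (vr k (RIn (k + i))) = ys ! i"
      for r ys
    proof -
      have "r (vr k (RIn i)) = (ms @ ys) ! i" if "i < k + l" for i
      proof (cases "i < k")
        case True
        then have "r (vr k (RIn i)) = r i" using start by (simp add: ev_start_scl)
        then show ?thesis using True inputs(1) ms by (simp add: nth_append)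
      next
        case False
        then show ?thesis using inputs(2)[of "i - k"] that ms
          by (simp add: nth_append)
      qed
      moreover have "prod_encode (0, 0) = 0" by (simp add: prod_encode_def)
      ultimately show ?thesis using start ys ms
        by (auto simp: initial_def ev_start_scl input_word_def)
    qed
    have acc: "(\<exists>m. stage B m r Plus) \<longleftrightarrow> ms @ ys \<in> R"
      if "initial k M (ms @ ys) (k + l) (0 # input_word (drop (k + l) (ms @ ys))) r" "length ys = l" for r ys
      using stage_initial[OF M that(1)] that(2) ms accepts_iff[OF MR M, of "ms @ ys"]
      by (simp add: B_def)
    show ?thesis
    proof
      assume "models_omega ?s \<Phi>"
      then obtain f where f: "ev (\<lambda>_ _. False) (start_scl k M (k + l)) (?r f) Plus" "\<exists>m. stage B m (?r f) Plus"
        unfolding models by blast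
      define ys where "ys = map (\<lambda>i. ?r f (vr k (RIn (k + i)))) [0..<l]"
      have "ms @ ys \<in> R"
        using acc[OF init[OF f(1)]] f(2) by (simp add: ys_def)
      then show "ms \<in> X" using XR[OF ms] by (auto simp: ys_def)
    next
      assume "ms \<in> X"
      then obtain ys where ys: "length ys = l" "ms @ ys \<in> R" using XR[OF ms] by blast
      define g where "g X = (case X of RMode \<Rightarrow> 6 + (k + l) | RState \<Rightarrow> start M
        | RIn j \<Rightarrow> (ms @ ys) ! j | _ \<Rightarrow> 0)" for X
      \<comment> \<open>\<open>from_nat\<close> recovers the register from the number of its
        variable.\<close>
      define f where "f x = g (from_nat (x - k))" for x
      have f: "?r f (vr k X) = g X" if "vr k X < N" for X
        using that by (simp add: f_def vr_def)
      have start: "ev (\<lambda>_ _. False) (start_scl k M (k + l)) (?r f) Plus"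
        unfolding ev_start_scl using f N ms by (auto simp: g_def nth_append)
      have "initial k M (ms @ ys) (k + l) (0 # input_word (drop (k + l) (ms @ ys))) (?r f)"
        using f N ms ys(1) by (intro init[OF start]) (auto simp: g_def nth_append)
      then show "models_omega ?s \<Phi>"
        unfolding models using start acc ys by blast
    qed
  qed
  moreover have "scl_free \<Phi> \<subseteq> {..<k}"
    using N(1) by (auto simp: \<Phi>_def scl_free_foldr_Exists not_le)
  ultimately show ?thesis using X unfolding bndscl_definable_def by blast
qed

theorem theorem7p6:
  fixes k :: nat and X :: "nat list set"
  assumes "X \<subseteq> {xs. length xs = k}"
  shows "bndscl_definable k X \<longleftrightarrow> sigma_omega_plus_1 k X"
  using sigma_if_definable definable_if_sigma by blast

end
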